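(* Let $G$ be a locally compact Hausdorff étale groupoid. Assume that $G$ is effective. Then the centralizer of $\mathrm{Aut}_{C_0(G^{(0)})}(C^*_r(G))$ in $\mathrm{Aut}(C^*_r(G))$ is contained in $\mathrm{Aut}(C^*_r(G); C_0(G^{(0)}))$. In particular, if $G$ is effective and $G$ has enough arrows, then $\mathrm{Aut}_{C_0(G^{(0)})}(C^*_r(G))$ is a maximal abelian subgroup of $\mathrm{Aut}(C^*_r(G))$.
   Context: For a groupoid $G$, $G^{(0)}$ is the unit space, and $d,r\colon G\to G^{(0)}$ are the domain and range maps. A topological groupoid is étale if $d$ is a local homeomorphism. $G$ is effective if $G^{(0)}$ equals the interior of $\mathrm{Iso}(G)=\{\alpha\in G: d(\alpha)=r(\alpha)\}$. $G$ has enough arrows if for every nonempty open set $U\subset G^{(0)}$ there exists $\alpha\in G\setminus G^{(0)}$ with $d(\alpha)\in U$. $C^*_r(G)$ is the reduced groupoid C*-algebra (the completion of the convolution *-algebra $C_c(G)$ in the reduced norm), and $C_0(G^{(0)})\subset C^*_r(G)$ is the canonical C*-subalgebra. For a C*-algebra $A$ and a C*-subalgebra $B\subset A$, $\mathrm{Aut}(A)$ is the group of *-automorphisms of $A$, $\mathrm{Aut}(A;B)=\{\varphi\in\mathrm{Aut}(A): \varphi(B)=B\}$, and $\mathrm{Aut}_B(A)=\{\varphi\in\mathrm{Aut}(A):\varphi(b)=b\text{ for all }b\in B\}$. *)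

theory Defs
  imports "HOL-Analysis.Analysis" "HOL-Algebra.Bij"
begin

section \<open>Topological groupoids\<close>

text \<open>The set of arrows is the underlying set of the topology, and units are identified with
  identity arrows. Outside the arrows, and on non-composable pairs, the operations are
  unspecified.\<close>

record 'g topological_groupoid_data =
  gtop :: "'g topology"
  gdom :: "'g \<Rightarrow> 'g"
  gran :: "'g \<Rightarrow> 'g"
  gmult :: "'g \<Rightarrow> 'g \<Rightarrow> 'g"
  ginv :: "'g \<Rightarrow> 'g"

definition arrows :: "('g, 'm) topological_groupoid_data_scheme \<Rightarrow> 'g set" where
  "arrows G = topspace (gtop G)"

definition units :: "('g, 'm) topological_groupoid_data_scheme \<Rightarrow> 'g set" where
  "units G = gdom G ` arrows G"

definition unit_space :: "('g, 'm) topological_groupoid_data_scheme \<Rightarrow> 'g topology" where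
  "unit_space G = subtopology (gtop G) (units G)"

locale groupoid =
  fixes G :: "('g, 'm) topological_groupoid_data_scheme" (structure)
  assumes dom_closed: "\<alpha> \<in> arrows G \<Longrightarrow> gdom G \<alpha> \<in> arrows G"
    and ran_closed: "\<alpha> \<in> arrows G \<Longrightarrow> gran G \<alpha> \<in> arrows G"
    and dom_dom: "\<alpha> \<in> arrows G \<Longrightarrow> gdom G (gdom G \<alpha>) = gdom G \<alpha>"
    and ran_dom: "\<alpha> \<in> arrows G \<Longrightarrow> gran G (gdom G \<alpha>) = gdom G \<alpha>"
    and dom_ran: "\<alpha> \<in> arrows G \<Longrightarrow> gdom G (gran G \<alpha>) = gran G \<alpha>"
    and ran_ran: "\<alpha> \<in> arrows G \<Longrightarrow> gran G (gran G \<alpha>) = gran G \<alpha>"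
    and mult_closed: "\<lbrakk>\<alpha> \<in> arrows G; \<beta> \<in> arrows G; gdom G \<alpha> = gran G \<beta>\<rbrakk>
          \<Longrightarrow> gmult G \<alpha> \<beta> \<in> arrows G"
    and dom_mult: "\<lbrakk>\<alpha> \<in> arrows G; \<beta> \<in> arrows G; gdom G \<alpha> = gran G \<beta>\<rbrakk>
          \<Longrightarrow> gdom G (gmult G \<alpha> \<beta>) = gdom G \<beta>"
    and ran_mult: "\<lbrakk>\<alpha> \<in> arrows G; \<beta> \<in> arrows G; gdom G \<alpha> = gran G \<beta>\<rbrakk>
          \<Longrightarrow> gran G (gmult G \<alpha> \<beta>) = gran G \<alpha>"
    and mult_assoc: "\<lbrakk>\<alpha> \<in> arrows G; \<beta> \<in> arrows G; \<gamma> \<in> arrows G;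
            gdom G \<alpha> = gran G \<beta>; gdom G \<beta> = gran G \<gamma>\<rbrakk>
          \<Longrightarrow> gmult G (gmult G \<alpha> \<beta>) \<gamma> = gmult G \<alpha> (gmult G \<beta> \<gamma>)"
    and mult_dom: "\<alpha> \<in> arrows G \<Longrightarrow> gmult G \<alpha> (gdom G \<alpha>) = \<alpha>"
    and ran_times: "\<alpha> \<in> arrows G \<Longrightarrow> gmult G (gran G \<alpha>) \<alpha> = \<alpha>"
    and inv_closed: "\<alpha> \<in> arrows G \<Longrightarrow> ginv G \<alpha> \<in> arrows G"
    and dom_inv: "\<alpha> \<in> arrows G \<Longrightarrow> gdom G (ginv G \<alpha>) = gran G \<alpha>"
    and ran_inv: "\<alpha> \<in> arrows G \<Longrightarrow> gran G (ginv G \<alpha>) = gdom G \<alpha>"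
    and inv_mult: "\<alpha> \<in> arrows G \<Longrightarrow> gmult G (ginv G \<alpha>) \<alpha> = gdom G \<alpha>"
    and mult_inv: "\<alpha> \<in> arrows G \<Longrightarrow> gmult G \<alpha> (ginv G \<alpha>) = gran G \<alpha>"

locale topological_groupoid = groupoid +
  assumes continuous_mult:
      "continuous_map
         (subtopology (prod_topology (gtop G) (gtop G)) {(\<alpha>, \<beta>). gdom G \<alpha> = gran G \<beta>})
         (gtop G) (\<lambda>(\<alpha>, \<beta>). gmult G \<alpha> \<beta>)"
    and continuous_inv: "continuous_map (gtop G) (gtop G) (ginv G)"

definition local_homeomorphism_map :: "'a topology \<Rightarrow> 'b topology \<Rightarrow> ('a \<Rightarrow> 'b) \<Rightarrow> bool" where
  "local_homeomorphism_map X Y f \<longleftrightarrow>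
     f \<in> topspace X \<rightarrow> topspace Y \<and>
     (\<forall>x \<in> topspace X. \<exists>U. openin X U \<and> x \<in> U \<and> openin Y (f ` U) \<and>
        homeomorphic_map (subtopology X U) (subtopology Y (f ` U)) f)"

locale etale_groupoid = topological_groupoid +
  assumes local_homeomorphism_dom:
    "local_homeomorphism_map (gtop G) (unit_space G) (gdom G)"

definition isotropy :: "('g, 'm) topological_groupoid_data_scheme \<Rightarrow> 'g set" where
  "isotropy G = {\<alpha> \<in> arrows G. gdom G \<alpha> = gran G \<alpha>}"

definition effective :: "('g, 'm) topological_groupoid_data_scheme \<Rightarrow> bool" where
  "effective G \<longleftrightarrow> units G = (gtop G) interior_of (isotropy G)"

definition enough_arrows :: "('g, 'm) topological_groupoid_data_scheme \<Rightarrow> bool" where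
  "enough_arrows G \<longleftrightarrow>
     (\<forall>U. openin (unit_space G) U \<and> U \<noteq> {} \<longrightarrow>
        (\<exists>\<alpha> \<in> arrows G - units G. gdom G \<alpha> \<in> U))"


section \<open>Normed *-algebras and their completions\<close>

record 'a normed_star_algebra = "'a partial_object" +
  add :: "'a \<Rightarrow> 'a \<Rightarrow> 'a"
  scale :: "complex \<Rightarrow> 'a \<Rightarrow> 'a"
  times :: "'a \<Rightarrow> 'a \<Rightarrow> 'a"
  star :: "'a \<Rightarrow> 'a"
  nrm :: "'a \<Rightarrow> real"

definition dst :: "('a, 'm) normed_star_algebra_scheme \<Rightarrow> 'a \<Rightarrow> 'a \<Rightarrow> real" where
  "dst A a b = nrm A (add A a (scale A (-1) b))"

definition cauchy_seqs :: "('a, 'm) normed_star_algebra_scheme \<Rightarrow> (nat \<Rightarrow> 'a) set" where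
  "cauchy_seqs A =
     {x. (\<forall>n. x n \<in> carrier A) \<and> (\<forall>e>0. \<exists>N. \<forall>m\<ge>N. \<forall>n\<ge>N. dst A (x m) (x n) < e)}"

definition cauchy_rel :: "('a, 'm) normed_star_algebra_scheme \<Rightarrow> (nat \<Rightarrow> 'a) rel" where
  "cauchy_rel A =
     {(x, y). x \<in> cauchy_seqs A \<and> y \<in> cauchy_seqs A \<and> (\<lambda>n. dst A (x n) (y n)) \<longlonglongrightarrow> 0}"

text \<open>The completion consists of Cauchy sequences modulo null sequences. The unions below
  range over the representatives of a class and all their members coincide.\<close>

definition completion ::
  "('a, 'm) normed_star_algebra_scheme \<Rightarrow> (nat \<Rightarrow> 'a) set normed_star_algebra" where
  "completion A =
     \<lparr>carrier = cauchy_seqs A // cauchy_rel A,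
      add = (\<lambda>X Y. \<Union>x\<in>X. \<Union>y\<in>Y. cauchy_rel A `` {\<lambda>n. add A (x n) (y n)}),
      scale = (\<lambda>c X. \<Union>x\<in>X. cauchy_rel A `` {\<lambda>n. scale A c (x n)}),
      times = (\<lambda>X Y. \<Union>x\<in>X. \<Union>y\<in>Y. cauchy_rel A `` {\<lambda>n. times A (x n) (y n)}),
      star = (\<lambda>X. \<Union>x\<in>X. cauchy_rel A `` {\<lambda>n. star A (x n)}),
      nrm = (\<lambda>X. THE l. \<forall>x\<in>X. (\<lambda>n. nrm A (x n)) \<longlonglongrightarrow> l)\<rparr>"


section \<open>The reduced groupoid C*-algebra\<close>

text \<open>Functions on a space are represented by functions on the whole type that vanish outside
  the space. With this convention \<open>C_c (unit_space G) \<subseteq> C_c (gtop G)\<close> for a Hausdorff etale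
  groupoid, since its unit space is then clopen.\<close>

definition C_c :: "'a topology \<Rightarrow> ('a \<Rightarrow> complex) set" where
  "C_c X = {f. continuous_map X euclidean f \<and> (\<forall>x. x \<notin> topspace X \<longrightarrow> f x = 0) \<and>
               compactin X (X closure_of {x \<in> topspace X. f x \<noteq> 0})}"

definition C_0 :: "'a topology \<Rightarrow> ('a \<Rightarrow> complex) set" where
  "C_0 X = {f. continuous_map X euclidean f \<and> (\<forall>x. x \<notin> topspace X \<longrightarrow> f x = 0) \<and>
               (\<forall>e>0. compactin X {x \<in> topspace X. e \<le> norm (f x)})}"

definition convolution ::
  "('g, 'm) topological_groupoid_data_scheme \<Rightarrow> ('g \<Rightarrow> complex) \<Rightarrow> ('g \<Rightarrow> complex) \<Rightarrow> 'g \<Rightarrow> complex"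
  where
  "convolution G f g \<alpha> =
     (if \<alpha> \<in> arrows G
      then \<Sum>\<^sub>\<infinity>\<beta>\<in>{\<beta> \<in> arrows G. gran G \<beta> = gran G \<alpha>}. f \<beta> * g (gmult G (ginv G \<beta>) \<alpha>)
      else 0)"

definition involution ::
  "('g, 'm) topological_groupoid_data_scheme \<Rightarrow> ('g \<Rightarrow> complex) \<Rightarrow> 'g \<Rightarrow> complex" where
  "involution G f \<alpha> = (if \<alpha> \<in> arrows G then cnj (f (ginv G \<alpha>)) else 0)"

definition source_fibre :: "('g, 'm) topological_groupoid_data_scheme \<Rightarrow> 'g \<Rightarrow> 'g set" where
  "source_fibre G x = {\<alpha> \<in> arrows G. gdom G \<alpha> = x}"

definition l2 :: "'a set \<Rightarrow> ('a \<Rightarrow> complex) set" where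
  "l2 S = {\<xi>. (\<forall>a. a \<notin> S \<longrightarrow> \<xi> a = 0) \<and> (\<lambda>a. (norm (\<xi> a))\<^sup>2) summable_on S}"

definition l2_norm :: "'a set \<Rightarrow> ('a \<Rightarrow> complex) \<Rightarrow> real" where
  "l2_norm S \<xi> = sqrt (\<Sum>\<^sub>\<infinity>a\<in>S. (norm (\<xi> a))\<^sup>2)"

definition regular_rep ::
  "('g, 'm) topological_groupoid_data_scheme \<Rightarrow> 'g \<Rightarrow> ('g \<Rightarrow> complex) \<Rightarrow> ('g \<Rightarrow> complex) \<Rightarrow> 'g \<Rightarrow> complex"
  where
  "regular_rep G x f \<xi> \<alpha> =
     (if \<alpha> \<in> source_fibre G x
      then \<Sum>\<^sub>\<infinity>\<beta>\<in>source_fibre G x. f (gmult G \<alpha> (ginv G \<beta>)) * \<xi> \<beta>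
      else 0)"

definition regular_rep_norm ::
  "('g, 'm) topological_groupoid_data_scheme \<Rightarrow> 'g \<Rightarrow> ('g \<Rightarrow> complex) \<Rightarrow> real" where
  "regular_rep_norm G x f =
     Sup {l2_norm (source_fibre G x) (regular_rep G x f \<xi>) | \<xi>.
            \<xi> \<in> l2 (source_fibre G x) \<and> l2_norm (source_fibre G x) \<xi> \<le> 1}"

text \<open>Inserting \<open>0\<close> only matters for the empty groupoid. For \<open>f \<in> C_c (gtop G)\<close> on an
  etale groupoid both suprema are over bounded sets.\<close>

definition reduced_norm ::
  "('g, 'm) topological_groupoid_data_scheme \<Rightarrow> ('g \<Rightarrow> complex) \<Rightarrow> real" where
  "reduced_norm G f = Sup (insert 0 ((\<lambda>x. regular_rep_norm G x f) ` units G))"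

definition convolution_algebra ::
  "('g, 'm) topological_groupoid_data_scheme \<Rightarrow> ('g \<Rightarrow> complex) normed_star_algebra" where
  "convolution_algebra G =
     \<lparr>carrier = C_c (gtop G),
      add = (\<lambda>f g \<alpha>. f \<alpha> + g \<alpha>),
      scale = (\<lambda>c f \<alpha>. c * f \<alpha>),
      times = convolution G,
      star = involution G,
      nrm = reduced_norm G\<rparr>"

definition reduced_Cstar ::
  "('g, 'm) topological_groupoid_data_scheme \<Rightarrow> (nat \<Rightarrow> 'g \<Rightarrow> complex) set normed_star_algebra"
  where
  "reduced_Cstar G = completion (convolution_algebra G)"

text \<open>The inclusion of \<open>C_c\<close> of the unit space into the convolution algebra is isometric from
  the supremum norm to the reduced norm. The canonical embedding of \<open>C_0\<close> of the unit space is
  its continuous extension: \<open>f\<close> is sent to the class of any sequence in \<open>C_c\<close> of the unit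
  space that converges uniformly to \<open>f\<close>.\<close>

definition C_0_embedding ::
  "('g, 'm) topological_groupoid_data_scheme \<Rightarrow> ('g \<Rightarrow> complex) \<Rightarrow> (nat \<Rightarrow> 'g \<Rightarrow> complex) set"
  where
  "C_0_embedding G f =
     cauchy_rel (convolution_algebra G) ``
       {y. (\<forall>n. y n \<in> C_c (unit_space G)) \<and> uniform_limit (units G) y f sequentially}"

definition C_0_units ::
  "('g, 'm) topological_groupoid_data_scheme \<Rightarrow> (nat \<Rightarrow> 'g \<Rightarrow> complex) set set" where
  "C_0_units G = C_0_embedding G ` C_0 (unit_space G)"


section \<open>Automorphism groups\<close>

text \<open>As in \<open>BijGroup\<close>, automorphisms are extensional functions on the carrier, so that
  automorphisms agreeing on the carrier are equal.\<close>

definition star_automorphisms :: "('a, 'm) normed_star_algebra_scheme \<Rightarrow> ('a \<Rightarrow> 'a) set" where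
  "star_automorphisms A =
     {\<phi> \<in> Bij (carrier A).
        (\<forall>a\<in>carrier A. \<forall>b\<in>carrier A. \<phi> (add A a b) = add A (\<phi> a) (\<phi> b)) \<and>
        (\<forall>c. \<forall>a\<in>carrier A. \<phi> (scale A c a) = scale A c (\<phi> a)) \<and>
        (\<forall>a\<in>carrier A. \<forall>b\<in>carrier A. \<phi> (times A a b) = times A (\<phi> a) (\<phi> b)) \<and>
        (\<forall>a\<in>carrier A. \<phi> (star A a) = star A (\<phi> a))}"

definition Aut :: "('a, 'm) normed_star_algebra_scheme \<Rightarrow> ('a \<Rightarrow> 'a) monoid" where
  "Aut A = BijGroup (carrier A) \<lparr>carrier := star_automorphisms A\<rparr>"

definition Aut_preserving ::
  "('a, 'm) normed_star_algebra_scheme \<Rightarrow> 'a set \<Rightarrow> ('a \<Rightarrow> 'a) set" where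
  "Aut_preserving A B = {\<phi> \<in> carrier (Aut A). \<phi> ` B = B}"

definition Aut_fixing ::
  "('a, 'm) normed_star_algebra_scheme \<Rightarrow> 'a set \<Rightarrow> ('a \<Rightarrow> 'a) set" where
  "Aut_fixing A B = {\<phi> \<in> carrier (Aut A). \<forall>b\<in>B. \<phi> b = b}"

definition centralizer :: "('a, 'm) monoid_scheme \<Rightarrow> 'a set \<Rightarrow> 'a set" where
  "centralizer \<Gamma> S = {g \<in> carrier \<Gamma>. \<forall>h\<in>S. g \<otimes>\<^bsub>\<Gamma>\<^esub> h = h \<otimes>\<^bsub>\<Gamma>\<^esub> g}"

definition abelian_subgroup :: "'a set \<Rightarrow> ('a, 'm) monoid_scheme \<Rightarrow> bool" where
  "abelian_subgroup H \<Gamma> \<longleftrightarrow> subgroup H \<Gamma> \<and> comm_group (\<Gamma>\<lparr>carrier := H\<rparr>)"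

definition maximal_abelian_subgroup :: "'a set \<Rightarrow> ('a, 'm) monoid_scheme \<Rightarrow> bool" where
  "maximal_abelian_subgroup H \<Gamma> \<longleftrightarrow>
     abelian_subgroup H \<Gamma> \<and> (\<forall>K. abelian_subgroup K \<Gamma> \<and> H \<subseteq> K \<longrightarrow> K = H)"

end

theory Submission
  imports Defs
begin

text \<open>Elements of the reduced algebra are identified with functions on \<open>G\<close>: the completion becomes the
  set \<open>redc\<close> of functions that are limits of \<open>C_c(G)\<close> in the norm of the regular representations, with
  products given by the convolution series, which converges since rows and columns are square summable.
  Under effectiveness \<open>C0 = C_0(units G)\<close> is its own commutant: if \<open>a\<close> commutes with \<open>C0\<close>, the open set \<open>a \<noteq> 0\<close>
  lies in the isotropy, hence in the units.

  If \<open>\<psi>\<close> centralizes the automorphisms fixing \<open>C0\<close>, it commutes with conjugation by every unitary \<open>u\<close> of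
  the unitization of \<open>C0\<close>. Conjugation by \<open>\<psi>(u)\<close> then fixes \<open>C0\<close>, so \<open>\<psi>(u)\<close> lies in the commutant of \<open>C0\<close>;
  applying this to Cayley transforms gives \<open>\<psi>(C0) = C0\<close>. Moreover \<open>u\<close> and \<open>\<psi>(u)\<close> define the same conjugation,
  so \<open>\<psi>(f) - f\<close> is invariant under arrows for \<open>f\<close> in \<open>C0\<close>; with enough arrows, multiplicativity of \<open>\<psi>\<close>
  then forces \<open>\<psi>(f) = f\<close>.

  Automorphisms fixing \<open>C0\<close> commute on functions supported on bisections, where they act through the
  elements \<open>\<phi>(m) m*\<close> of the commutant of \<open>C0\<close>. These functions span \<open>C_c(G)\<close>, and automorphisms are
  bounded because \<open>1 - a* a\<close> has a square root when \<open>a\<close> has small norm.\<close>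

section \<open>Bounded kernels on square-summable functions\<close>

text \<open>The algebra has no unit unless the unit space is compact, and automorphisms are given as
  purely algebraic maps. The first fact forces unitaries \<open>1 + d\<close> and their relations to
  be expanded into identities between elements of the algebra. It also forces the unitary multiplier
  that one would attach to an automorphism fixing \<open>C0\<close> to be replaced by damped
  elements \<phi>(m) m*; odd roots provide the spare factors m* m that the damping consumes. The
  second fact means that no limit may be passed through an automorphism before its boundedness is
  derived, and boundedness must itself come from a relation that an automorphism preserves. For the
  same reason functions of a self-adjoint f are taken to be Cayley transforms: these satisfy a
  polynomial equation, so the transform can be pushed through \<psi> and \<psi>(f) can be recovered
  from the image. A whole family with parameter t is used because a single unitary enters a
  conjugation only through the ratio of its values at the two ends of an arrow; varying t extracts
  from these ratios the difference of the values of f.\<close>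

abbreviation sq_summable_on :: "('a \<Rightarrow> complex) \<Rightarrow> 'a set \<Rightarrow> bool" (infixr "sq'_summable'_on" 46) where
  "\<xi> sq_summable_on S \<equiv> (\<lambda>a. (norm (\<xi> a))\<^sup>2) summable_on S"

lemma l2_norm_nonneg [simp]: "0 \<le> l2_norm S \<xi>"
  by (simp add: l2_norm_def infsum_nonneg)

lemma l2_norm_square: "(l2_norm S \<xi>)\<^sup>2 = (\<Sum>\<^sub>\<infinity>a\<in>S. (norm (\<xi> a))\<^sup>2)"
  by (simp add: l2_norm_def infsum_nonneg)

lemma L2_set_le_l2_norm:
  assumes "\<xi> sq_summable_on S" "finite F" "F \<subseteq> S"
  shows "L2_set (\<lambda>a. norm (\<xi> a)) F \<le> l2_norm S \<xi>"
  unfolding L2_set_def l2_norm_def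
  by (rule real_sqrt_le_mono, rule finite_sum_le_infsum) (use assms in auto)

lemma sq_summable_if_L2_set_le:
  assumes "\<And>F. finite F \<Longrightarrow> F \<subseteq> S \<Longrightarrow> L2_set (\<lambda>a. norm (\<xi> a)) F \<le> C"
  shows "\<xi> sq_summable_on S" and "l2_norm S \<xi> \<le> C"
proof -
  have C: "0 \<le> C" using assms[of "{}"] by simp
  have sq: "(\<Sum>a\<in>F. (norm (\<xi> a))\<^sup>2) \<le> C\<^sup>2" if "finite F" "F \<subseteq> S" for F
    using assms[OF that] C unfolding L2_set_def
    by (metis real_sqrt_le_iff real_sqrt_unique)
  then show s: "\<xi> sq_summable_on S"
    by (intro nonneg_bdd_above_summable_on) (auto intro!: bdd_aboveI2)
  have "(\<Sum>\<^sub>\<infinity>a\<in>S. (norm (\<xi> a))\<^sup>2) \<le> C\<^sup>2"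
    by (rule infsum_le_finite_sums[OF s sq])
  then show "l2_norm S \<xi> \<le> C"
    unfolding l2_norm_def using C by (metis real_sqrt_le_iff real_sqrt_unique)
qed

lemma sq_summable_finite_support:
  assumes "finite F" "F \<subseteq> S" "\<And>a. a \<in> S - F \<Longrightarrow> \<xi> a = 0"
  shows "\<xi> sq_summable_on S" and "l2_norm S \<xi> = L2_set (\<lambda>a. norm (\<xi> a)) F"
proof -
  have eq: "(\<lambda>a. (norm (\<xi> a))\<^sup>2) summable_on S \<longleftrightarrow> (\<lambda>a. (norm (\<xi> a))\<^sup>2) summable_on F"
    by (rule summable_on_cong_neutral) (use assms in auto)
  show "\<xi> sq_summable_on S" unfolding eq using assms by simp
  have "(\<Sum>\<^sub>\<infinity>a\<in>S. (norm (\<xi> a))\<^sup>2) = (\<Sum>\<^sub>\<infinity>a\<in>F. (norm (\<xi> a))\<^sup>2)"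
    by (rule infsum_cong_neutral) (use assms in auto)
  then show "l2_norm S \<xi> = L2_set (\<lambda>a. norm (\<xi> a)) F"
    using assms by (simp add: l2_norm_def L2_set_def)
qed

lemma sq_summable_prod:
  assumes "\<xi> sq_summable_on S" "\<eta> sq_summable_on S"
  shows "(\<lambda>a. norm (\<xi> a * \<eta> a)) summable_on S"
  by (rule abs_summable_product) (use assms in \<open>simp_all add: norm_mult power2_eq_square\<close>)

lemma norm_sum_prod_le_L2_set:
  fixes \<xi> \<eta> :: "'a \<Rightarrow> complex"
  shows "norm (\<Sum>a\<in>F. \<xi> a * \<eta> a) \<le> L2_set (\<lambda>a. norm (\<xi> a)) F * L2_set (\<lambda>a. norm (\<eta> a)) F"
proof -
  have "norm (\<Sum>a\<in>F. \<xi> a * \<eta> a) \<le> (\<Sum>a\<in>F. \<bar>norm (\<xi> a)\<bar> * \<bar>norm (\<eta> a)\<bar>)"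
    by (rule order_trans[OF norm_sum]) (simp add: norm_mult)
  also have "\<dots> \<le> L2_set (\<lambda>a. norm (\<xi> a)) F * L2_set (\<lambda>a. norm (\<eta> a)) F"
    by (rule L2_set_mult_ineq)
  finally show ?thesis .
qed

lemma infsum_diff:
  fixes f g :: "'a \<Rightarrow> complex"
  assumes "f summable_on S" "g summable_on S"
  shows "(\<Sum>\<^sub>\<infinity>a\<in>S. f a - g a) = infsum f S - infsum g S"
  using infsum_add[OF assms(1), of "\<lambda>a. - g a"] assms(2) by (simp add: infsum_uminus summable_on_uminus)

lemma
  fixes f :: "'b \<Rightarrow> 'a \<Rightarrow> complex"
  assumes "\<And>i. i \<in> I \<Longrightarrow> f i summable_on S"
  shows summable_on_sum: "(\<lambda>a. \<Sum>i\<in>I. f i a) summable_on S"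
    and infsum_sum: "(\<Sum>\<^sub>\<infinity>a\<in>S. \<Sum>i\<in>I. f i a) = (\<Sum>i\<in>I. infsum (f i) S)"
  using assms
  by (induction I rule: infinite_finite_induct) (auto simp: summable_on_add infsum_add)

lemma norm_infsum_le_finite:
  fixes f :: "'a \<Rightarrow> complex"
  assumes "f summable_on S" "\<And>F. finite F \<Longrightarrow> F \<subseteq> S \<Longrightarrow> norm (sum f F) \<le> C"
  shows "norm (infsum f S) \<le> C"
proof (rule tendsto_upperbound)
  show "((\<lambda>F. norm (sum f F)) \<longlongrightarrow> norm (infsum f S)) (finite_subsets_at_top S)"
    by (intro tendsto_norm infsum_tendsto assms)
  show "\<forall>\<^sub>F F in finite_subsets_at_top S. norm (sum f F) \<le> C"
    by (rule eventually_finite_subsets_at_top_weakI) (use assms in auto)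
qed simp

lemma Cauchy_Schwarz_infsum:
  assumes "\<xi> sq_summable_on S" "\<eta> sq_summable_on S"
  shows "norm (\<Sum>\<^sub>\<infinity>a\<in>S. \<xi> a * \<eta> a) \<le> l2_norm S \<xi> * l2_norm S \<eta>"
proof (rule norm_infsum_le_finite)
  show "(\<lambda>a. \<xi> a * \<eta> a) summable_on S"
    using sq_summable_prod[OF assms] by (rule abs_summable_summable)
  fix F assume F: "finite F" "F \<subseteq> S"
  show "norm (\<Sum>a\<in>F. \<xi> a * \<eta> a) \<le> l2_norm S \<xi> * l2_norm S \<eta>"
    by (rule order_trans[OF norm_sum_prod_le_L2_set])
       (intro mult_mono L2_set_le_l2_norm assms F; simp)
qed

text \<open>Finite approximation of the sum of squares to precision \<open>e^2\<close>, since the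
  norm is its square root.\<close>

lemma l2_tail:
  assumes "\<xi> sq_summable_on S" "e > 0"
  obtains F where "finite F" "F \<subseteq> S" "(\<lambda>a. if a \<in> F then 0 else \<xi> a) sq_summable_on S"
    "l2_norm S (\<lambda>a. if a \<in> F then 0 else \<xi> a) \<le> e"
proof -
  let ?f = "\<lambda>a. (norm (\<xi> a))\<^sup>2"
  have "\<exists>F. finite F \<and> F \<subseteq> S \<and> dist (sum ?f F) (infsum ?f S) \<le> e\<^sup>2"
    by (rule infsum_finite_approximation) (use assms in auto)
  then obtain F where F: "finite F" "F \<subseteq> S" "dist (sum ?f F) (infsum ?f S) \<le> e\<^sup>2" by auto
  let ?t = "\<lambda>a. if a \<in> F then 0 else \<xi> a"
  have s: "?t sq_summable_on S"
    by (rule summable_on_comparison_test[OF assms(1)]) auto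
  have sF: "?f summable_on F" "?f summable_on (S - F)"
    using F assms(1) by (auto intro: summable_on_subset_banach)
  have "infsum ?f S = infsum ?f F + infsum ?f (S - F)"
    using infsum_Un_disjoint[OF sF] F by (simp add: Un_absorb1)
  moreover have "(\<Sum>\<^sub>\<infinity>a\<in>S. (norm (?t a))\<^sup>2) = infsum ?f (S - F)"
    by (rule infsum_cong_neutral) auto
  ultimately have "(\<Sum>\<^sub>\<infinity>a\<in>S. (norm (?t a))\<^sup>2) \<le> e\<^sup>2"
    using F by (simp add: dist_real_def abs_if split: if_splits)
  then have "l2_norm S ?t \<le> e"
    unfolding l2_norm_def using assms(2) by (metis less_imp_le real_sqrt_le_iff real_sqrt_unique)
  then show ?thesis using that F s by blast
qed

lemma sq_summable_scale:
  assumes "\<xi> sq_summable_on S"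
  shows "(\<lambda>a. c * \<xi> a) sq_summable_on S"
  using summable_on_cmult_right[OF assms, of "(norm c)\<^sup>2"] by (simp add: norm_mult power_mult_distrib)

lemma l2_norm_scale: "l2_norm S (\<lambda>a. c * \<xi> a) = norm c * l2_norm S \<xi>"
  by (simp add: l2_norm_def norm_mult power_mult_distrib infsum_cmult_right' real_sqrt_mult)

text \<open>Cancels a possibly vanishing factor in estimates obtained by testing a vector against
  its own conjugate.\<close>

lemma le_if_square_le_mult:
  fixes x y :: real
  assumes "x\<^sup>2 \<le> y * x" "0 \<le> y"
  shows "x \<le> y"
proof (rule ccontr)
  assume "\<not> x \<le> y"
  then have "y < x" "0 < x" using assms by auto
  then have "y * x < x * x" by (rule mult_strict_right_mono)
  then show False using assms by (simp add: power2_eq_square)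
qed

lemma le_zero_if_le_mult:
  fixes x K :: real
  assumes "0 \<le> K" and le: "\<And>e. e > 0 \<Longrightarrow> x \<le> K * e"
  shows "x \<le> 0"
proof (rule field_le_epsilon)
  fix e :: real assume e: "e > 0"
  have "x \<le> K * (e / (K + 1))" by (rule le) (use assms(1) e in simp)
  also have "\<dots> \<le> e" using assms(1) e by (simp add: field_simps)
  finally show "x \<le> 0 + e" by simp
qed

text \<open>A bound for the matrix \<open>M\<close> as an operator on \<open>l2 S\<close>, phrased
  through the bilinear form without conjugation. Only finite sums occur, so the notion is visibly
  stable under transposition, conjugation and entrywise limits.\<close>

definition bounded_kernel :: "'a set \<Rightarrow> ('a \<Rightarrow> 'a \<Rightarrow> complex) \<Rightarrow> real \<Rightarrow> bool" where
  "bounded_kernel S M C \<longleftrightarrow> 0 \<le> C \<and> (\<forall>F \<xi> \<eta>. finite F \<and> F \<subseteq> S \<longrightarrow>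
     norm (\<Sum>a\<in>F. \<Sum>b\<in>F. \<eta> a * M a b * \<xi> b)
       \<le> C * L2_set (\<lambda>b. norm (\<xi> b)) F * L2_set (\<lambda>a. norm (\<eta> a)) F)"

lemma bounded_kernelD0: "bounded_kernel S M C \<Longrightarrow> 0 \<le> C"
  by (simp add: bounded_kernel_def)

lemma bounded_kernelD:
  "\<lbrakk>bounded_kernel S M C; finite F; F \<subseteq> S\<rbrakk> \<Longrightarrow>
     norm (\<Sum>a\<in>F. \<Sum>b\<in>F. \<eta> a * M a b * \<xi> b)
       \<le> C * L2_set (\<lambda>b. norm (\<xi> b)) F * L2_set (\<lambda>a. norm (\<eta> a)) F"
  by (simp add: bounded_kernel_def)

lemma bounded_kernel_cong:
  assumes "\<And>a b. a \<in> S \<Longrightarrow> b \<in> S \<Longrightarrow> M a b = N a b"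
  shows "bounded_kernel S M C \<longleftrightarrow> bounded_kernel S N C"
proof -
  have "(\<Sum>a\<in>F. \<Sum>b\<in>F. \<eta> a * M a b * \<xi> b) = (\<Sum>a\<in>F. \<Sum>b\<in>F. \<eta> a * N a b * \<xi> b)" if "F \<subseteq> S" for F \<eta> \<xi>
    by (intro sum.cong refl) (use assms that in auto)
  then show ?thesis unfolding bounded_kernel_def by (metis (no_types, lifting))
qed

text \<open>Both vectors are extended by zero to \<open>F \<union> H\<close>, which turns the
  rectangle into a square block.\<close>

lemma bounded_kernel_rect:
  assumes "bounded_kernel S M C" "finite F" "F \<subseteq> S" "finite H" "H \<subseteq> S"
  shows "norm (\<Sum>a\<in>F. \<Sum>b\<in>H. \<eta> a * M a b * \<xi> b)
           \<le> C * L2_set (\<lambda>b. norm (\<xi> b)) H * L2_set (\<lambda>a. norm (\<eta> a)) F"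
proof -
  let ?\<eta> = "\<lambda>a. if a \<in> F then \<eta> a else 0" and ?\<xi> = "\<lambda>a. if a \<in> H then \<xi> a else 0"
  have "norm (\<Sum>a\<in>F\<union>H. \<Sum>b\<in>F\<union>H. ?\<eta> a * M a b * ?\<xi> b)
          \<le> C * L2_set (\<lambda>b. norm (?\<xi> b)) (F\<union>H) * L2_set (\<lambda>a. norm (?\<eta> a)) (F\<union>H)"
    by (rule bounded_kernelD) (use assms in auto)
  moreover have "(\<Sum>a\<in>F\<union>H. \<Sum>b\<in>F\<union>H. ?\<eta> a * M a b * ?\<xi> b) = (\<Sum>a\<in>F. \<Sum>b\<in>F\<union>H. ?\<eta> a * M a b * ?\<xi> b)"
    by (rule sum.mono_neutral_right) (use assms in auto)
  moreover have "\<dots> = (\<Sum>a\<in>F. \<Sum>b\<in>H. \<eta> a * M a b * \<xi> b)"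
  proof (rule sum.cong[OF refl])
    fix a assume a: "a \<in> F"
    have "(\<Sum>b\<in>F\<union>H. ?\<eta> a * M a b * ?\<xi> b) = (\<Sum>b\<in>H. ?\<eta> a * M a b * ?\<xi> b)"
      by (rule sum.mono_neutral_right) (use assms in auto)
    then show "(\<Sum>b\<in>F\<union>H. ?\<eta> a * M a b * ?\<xi> b) = (\<Sum>b\<in>H. \<eta> a * M a b * \<xi> b)" using a by simp
  qed
  moreover have "L2_set (\<lambda>b. norm (?\<xi> b)) (F\<union>H) = L2_set (\<lambda>b. norm (\<xi> b)) H"
    unfolding L2_set_def
    by (rule arg_cong[where f=sqrt], rule sum.mono_neutral_cong_right) (use assms in auto)
  moreover have "L2_set (\<lambda>b. norm (?\<eta> b)) (F\<union>H) = L2_set (\<lambda>b. norm (\<eta> b)) F"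
    unfolding L2_set_def
    by (rule arg_cong[where f=sqrt], rule sum.mono_neutral_cong_right) (use assms in auto)
  ultimately show ?thesis by simp
qed

lemma bounded_kernel_transpose:
  assumes "bounded_kernel S M C"
  shows "bounded_kernel S (\<lambda>a b. M b a) C"
  unfolding bounded_kernel_def
proof (intro conjI allI impI)
  show "0 \<le> C" using assms by (rule bounded_kernelD0)
  fix F and \<xi> \<eta> :: "'a \<Rightarrow> complex" assume F: "finite F \<and> F \<subseteq> S"
  have "(\<Sum>a\<in>F. \<Sum>b\<in>F. \<eta> a * M b a * \<xi> b) = (\<Sum>a\<in>F. \<Sum>b\<in>F. \<xi> a * M a b * \<eta> b)"
    by (subst sum.swap) (simp add: mult_ac)
  then show "norm (\<Sum>a\<in>F. \<Sum>b\<in>F. \<eta> a * M b a * \<xi> b)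
      \<le> C * L2_set (\<lambda>b. norm (\<xi> b)) F * L2_set (\<lambda>a. norm (\<eta> a)) F"
    using assms F unfolding bounded_kernel_def by (metis (no_types, lifting) mult.assoc mult.commute)
qed

lemma bounded_kernel_cnj:
  assumes "bounded_kernel S M C"
  shows "bounded_kernel S (\<lambda>a b. cnj (M a b)) C"
  unfolding bounded_kernel_def
proof (intro conjI allI impI)
  show "0 \<le> C" using assms by (rule bounded_kernelD0)
  fix F and \<xi> \<eta> :: "'a \<Rightarrow> complex" assume F: "finite F \<and> F \<subseteq> S"
  have "(\<Sum>a\<in>F. \<Sum>b\<in>F. \<eta> a * cnj (M a b) * \<xi> b) = cnj (\<Sum>a\<in>F. \<Sum>b\<in>F. cnj (\<eta> a) * M a b * cnj (\<xi> b))"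
    by simp
  moreover have "norm (\<Sum>a\<in>F. \<Sum>b\<in>F. cnj (\<eta> a) * M a b * cnj (\<xi> b))
       \<le> C * L2_set (\<lambda>b. norm (cnj (\<xi> b))) F * L2_set (\<lambda>a. norm (cnj (\<eta> a))) F"
    by (rule bounded_kernelD) (use assms F in auto)
  ultimately show "norm (\<Sum>a\<in>F. \<Sum>b\<in>F. \<eta> a * cnj (M a b) * \<xi> b)
      \<le> C * L2_set (\<lambda>b. norm (\<xi> b)) F * L2_set (\<lambda>a. norm (\<eta> a)) F"
    by (simp only: complex_mod_cnj)
qed

text \<open>Test row \<open>a\<close> against its own conjugate: the squared norm of each finite
  piece of the row is at most \<open>C\<close> times its norm, and one factor cancels.\<close>

lemma bounded_kernel_row:
  assumes "bounded_kernel S M C" "a \<in> S"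
  shows "(\<lambda>b. M a b) sq_summable_on S" and "l2_norm S (\<lambda>b. M a b) \<le> C"
proof -
  have "L2_set (\<lambda>b. norm (M a b)) F \<le> C" if F: "finite F" "F \<subseteq> S" for F
  proof -
    let ?L = "L2_set (\<lambda>b. norm (M a b)) F"
    have "norm (\<Sum>a\<in>{a}. \<Sum>b\<in>F. 1 * M a b * cnj (M a b))
       \<le> C * L2_set (\<lambda>b. norm (cnj (M a b))) F * L2_set (\<lambda>a. norm (1::complex)) {a}"
      using bounded_kernel_rect[OF assms(1), of "{a}" F "\<lambda>_. 1" "\<lambda>b. cnj (M a b)"] assms(2) F by simp
    moreover have "(\<Sum>b\<in>F. M a b * cnj (M a b)) = of_real (\<Sum>b\<in>F. (norm (M a b))\<^sup>2)"
      by (simp only: of_real_sum complex_norm_square)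
    moreover have "(\<Sum>b\<in>F. (norm (M a b))\<^sup>2) = ?L\<^sup>2"
      by (simp add: L2_set_def sum_nonneg)
    ultimately have "?L\<^sup>2 \<le> C * ?L" by (simp add: norm_power)
    then show ?thesis
      by (rule le_if_square_le_mult[OF _ bounded_kernelD0[OF assms(1)]])
  qed
  then show "(\<lambda>b. M a b) sq_summable_on S" "l2_norm S (\<lambda>b. M a b) \<le> C"
    by (rule sq_summable_if_L2_set_le; blast)+
qed

definition apply_kernel :: "'a set \<Rightarrow> ('a \<Rightarrow> 'a \<Rightarrow> complex) \<Rightarrow> ('a \<Rightarrow> complex) \<Rightarrow> 'a \<Rightarrow> complex" where
  "apply_kernel S M \<xi> a = (\<Sum>\<^sub>\<infinity>b\<in>S. M a b * \<xi> b)"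

lemma row_summable:
  assumes "bounded_kernel S M C" "a \<in> S" "\<xi> sq_summable_on S"
  shows "(\<lambda>b. M a b * \<xi> b) summable_on S"
  by (rule abs_summable_summable, rule sq_summable_prod[OF bounded_kernel_row(1)[OF assms(1,2)] assms(3)])

text \<open>Only the outer index is kept finite; the inner series is exhausted by finite sets
  \<open>H\<close>, and the rectangular estimate does not depend on \<open>H\<close>.\<close>

lemma apply_kernel_finite_pairing:
  assumes "bounded_kernel S M C" "\<xi> sq_summable_on S" "finite F" "F \<subseteq> S"
  shows "norm (\<Sum>a\<in>F. \<eta> a * apply_kernel S M \<xi> a) \<le> C * l2_norm S \<xi> * L2_set (\<lambda>a. norm (\<eta> a)) F"
proof -
  have s: "(\<lambda>b. \<eta> a * M a b * \<xi> b) summable_on S" if "a \<in> F" for a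
    using summable_on_cmult_right[OF row_summable[OF assms(1) _ assms(2)], of a "\<eta> a"] that assms
    by (auto simp: mult.assoc)
  have "(\<Sum>a\<in>F. \<eta> a * apply_kernel S M \<xi> a) = (\<Sum>a\<in>F. \<Sum>\<^sub>\<infinity>b\<in>S. \<eta> a * M a b * \<xi> b)"
    by (simp add: apply_kernel_def infsum_cmult_right' mult.assoc)
  also have "\<dots> = (\<Sum>\<^sub>\<infinity>b\<in>S. \<Sum>a\<in>F. \<eta> a * M a b * \<xi> b)"
    by (rule infsum_sum[symmetric]) (use s in auto)
  also have "norm \<dots> \<le> C * l2_norm S \<xi> * L2_set (\<lambda>a. norm (\<eta> a)) F"
  proof (rule norm_infsum_le_finite)
    show "(\<lambda>b. \<Sum>a\<in>F. \<eta> a * M a b * \<xi> b) summable_on S" using s by (rule summable_on_sum)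
    fix H assume H: "finite H" "H \<subseteq> S"
    have "(\<Sum>b\<in>H. \<Sum>a\<in>F. \<eta> a * M a b * \<xi> b) = (\<Sum>a\<in>F. \<Sum>b\<in>H. \<eta> a * M a b * \<xi> b)"
      by (rule sum.swap)
    also have "norm \<dots> \<le> C * L2_set (\<lambda>b. norm (\<xi> b)) H * L2_set (\<lambda>a. norm (\<eta> a)) F"
      by (rule bounded_kernel_rect) (use assms H in auto)
    also have "\<dots> \<le> C * l2_norm S \<xi> * L2_set (\<lambda>a. norm (\<eta> a)) F"
      by (intro mult_right_mono mult_left_mono L2_set_le_l2_norm assms H bounded_kernelD0[OF assms(1)]) simp
    finally show "norm (\<Sum>b\<in>H. \<Sum>a\<in>F. \<eta> a * M a b * \<xi> b) \<le> C * l2_norm S \<xi> * L2_set (\<lambda>a. norm (\<eta> a)) F" .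
  qed
  finally show ?thesis .
qed

text \<open>The pairing estimate is applied to the conjugate of the image itself, so that again one
  factor cancels.\<close>

lemma apply_kernel_bounded:
  assumes "bounded_kernel S M C" "\<xi> sq_summable_on S"
  shows "apply_kernel S M \<xi> sq_summable_on S" and "l2_norm S (apply_kernel S M \<xi>) \<le> C * l2_norm S \<xi>"
proof -
  have "L2_set (\<lambda>a. norm (apply_kernel S M \<xi> a)) F \<le> C * l2_norm S \<xi>" if F: "finite F" "F \<subseteq> S" for F
  proof -
    let ?L = "L2_set (\<lambda>a. norm (apply_kernel S M \<xi> a)) F"
    have "norm (\<Sum>a\<in>F. cnj (apply_kernel S M \<xi> a) * apply_kernel S M \<xi> a)
       \<le> C * l2_norm S \<xi> * L2_set (\<lambda>a. norm (cnj (apply_kernel S M \<xi> a))) F"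
      by (rule apply_kernel_finite_pairing[OF assms F])
    moreover have "(\<Sum>a\<in>F. cnj (apply_kernel S M \<xi> a) * apply_kernel S M \<xi> a)
        = of_real (\<Sum>a\<in>F. (norm (apply_kernel S M \<xi> a))\<^sup>2)"
      by (simp only: of_real_sum complex_norm_square mult.commute)
    moreover have "(\<Sum>a\<in>F. (norm (apply_kernel S M \<xi> a))\<^sup>2) = ?L\<^sup>2"
      by (simp add: L2_set_def sum_nonneg)
    ultimately have "?L\<^sup>2 \<le> C * l2_norm S \<xi> * ?L" by (simp add: norm_power)
    then show ?thesis
      by (rule le_if_square_le_mult) (use bounded_kernelD0[OF assms(1)] in simp)
  qed
  then show "apply_kernel S M \<xi> sq_summable_on S" "l2_norm S (apply_kernel S M \<xi>) \<le> C * l2_norm S \<xi>"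
    by (rule sq_summable_if_L2_set_le; blast)+
qed

lemma apply_kernel_diff:
  assumes "bounded_kernel S M C" "a \<in> S" "\<xi> sq_summable_on S" "\<zeta> sq_summable_on S"
  shows "apply_kernel S M (\<lambda>b. \<xi> b - \<zeta> b) a = apply_kernel S M \<xi> a - apply_kernel S M \<zeta> a"
  unfolding apply_kernel_def right_diff_distrib
  by (rule infsum_diff[OF row_summable[OF assms(1-3)] row_summable[OF assms(1,2,4)]])

text \<open>Converse of \<open>apply_kernel_bounded\<close>: a vector on a finite block, extended by
  zero, belongs to \<open>l2 S\<close>.\<close>

lemma bounded_kernelI:
  assumes "0 \<le> C"
    and "\<And>\<xi>. \<xi> \<in> l2 S \<Longrightarrow> apply_kernel S M \<xi> sq_summable_on S"
    and "\<And>\<xi>. \<xi> \<in> l2 S \<Longrightarrow> l2_norm S (apply_kernel S M \<xi>) \<le> C * l2_norm S \<xi>"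
  shows "bounded_kernel S M C"
  unfolding bounded_kernel_def
proof (intro conjI allI impI)
  fix F and \<xi> \<eta> :: "'a \<Rightarrow> complex" assume "finite F \<and> F \<subseteq> S"
  then have F: "finite F" "F \<subseteq> S" by auto
  let ?\<xi> = "\<lambda>b. if b \<in> F then \<xi> b else 0"
  have ssq: "?\<xi> sq_summable_on S" and nrm: "l2_norm S ?\<xi> = L2_set (\<lambda>a. norm (?\<xi> a)) F"
    by (rule sq_summable_finite_support[OF F]; simp)+
  have l2: "?\<xi> \<in> l2 S" using ssq F by (auto simp: l2_def)
  have nrm': "L2_set (\<lambda>a. norm (?\<xi> a)) F = L2_set (\<lambda>a. norm (\<xi> a)) F"
    by (rule L2_set_cong) auto
  have "apply_kernel S M ?\<xi> a = (\<Sum>b\<in>F. M a b * \<xi> b)" for a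
  proof -
    have "apply_kernel S M ?\<xi> a = (\<Sum>\<^sub>\<infinity>b\<in>F. M a b * ?\<xi> b)"
      unfolding apply_kernel_def by (rule infsum_cong_neutral) (use F in auto)
    then show ?thesis using F by simp
  qed
  then have "(\<Sum>a\<in>F. \<Sum>b\<in>F. \<eta> a * M a b * \<xi> b) = (\<Sum>a\<in>F. \<eta> a * apply_kernel S M ?\<xi> a)"
    by (simp add: sum_distrib_left mult.assoc)
  also have "norm \<dots> \<le> L2_set (\<lambda>a. norm (\<eta> a)) F * L2_set (\<lambda>a. norm (apply_kernel S M ?\<xi> a)) F"
    by (rule norm_sum_prod_le_L2_set)
  also have "\<dots> \<le> L2_set (\<lambda>a. norm (\<eta> a)) F * l2_norm S (apply_kernel S M ?\<xi>)"
    by (intro mult_left_mono L2_set_le_l2_norm assms F l2) simp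
  also have "\<dots> \<le> L2_set (\<lambda>a. norm (\<eta> a)) F * (C * l2_norm S ?\<xi>)"
    by (intro mult_left_mono assms l2) simp
  finally show "norm (\<Sum>a\<in>F. \<Sum>b\<in>F. \<eta> a * M a b * \<xi> b)
      \<le> C * L2_set (\<lambda>b. norm (\<xi> b)) F * L2_set (\<lambda>a. norm (\<eta> a)) F"
    by (simp add: nrm nrm' mult_ac)
qed (rule assms)

lemma apply_kernel_finite:
  assumes "finite F" "F \<subseteq> S" "\<And>b. b \<in> S - F \<Longrightarrow> \<xi> b = 0"
  shows "apply_kernel S M \<xi> a = (\<Sum>b\<in>F. M a b * \<xi> b)"
proof -
  have "apply_kernel S M \<xi> a = (\<Sum>\<^sub>\<infinity>b\<in>F. M a b * \<xi> b)"
    unfolding apply_kernel_def by (rule infsum_cong_neutral) (use assms in auto)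
  then show ?thesis using assms by simp
qed

text \<open>The double series need not converge absolutely, so \<open>infsum_swap\<close> does not apply: the
  identity is passed to the limit from finitely supported \<open>\<xi>\<close>.\<close>

lemma apply_kernel_pairing_swap:
  assumes M: "bounded_kernel S M C" and \<xi>: "\<xi> sq_summable_on S" and \<eta>: "\<eta> sq_summable_on S"
  shows "(\<Sum>\<^sub>\<infinity>a\<in>S. \<eta> a * apply_kernel S M \<xi> a) = (\<Sum>\<^sub>\<infinity>b\<in>S. apply_kernel S (\<lambda>a b. M b a) \<eta> b * \<xi> b)"
    (is "?L \<xi> = ?R \<xi>")
proof -
  note Mt = bounded_kernel_transpose[OF M]
  have C: "0 \<le> C" using M by (rule bounded_kernelD0)
  have "norm (?L \<xi> - ?R \<xi>) \<le> 2 * C * l2_norm S \<eta> * e" if e: "e > 0" for e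
  proof -
    obtain F where F: "finite F" "F \<subseteq> S" and tail: "(\<lambda>a. if a \<in> F then 0 else \<xi> a) sq_summable_on S"
      "l2_norm S (\<lambda>a. if a \<in> F then 0 else \<xi> a) \<le> e" using l2_tail[OF \<xi> e] by blast
    define f where "f = (\<lambda>a. if a \<in> F then \<xi> a else 0)"
    \<comment> \<open>The sign makes \<xi> the difference \<open>f - t\<close> of a finitely
      supported part and a small tail, so that \<open>infsum_diff\<close> splits every
      series.\<close>
    define t where "t = (\<lambda>a. (- 1) * (if a \<in> F then 0 else \<xi> a))"
    have f: "f sq_summable_on S" by (rule sq_summable_finite_support[OF F]) (simp add: f_def)
    have dec: "\<xi> b = f b - t b" for b by (simp add: f_def t_def)
    have t': "t sq_summable_on S" unfolding t_def by (rule sq_summable_scale[OF tail(1)])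
    have tn: "l2_norm S t \<le> e" unfolding t_def l2_norm_scale using tail(2) by simp
    have ap: "apply_kernel S M \<xi> a = apply_kernel S M f a - apply_kernel S M t a" if "a \<in> S" for a
      using apply_kernel_diff[OF M that f t'] by (simp add: dec[symmetric])
    have sL: "(\<lambda>a. \<eta> a * apply_kernel S M \<zeta> a) summable_on S" if "\<zeta> sq_summable_on S" for \<zeta>
      by (rule abs_summable_summable[OF sq_summable_prod[OF \<eta> apply_kernel_bounded(1)[OF M that]]])
    have sR: "(\<lambda>b. apply_kernel S (\<lambda>a b. M b a) \<eta> b * \<zeta> b) summable_on S" if "\<zeta> sq_summable_on S" for \<zeta>
      by (rule abs_summable_summable[OF sq_summable_prod[OF apply_kernel_bounded(1)[OF Mt \<eta>] that]])
    have "?L \<xi> = (\<Sum>\<^sub>\<infinity>a\<in>S. \<eta> a * apply_kernel S M f a - \<eta> a * apply_kernel S M t a)"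
      by (rule infsum_cong) (simp add: ap right_diff_distrib)
    also have "\<dots> = ?L f - ?L t"
      by (rule infsum_diff[OF sL[OF f] sL[OF t']])
    finally have L: "?L \<xi> = ?L f - ?L t" .
    have "?R \<xi> = (\<Sum>\<^sub>\<infinity>b\<in>S. apply_kernel S (\<lambda>a b. M b a) \<eta> b * f b - apply_kernel S (\<lambda>a b. M b a) \<eta> b * t b)"
      by (rule infsum_cong) (simp add: dec right_diff_distrib)
    also have "\<dots> = ?R f - ?R t"
      by (rule infsum_diff[OF sR[OF f] sR[OF t']])
    finally have R: "?R \<xi> = ?R f - ?R t" .
    have "?L f = (\<Sum>\<^sub>\<infinity>a\<in>S. \<Sum>b\<in>F. \<eta> a * M a b * \<xi> b)"
      using apply_kernel_finite[OF F, of f M] by (simp add: f_def sum_distrib_left mult.assoc)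
    also have "\<dots> = (\<Sum>b\<in>F. \<Sum>\<^sub>\<infinity>a\<in>S. \<eta> a * M a b * \<xi> b)"
    proof (rule infsum_sum)
      fix b assume "b \<in> F"
      then have "(\<lambda>a. \<eta> a * M a b) summable_on S"
        using row_summable[OF Mt _ \<eta>, of b] F by (auto simp: mult.commute)
      then show "(\<lambda>a. \<eta> a * M a b * \<xi> b) summable_on S" by (rule summable_on_cmult_left)
    qed
    also have "\<dots> = (\<Sum>b\<in>F. apply_kernel S (\<lambda>a b. M b a) \<eta> b * f b)"
      by (rule sum.cong) (simp_all add: f_def apply_kernel_def infsum_cmult_left' mult.commute[of "M _ _"])
    also have "\<dots> = (\<Sum>\<^sub>\<infinity>b\<in>F. apply_kernel S (\<lambda>a b. M b a) \<eta> b * f b)" using F by simp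
    also have "\<dots> = ?R f"
      by (rule infsum_cong_neutral) (use F in \<open>auto simp: f_def\<close>)
    finally have d: "?L \<xi> - ?R \<xi> = ?R t - ?L t" using L R by simp
    moreover have "norm (?R t) \<le> (C * l2_norm S \<eta>) * e"
      by (rule order_trans[OF Cauchy_Schwarz_infsum[OF apply_kernel_bounded(1)[OF Mt \<eta>] t']],
          rule mult_mono[OF apply_kernel_bounded(2)[OF Mt \<eta>] tn]) (simp_all add: C)
    moreover have "norm (?L t) \<le> l2_norm S \<eta> * (C * e)"
    proof (rule order_trans[OF Cauchy_Schwarz_infsum[OF \<eta> apply_kernel_bounded(1)[OF M t']]])
      have "l2_norm S (apply_kernel S M t) \<le> C * l2_norm S t"
        by (rule apply_kernel_bounded[OF M t'])
      also have "\<dots> \<le> C * e" using tn C by (rule mult_left_mono)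
      finally show "l2_norm S \<eta> * l2_norm S (apply_kernel S M t) \<le> l2_norm S \<eta> * (C * e)"
        by (rule mult_left_mono) simp
    qed
    moreover have "norm (?L \<xi> - ?R \<xi>) \<le> norm (?R t) + norm (?L t)"
      unfolding d by (rule norm_triangle_ineq4)
    ultimately show ?thesis by (simp add: mult_ac)
  qed
  then have H: "\<And>e. e > 0 \<Longrightarrow> norm (?L \<xi> - ?R \<xi>) \<le> (2 * C * l2_norm S \<eta>) * e" .
  have "norm (?L \<xi> - ?R \<xi>) \<le> 0"
    by (rule le_zero_if_le_mult[OF _ H]) (simp add: C)
  then show ?thesis by simp
qed

text \<open>The value of \<open>M (N \<xi>)\<close> at \<open>a\<close> pairs the square-summable
  row \<open>a\<close> of \<open>M\<close> with \<open>N \<xi>\<close>. Moving \<open>N\<close>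
  across this pairing by \<open>apply_kernel_pairing_swap\<close> exhibits the product
  kernel.\<close>

lemma bounded_kernel_mult:
  assumes M: "bounded_kernel S M C" and N: "bounded_kernel S N D"
  shows "bounded_kernel S (\<lambda>a b. \<Sum>\<^sub>\<infinity>k\<in>S. M a k * N k b) (C * D)"
    and "\<lbrakk>a \<in> S; \<xi> sq_summable_on S\<rbrakk> \<Longrightarrow>
      apply_kernel S (\<lambda>a b. \<Sum>\<^sub>\<infinity>k\<in>S. M a k * N k b) \<xi> a = apply_kernel S M (apply_kernel S N \<xi>) a"
proof -
  have C: "0 \<le> C" and D: "0 \<le> D" using M N by (auto dest: bounded_kernelD0)
  show eq: "apply_kernel S (\<lambda>a b. \<Sum>\<^sub>\<infinity>k\<in>S. M a k * N k b) \<xi> a = apply_kernel S M (apply_kernel S N \<xi>) a"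
    if "a \<in> S" "\<xi> sq_summable_on S" for a \<xi>
  proof -
    have "apply_kernel S M (apply_kernel S N \<xi>) a
        = (\<Sum>\<^sub>\<infinity>b\<in>S. apply_kernel S (\<lambda>a b. N b a) (M a) b * \<xi> b)"
      using apply_kernel_pairing_swap[OF N that(2), of "M a"] bounded_kernel_row[OF M that(1)]
      by (simp add: apply_kernel_def)
    then show ?thesis by (simp add: apply_kernel_def mult.commute)
  qed
  show "bounded_kernel S (\<lambda>a b. \<Sum>\<^sub>\<infinity>k\<in>S. M a k * N k b) (C * D)"
  proof (rule bounded_kernelI)
    fix \<xi> assume "\<xi> \<in> l2 S"
    then have \<xi>: "\<xi> sq_summable_on S" by (simp add: l2_def)
    note n = apply_kernel_bounded[OF N \<xi>]
    note m = apply_kernel_bounded[OF M n(1)]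
    let ?P = "apply_kernel S (\<lambda>a b. \<Sum>\<^sub>\<infinity>k\<in>S. M a k * N k b) \<xi>"
    show "?P sq_summable_on S"
      using m(1) by (subst summable_on_cong[OF arg_cong[OF eq[OF _ \<xi>]]]) auto
    have "l2_norm S ?P = l2_norm S (apply_kernel S M (apply_kernel S N \<xi>))"
      unfolding l2_norm_def by (rule arg_cong[where f=sqrt], rule infsum_cong) (simp add: eq \<xi>)
    also have "\<dots> \<le> C * (D * l2_norm S \<xi>)"
      using m(2) n(2) C by (meson order_trans mult_left_mono)
    finally show "l2_norm S ?P \<le> C * D * l2_norm S \<xi>" by (simp add: mult.assoc)
  qed (use C D in simp)
qed

lemma bounded_kernel_add:
  assumes "bounded_kernel S M C" "bounded_kernel S N D"
  shows "bounded_kernel S (\<lambda>a b. M a b + N a b) (C + D)"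
  unfolding bounded_kernel_def
proof (intro conjI allI impI)
  show "0 \<le> C + D" using bounded_kernelD0[OF assms(1)] bounded_kernelD0[OF assms(2)] by simp
  fix F and \<xi> \<eta> :: "'a \<Rightarrow> complex" assume F: "finite F \<and> F \<subseteq> S"
  have "(\<Sum>a\<in>F. \<Sum>b\<in>F. \<eta> a * (M a b + N a b) * \<xi> b)
      = (\<Sum>a\<in>F. \<Sum>b\<in>F. \<eta> a * M a b * \<xi> b) + (\<Sum>a\<in>F. \<Sum>b\<in>F. \<eta> a * N a b * \<xi> b)"
    by (simp add: algebra_simps sum.distrib)
  also have "norm \<dots> \<le> C * L2_set (\<lambda>b. norm (\<xi> b)) F * L2_set (\<lambda>a. norm (\<eta> a)) F
      + D * L2_set (\<lambda>b. norm (\<xi> b)) F * L2_set (\<lambda>a. norm (\<eta> a)) F"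
    by (rule norm_triangle_mono) (rule bounded_kernelD, use assms F in auto)+
  finally show "norm (\<Sum>a\<in>F. \<Sum>b\<in>F. \<eta> a * (M a b + N a b) * \<xi> b)
      \<le> (C + D) * L2_set (\<lambda>b. norm (\<xi> b)) F * L2_set (\<lambda>a. norm (\<eta> a)) F"
    by (simp add: algebra_simps)
qed

lemma bounded_kernel_mono:
  assumes "bounded_kernel S M C" "C \<le> D"
  shows "bounded_kernel S M D"
  unfolding bounded_kernel_def
proof (intro conjI allI impI)
  show "0 \<le> D" using bounded_kernelD0[OF assms(1)] assms(2) by simp
  fix F and \<xi> \<eta> :: "'a \<Rightarrow> complex" assume F: "finite F \<and> F \<subseteq> S"
  have "norm (\<Sum>a\<in>F. \<Sum>b\<in>F. \<eta> a * M a b * \<xi> b)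
      \<le> C * L2_set (\<lambda>b. norm (\<xi> b)) F * L2_set (\<lambda>a. norm (\<eta> a)) F"
    by (rule bounded_kernelD) (use assms F in auto)
  also have "\<dots> \<le> D * L2_set (\<lambda>b. norm (\<xi> b)) F * L2_set (\<lambda>a. norm (\<eta> a)) F"
    by (intro mult_right_mono assms) simp_all
  finally show "norm (\<Sum>a\<in>F. \<Sum>b\<in>F. \<eta> a * M a b * \<xi> b)
      \<le> D * L2_set (\<lambda>b. norm (\<xi> b)) F * L2_set (\<lambda>a. norm (\<eta> a)) F" .
qed

text \<open>Diagonal contractions on both sides do not enlarge the bound; conjugation by a unitary
  \<open>1 + d\<close> has this form on every source fibre.\<close>

lemma bounded_kernel_mult_left_right:
  assumes "bounded_kernel S M C" "\<And>a. a \<in> S \<Longrightarrow> norm (v a) \<le> 1" "\<And>a. a \<in> S \<Longrightarrow> norm (w a) \<le> 1"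
  shows "bounded_kernel S (\<lambda>a b. v a * M a b * w b) C"
  unfolding bounded_kernel_def
proof (intro conjI allI impI)
  show C: "0 \<le> C" using bounded_kernelD0[OF assms(1)] .
  fix F and \<xi> \<eta> :: "'a \<Rightarrow> complex" assume F: "finite F \<and> F \<subseteq> S"
  have "norm (\<Sum>a\<in>F. \<Sum>b\<in>F. \<eta> a * (v a * M a b * w b) * \<xi> b)
      = norm (\<Sum>a\<in>F. \<Sum>b\<in>F. (\<eta> a * v a) * M a b * (w b * \<xi> b))"
    by (simp add: mult_ac)
  also have "\<dots> \<le> C * L2_set (\<lambda>b. norm (w b * \<xi> b)) F * L2_set (\<lambda>a. norm (\<eta> a * v a)) F"
    by (rule bounded_kernelD) (use assms F in auto)
  also have "\<dots> \<le> C * L2_set (\<lambda>b. norm (\<xi> b)) F * L2_set (\<lambda>a. norm (\<eta> a)) F"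
    using assms F
    by (intro mult_mono mult_left_mono L2_set_mono)
       (auto simp: C norm_mult intro!: mult_left_le_one_le mult_right_le_one_le)
  finally show "norm (\<Sum>a\<in>F. \<Sum>b\<in>F. \<eta> a * (v a * M a b * w b) * \<xi> b)
      \<le> C * L2_set (\<lambda>b. norm (\<xi> b)) F * L2_set (\<lambda>a. norm (\<eta> a)) F" .
qed

lemma bounded_kernel_scale:
  assumes "bounded_kernel S M C"
  shows "bounded_kernel S (\<lambda>a b. c * M a b) (norm c * C)"
  unfolding bounded_kernel_def
proof (intro conjI allI impI)
  show C: "0 \<le> norm c * C" using bounded_kernelD0[OF assms(1)] by simp
  fix F and \<xi> \<eta> :: "'a \<Rightarrow> complex" assume F: "finite F \<and> F \<subseteq> S"
  have "(\<Sum>a\<in>F. \<Sum>b\<in>F. \<eta> a * (c * M a b) * \<xi> b) = c * (\<Sum>a\<in>F. \<Sum>b\<in>F. \<eta> a * M a b * \<xi> b)"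
    by (simp add: sum_distrib_left mult_ac)
  also have "norm \<dots> \<le> norm c * (C * L2_set (\<lambda>b. norm (\<xi> b)) F * L2_set (\<lambda>a. norm (\<eta> a)) F)"
    unfolding norm_mult by (intro mult_left_mono bounded_kernelD[OF assms]) (use F in auto)
  finally show "norm (\<Sum>a\<in>F. \<Sum>b\<in>F. \<eta> a * (c * M a b) * \<xi> b)
      \<le> norm c * C * L2_set (\<lambda>b. norm (\<xi> b)) F * L2_set (\<lambda>a. norm (\<eta> a)) F"
    by (simp add: mult.assoc)
qed

lemma bounded_kernel_lim:
  assumes "\<And>n. bounded_kernel S (M n) C"
    and "\<And>a b. a \<in> S \<Longrightarrow> b \<in> S \<Longrightarrow> (\<lambda>n::nat. M n a b) \<longlonglongrightarrow> N a b"
  shows "bounded_kernel S N C"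
  unfolding bounded_kernel_def
proof (intro conjI allI impI)
  show C: "0 \<le> C" using bounded_kernelD0[OF assms(1)] .
  fix F and \<xi> \<eta> :: "'a \<Rightarrow> complex" assume F: "finite F \<and> F \<subseteq> S"
  have "(\<lambda>n. norm (\<Sum>a\<in>F. \<Sum>b\<in>F. \<eta> a * M n a b * \<xi> b)) \<longlonglongrightarrow> norm (\<Sum>a\<in>F. \<Sum>b\<in>F. \<eta> a * N a b * \<xi> b)"
    by (intro tendsto_intros assms) (use F in auto)
  then show "norm (\<Sum>a\<in>F. \<Sum>b\<in>F. \<eta> a * N a b * \<xi> b)
      \<le> C * L2_set (\<lambda>b. norm (\<xi> b)) F * L2_set (\<lambda>a. norm (\<eta> a)) F"
  proof (rule LIMSEQ_le_const2, intro exI allI impI)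
    show "norm (\<Sum>a\<in>F. \<Sum>b\<in>F. \<eta> a * M n a b * \<xi> b)
      \<le> C * L2_set (\<lambda>b. norm (\<xi> b)) F * L2_set (\<lambda>a. norm (\<eta> a)) F" for n
      by (rule bounded_kernelD[OF assms(1)]) (use F in auto)
  qed
qed

text \<open>Cauchy-Schwarz over the set \<open>R\<close> of pairs with nonzero entry: each row index
  and each column index belongs to at most \<open>n\<close> of these pairs, so each of the two
  factors contributes \<open>sqrt n\<close>.\<close>

lemma bounded_kernel_Schur_test:
  fixes c :: real and n :: nat
  assumes c: "0 \<le> c" and bd: "\<And>a b. a \<in> S \<Longrightarrow> b \<in> S \<Longrightarrow> norm (M a b) \<le> c"
    and rows: "\<And>a. a \<in> S \<Longrightarrow> finite {b\<in>S. M a b \<noteq> 0} \<and> card {b\<in>S. M a b \<noteq> 0} \<le> n"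
    and cols: "\<And>b. b \<in> S \<Longrightarrow> finite {a\<in>S. M a b \<noteq> 0} \<and> card {a\<in>S. M a b \<noteq> 0} \<le> n"
  shows "bounded_kernel S M (c * n)"
  unfolding bounded_kernel_def
proof (intro conjI allI impI)
  show "0 \<le> c * n" using c by simp
  fix F and \<xi> \<eta> :: "'a \<Rightarrow> complex" assume "finite F \<and> F \<subseteq> S"
  then have F: "finite F" "F \<subseteq> S" by auto
  define R where "R = (SIGMA a:F. {b\<in>F. M a b \<noteq> 0})"
  have fin: "finite {b\<in>F. M a b \<noteq> 0}" "finite {b\<in>F. M b a \<noteq> 0}" for a using F by auto
  have card: "card {b\<in>F. M a b \<noteq> 0} \<le> n" "card {b\<in>F. M b a \<noteq> 0} \<le> n" if "a \<in> F" for a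
  proof -
    have "card {b\<in>F. M a b \<noteq> 0} \<le> card {b\<in>S. M a b \<noteq> 0}" "card {b\<in>F. M b a \<noteq> 0} \<le> card {b\<in>S. M b a \<noteq> 0}"
      by (intro card_mono; use rows[of a] cols[of a] F that in auto)+
    then show "card {b\<in>F. M a b \<noteq> 0} \<le> n" "card {b\<in>F. M b a \<noteq> 0} \<le> n"
      using rows[of a] cols[of a] F that by auto
  qed
  have L1: "L2_set (\<lambda>p. norm (\<eta> (fst p))) R \<le> sqrt n * L2_set (\<lambda>a. norm (\<eta> a)) F"
  proof -
    have "(\<Sum>p\<in>R. (norm (\<eta> (fst p)))\<^sup>2) = (\<Sum>a\<in>F. \<Sum>b\<in>{b\<in>F. M a b \<noteq> 0}. (norm (\<eta> a))\<^sup>2)"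
      unfolding R_def by (subst sum.Sigma) (use F in \<open>auto simp: case_prod_unfold\<close>)
    also have "\<dots> \<le> (\<Sum>a\<in>F. n * (norm (\<eta> a))\<^sup>2)"
      by (rule sum_mono) (use card in \<open>auto intro!: mult_right_mono\<close>)
    finally show ?thesis unfolding L2_set_def real_sqrt_mult[symmetric] sum_distrib_left[symmetric]
      by (rule real_sqrt_le_mono)
  qed
  have L2: "L2_set (\<lambda>p. norm (\<xi> (snd p))) R \<le> sqrt n * L2_set (\<lambda>a. norm (\<xi> a)) F"
  proof -
    have "R = prod.swap ` (SIGMA b:F. {a\<in>F. M a b \<noteq> 0})" unfolding R_def by force
    then have "(\<Sum>p\<in>R. (norm (\<xi> (snd p)))\<^sup>2) = (\<Sum>p\<in>(SIGMA b:F. {a\<in>F. M a b \<noteq> 0}). (norm (\<xi> (fst p)))\<^sup>2)"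
      by (simp add: sum.reindex)
    also have "\<dots> = (\<Sum>b\<in>F. \<Sum>a\<in>{a\<in>F. M a b \<noteq> 0}. (norm (\<xi> b))\<^sup>2)"
      by (subst sum.Sigma) (use F in \<open>auto simp: case_prod_unfold\<close>)
    also have "\<dots> \<le> (\<Sum>a\<in>F. n * (norm (\<xi> a))\<^sup>2)"
      by (rule sum_mono) (use card in \<open>auto intro!: mult_right_mono\<close>)
    finally show ?thesis unfolding L2_set_def real_sqrt_mult[symmetric] sum_distrib_left[symmetric]
      by (rule real_sqrt_le_mono)
  qed
  have "(\<Sum>a\<in>F. \<Sum>b\<in>F. \<eta> a * M a b * \<xi> b) = (\<Sum>a\<in>F. \<Sum>b\<in>{b\<in>F. M a b \<noteq> 0}. \<eta> a * M a b * \<xi> b)"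
    by (intro sum.cong[OF refl] sum.mono_neutral_right) (use F in auto)
  also have "\<dots> = (\<Sum>p\<in>R. \<eta> (fst p) * M (fst p) (snd p) * \<xi> (snd p))"
    unfolding R_def by (subst sum.Sigma) (use F in \<open>auto simp: case_prod_unfold\<close>)
  also have "norm \<dots> \<le> (\<Sum>p\<in>R. c * (\<bar>norm (\<eta> (fst p))\<bar> * \<bar>norm (\<xi> (snd p))\<bar>))"
  proof (rule sum_norm_le)
    fix p assume "p \<in> R"
    then have "norm (M (fst p) (snd p)) \<le> c" using F by (intro bd) (auto simp: R_def)
    then have "norm (M (fst p) (snd p)) * (norm (\<eta> (fst p)) * norm (\<xi> (snd p))) \<le> c * (norm (\<eta> (fst p)) * norm (\<xi> (snd p)))"
      by (rule mult_right_mono) simp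
    then show "norm (\<eta> (fst p) * M (fst p) (snd p) * \<xi> (snd p)) \<le> c * (\<bar>norm (\<eta> (fst p))\<bar> * \<bar>norm (\<xi> (snd p))\<bar>)"
      by (simp add: norm_mult mult_ac)
  qed
  also have "\<dots> \<le> c * (L2_set (\<lambda>p. norm (\<eta> (fst p))) R * L2_set (\<lambda>p. norm (\<xi> (snd p))) R)"
    unfolding sum_distrib_left[symmetric] by (intro mult_left_mono L2_set_mult_ineq c)
  also have "\<dots> \<le> c * ((sqrt n * L2_set (\<lambda>a. norm (\<eta> a)) F) * (sqrt n * L2_set (\<lambda>a. norm (\<xi> a)) F))"
    by (intro mult_left_mono mult_mono L1 L2 c) simp_all
  also have "\<dots> = c * (sqrt n * sqrt n) * L2_set (\<lambda>b. norm (\<xi> b)) F * L2_set (\<lambda>a. norm (\<eta> a)) F"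
    by (simp only: mult_ac)
  also have "sqrt n * sqrt n = n" by simp
  finally show "norm (\<Sum>a\<in>F. \<Sum>b\<in>F. \<eta> a * M a b * \<xi> b)
      \<le> c * n * L2_set (\<lambda>b. norm (\<xi> b)) F * L2_set (\<lambda>a. norm (\<eta> a)) F" .
qed

lemma apply_kernel_cong:
  assumes "\<And>b. b \<in> S \<Longrightarrow> M a b = N a b" "\<And>b. b \<in> S \<Longrightarrow> \<xi> b = \<zeta> b"
  shows "apply_kernel S M \<xi> a = apply_kernel S N \<zeta> a"
  unfolding apply_kernel_def by (rule infsum_cong) (simp add: assms)

section \<open>Convolution of operator-bounded functions\<close>

context groupoid
begin

section \<open>Arrow calculus in a source fibre\<close>

lemma unitsD:
  assumes "u \<in> units G"
  shows "u \<in> arrows G" "gdom G u = u" "gran G u = u"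
  using assms by (auto simp: units_def dom_closed dom_dom ran_dom)

lemma dom_in_units: "\<alpha> \<in> arrows G \<Longrightarrow> gdom G \<alpha> \<in> units G"
  by (simp add: units_def)

lemma units_iff: "u \<in> units G \<longleftrightarrow> u \<in> arrows G \<and> gdom G u = u"
  using unitsD dom_in_units by metis

lemma ran_in_units: "\<alpha> \<in> arrows G \<Longrightarrow> gran G \<alpha> \<in> units G"
  by (simp add: units_iff ran_closed dom_ran)

lemma mult_cancel_left:
  assumes "\<alpha> \<in> arrows G" "\<beta> \<in> arrows G" "\<gamma> \<in> arrows G" "gdom G \<alpha> = gran G \<beta>" "gdom G \<alpha> = gran G \<gamma>"
    "gmult G \<alpha> \<beta> = gmult G \<alpha> \<gamma>"
  shows "\<beta> = \<gamma>"
proof -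
  have "gmult G (ginv G \<alpha>) (gmult G \<alpha> \<beta>) = \<beta>" if "\<beta> \<in> arrows G" "gdom G \<alpha> = gran G \<beta>" for \<beta>
    using that assms(1) by (simp add: mult_assoc[symmetric] inv_closed dom_inv inv_mult ran_times)
  then show ?thesis using assms by metis
qed

lemma inv_inv [simp]: "\<alpha> \<in> arrows G \<Longrightarrow> ginv G (ginv G \<alpha>) = \<alpha>"
  by (rule mult_cancel_left[of "ginv G \<alpha>"])
     (simp_all add: inv_closed dom_inv ran_inv mult_inv inv_mult)

lemma inv_unit: "u \<in> units G \<Longrightarrow> ginv G u = u"
  using mult_dom[of "ginv G u"] inv_mult[of u] unitsD[of u] dom_inv[of u] inv_closed[of u] by simp

lemma mult_unit_right: "\<lbrakk>\<alpha> \<in> arrows G; u \<in> units G; gdom G \<alpha> = u\<rbrakk> \<Longrightarrow> gmult G \<alpha> u = \<alpha>"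
  using mult_dom by blast

lemma source_fibreD:
  assumes "\<alpha> \<in> source_fibre G x"
  shows "\<alpha> \<in> arrows G" "gdom G \<alpha> = x" "x \<in> units G"
  using assms dom_in_units by (auto simp: source_fibre_def)

lemma unit_in_source_fibre: "x \<in> units G \<Longrightarrow> x \<in> source_fibre G x"
  using unitsD by (simp add: source_fibre_def)

text \<open>The matrix entries of the regular representation at \<open>x\<close> are indexed by
  pairs of arrows with source \<open>x\<close> and depend only on this quotient.\<close>

lemma quotient:
  assumes "\<alpha> \<in> source_fibre G x" "\<beta> \<in> source_fibre G x"
  shows "gmult G \<alpha> (ginv G \<beta>) \<in> arrows G" "gdom G (gmult G \<alpha> (ginv G \<beta>)) = gran G \<beta>"
    "gran G (gmult G \<alpha> (ginv G \<beta>)) = gran G \<alpha>"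
proof -
  note a = source_fibreD[OF assms(1)] and b = source_fibreD[OF assms(2)]
  have eq: "gdom G \<alpha> = gran G (ginv G \<beta>)" by (simp only: a(2) ran_inv[OF b(1)] b(2))
  show "gmult G \<alpha> (ginv G \<beta>) \<in> arrows G" "gdom G (gmult G \<alpha> (ginv G \<beta>)) = gran G \<beta>"
    "gran G (gmult G \<alpha> (ginv G \<beta>)) = gran G \<alpha>"
    using mult_closed[OF a(1) inv_closed[OF b(1)] eq] dom_mult[OF a(1) inv_closed[OF b(1)] eq]
      ran_mult[OF a(1) inv_closed[OF b(1)] eq] by (simp_all only: dom_inv[OF b(1)])
qed

lemma quotient_mult:
  assumes "\<alpha> \<in> source_fibre G x" "\<beta> \<in> source_fibre G x"
  shows "gmult G (gmult G \<alpha> (ginv G \<beta>)) \<beta> = \<alpha>"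
  using source_fibreD(1,2)[OF assms(1)] source_fibreD(1,2)[OF assms(2)]
  by (simp add: mult_assoc inv_closed ran_inv dom_inv inv_mult mult_unit_right source_fibreD(3)[OF assms(1)])

lemma quotient_quotient:
  assumes "\<alpha> \<in> source_fibre G x" "\<beta> \<in> source_fibre G x" "\<kappa> \<in> source_fibre G x"
  shows "gmult G (gmult G \<alpha> (ginv G \<kappa>)) (gmult G \<kappa> (ginv G \<beta>)) = gmult G \<alpha> (ginv G \<beta>)"
  using source_fibreD(1,2)[OF assms(1)] source_fibreD(1,2)[OF assms(2)] source_fibreD(1,2)[OF assms(3)]
    quotient[OF assms(1,3)] quotient_mult[OF assms(1,3)]
  by (simp add: mult_assoc[symmetric] inv_closed ran_inv)

lemma inv_quotient:
  assumes "\<alpha> \<in> source_fibre G x" "\<beta> \<in> source_fibre G x"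
  shows "ginv G (gmult G \<alpha> (ginv G \<beta>)) = gmult G \<beta> (ginv G \<alpha>)"
proof (rule mult_cancel_left[of "gmult G \<alpha> (ginv G \<beta>)"])
  note q = quotient[OF assms] quotient[OF assms(2,1)]
  show "gmult G (gmult G \<alpha> (ginv G \<beta>)) (ginv G (gmult G \<alpha> (ginv G \<beta>)))
      = gmult G (gmult G \<alpha> (ginv G \<beta>)) (gmult G \<beta> (ginv G \<alpha>))"
    using q source_fibreD[OF assms(1)] by (simp add: quotient_quotient[OF assms(1) assms(1) assms(2)] mult_inv)
qed (use quotient[OF assms] quotient[OF assms(2,1)] in \<open>simp_all add: inv_closed ran_inv\<close>)

lemma quotient_right_cancel:
  assumes "\<alpha> \<in> source_fibre G x" "\<beta> \<in> source_fibre G x" "\<kappa> \<in> source_fibre G x"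
    "gmult G \<alpha> (ginv G \<kappa>) = gmult G \<beta> (ginv G \<kappa>)"
  shows "\<alpha> = \<beta>"
  using quotient_mult[OF assms(1,3)] quotient_mult[OF assms(2,3)] assms(4) by metis

lemma quotient_left_cancel:
  assumes "\<alpha> \<in> source_fibre G x" "\<beta> \<in> source_fibre G x" "\<kappa> \<in> source_fibre G x"
    "gmult G \<kappa> (ginv G \<alpha>) = gmult G \<kappa> (ginv G \<beta>)"
  shows "\<alpha> = \<beta>"
  using assms inv_quotient quotient_right_cancel by metis

lemma quotient_unit:
  assumes "\<alpha> \<in> source_fibre G x"
  shows "gmult G \<alpha> (ginv G x) = \<alpha>"
  using source_fibreD[OF assms] by (simp add: inv_unit mult_unit_right)

text \<open>Consequently functions supported on the units have diagonal kernels on every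
  fibre.\<close>

lemma quotient_in_units_iff:
  assumes "\<alpha> \<in> source_fibre G x" "\<beta> \<in> source_fibre G x"
  shows "gmult G \<alpha> (ginv G \<beta>) \<in> units G \<longleftrightarrow> \<alpha> = \<beta>"
proof
  assume u: "gmult G \<alpha> (ginv G \<beta>) \<in> units G"
  then have "gmult G \<alpha> (ginv G \<beta>) = gran G \<beta>" using unitsD(2)[OF u] quotient(2)[OF assms] by simp
  then show "\<alpha> = \<beta>" using quotient_mult[OF assms] ran_times source_fibreD[OF assms(2)] by simp
qed (use source_fibreD[OF assms(1)] in \<open>simp add: mult_inv ran_in_units\<close>)

text \<open>Reindexes the convolution series, a sum over the arrows with a given range, by a source
  fibre. The arrow \<beta> comes from \<open>\<kappa> = \<beta>^-1 \<alpha>\<close>.\<close>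

lemma bij_betw_quotient:
  assumes "\<alpha> \<in> source_fibre G x"
  shows "bij_betw (\<lambda>\<kappa>. gmult G \<alpha> (ginv G \<kappa>)) (source_fibre G x) {\<beta> \<in> arrows G. gran G \<beta> = gran G \<alpha>}"
proof (rule bij_betwI')
  note a = source_fibreD[OF assms]
  fix \<kappa> \<kappa>' assume "\<kappa> \<in> source_fibre G x" "\<kappa>' \<in> source_fibre G x"
  then show "(gmult G \<alpha> (ginv G \<kappa>) = gmult G \<alpha> (ginv G \<kappa>')) = (\<kappa> = \<kappa>')"
    using quotient_left_cancel assms by metis
next
  fix \<kappa> assume "\<kappa> \<in> source_fibre G x"
  then show "gmult G \<alpha> (ginv G \<kappa>) \<in> {\<beta> \<in> arrows G. gran G \<beta> = gran G \<alpha>}"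
    using quotient assms by simp
next
  note a = source_fibreD[OF assms]
  fix \<beta> assume "\<beta> \<in> {\<beta> \<in> arrows G. gran G \<beta> = gran G \<alpha>}"
  then have b: "\<beta> \<in> arrows G" "gran G \<beta> = gran G \<alpha>" by auto
  let ?k = "gmult G (ginv G \<beta>) \<alpha>"
  have k: "?k \<in> source_fibre G x"
    using a b by (simp add: source_fibre_def mult_closed dom_mult inv_closed dom_inv)
  have "gmult G \<alpha> (ginv G ?k) = \<beta>"
  proof (rule mult_cancel_left[of "ginv G \<beta>"])
    have "gmult G (ginv G \<beta>) (gmult G \<alpha> (ginv G ?k)) = gmult G ?k (ginv G ?k)"
      using a b k by (simp add: mult_assoc inv_closed dom_inv ran_inv source_fibreD)
    also have "\<dots> = gmult G (ginv G \<beta>) \<beta>"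
      using a b source_fibreD[OF k] by (simp add: mult_inv inv_mult ran_mult inv_closed dom_inv ran_inv)
    finally show "gmult G (ginv G \<beta>) (gmult G \<alpha> (ginv G ?k)) = gmult G (ginv G \<beta>) \<beta>" .
  qed (use a b quotient[OF assms k] in \<open>simp_all add: inv_closed dom_inv\<close>)
  then show "\<exists>\<kappa>\<in>source_fibre G x. \<beta> = gmult G \<alpha> (ginv G \<kappa>)" using k by metis
qed

section \<open>Functions as kernels on the source fibres\<close>

definition kern :: "('g \<Rightarrow> complex) \<Rightarrow> 'g \<Rightarrow> 'g \<Rightarrow> complex" where
  "kern f \<alpha> \<beta> = f (gmult G \<alpha> (ginv G \<beta>))"

text \<open>Boundedness by \<open>C\<close> in every regular representation, tested on finite blocks so that it passes to
  pointwise limits.\<close>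

definition opb :: "('g \<Rightarrow> complex) \<Rightarrow> real \<Rightarrow> bool" where
  "opb f C \<longleftrightarrow> 0 \<le> C \<and> (\<forall>x\<in>units G. bounded_kernel (source_fibre G x) (kern f) C)"

lemma opbD0: "opb f C \<Longrightarrow> 0 \<le> C" by (simp add: opb_def)

lemma opbD: "\<lbrakk>opb f C; x \<in> units G\<rbrakk> \<Longrightarrow> bounded_kernel (source_fibre G x) (kern f) C"
  by (simp add: opb_def)

text \<open>The column indexed by the unit \<open>x\<close> is the function itself on the fibre.
  Pointwise bounds, square summability and convolution are all read off from this column.\<close>

lemma kern_unit: "\<alpha> \<in> source_fibre G x \<Longrightarrow> kern f \<alpha> x = f \<alpha>"
  by (simp add: kern_def quotient_unit)

lemma kern_convolution:
  assumes "\<alpha> \<in> source_fibre G x" "\<beta> \<in> source_fibre G x"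
  shows "kern (convolution G f g) \<alpha> \<beta> = (\<Sum>\<^sub>\<infinity>\<kappa>\<in>source_fibre G x. kern f \<alpha> \<kappa> * kern g \<kappa> \<beta>)"
proof -
  let ?q = "gmult G \<alpha> (ginv G \<beta>)"
  note q = quotient[OF assms]
  have "kern (convolution G f g) \<alpha> \<beta>
      = (\<Sum>\<^sub>\<infinity>\<gamma>\<in>{\<gamma> \<in> arrows G. gran G \<gamma> = gran G \<alpha>}. f \<gamma> * g (gmult G (ginv G \<gamma>) ?q))"
    by (simp add: kern_def convolution_def q)
  also have "\<dots> = (\<Sum>\<^sub>\<infinity>\<kappa>\<in>source_fibre G x. f (gmult G \<alpha> (ginv G \<kappa>)) *
      g (gmult G (ginv G (gmult G \<alpha> (ginv G \<kappa>))) ?q))"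
    by (rule infsum_reindex_bij_betw[symmetric, OF bij_betw_quotient[OF assms(1)]])
  also have "\<dots> = (\<Sum>\<^sub>\<infinity>\<kappa>\<in>source_fibre G x. kern f \<alpha> \<kappa> * kern g \<kappa> \<beta>)"
    using assms by (intro infsum_cong) (simp add: kern_def inv_quotient quotient_quotient)
  finally show ?thesis .
qed

text \<open>The matrix product read in the column of the unit: \<open>f\<close> acts as a matrix on
  the restriction of \<open>g\<close> to the fibre.\<close>

lemma convolution_eq_apply:
  assumes "\<gamma> \<in> source_fibre G x"
  shows "convolution G f g \<gamma> = apply_kernel (source_fibre G x) (kern f) g \<gamma>"
proof -
  note x = source_fibreD[OF assms]
  have "convolution G f g \<gamma> = kern (convolution G f g) \<gamma> x" by (simp add: kern_unit assms)
  also have "\<dots> = (\<Sum>\<^sub>\<infinity>\<kappa>\<in>source_fibre G x. kern f \<gamma> \<kappa> * kern g \<kappa> x)"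
    by (rule kern_convolution) (use assms x in \<open>auto simp: unit_in_source_fibre\<close>)
  also have "\<dots> = apply_kernel (source_fibre G x) (kern f) g \<gamma>"
    unfolding apply_kernel_def by (rule infsum_cong) (simp add: kern_unit)
  finally show ?thesis .
qed

lemma convolution_outside: "\<gamma> \<notin> arrows G \<Longrightarrow> convolution G f g \<gamma> = 0"
  by (simp add: convolution_def)

lemma involution_outside: "\<gamma> \<notin> arrows G \<Longrightarrow> involution G f \<gamma> = 0"
  by (simp add: involution_def)

lemma in_fibre: "\<gamma> \<in> arrows G \<Longrightarrow> \<gamma> \<in> source_fibre G (gdom G \<gamma>)"
  by (simp add: source_fibre_def)

lemma opb_add: "\<lbrakk>opb f C; opb g D\<rbrakk> \<Longrightarrow> opb (\<lambda>\<gamma>. f \<gamma> + g \<gamma>) (C + D)"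
  using bounded_kernel_add[of _ "kern f" C "kern g" D] by (auto simp: opb_def kern_def[abs_def])

lemma opb_scale: "opb f C \<Longrightarrow> opb (\<lambda>\<gamma>. c * f \<gamma>) (norm c * C)"
  using bounded_kernel_scale[of _ "kern f" C c] by (auto simp: opb_def kern_def[abs_def])

lemma opb_mono: "\<lbrakk>opb f C; C \<le> D\<rbrakk> \<Longrightarrow> opb f D"
  using order_trans by (auto simp: opb_def intro: bounded_kernel_mono)

lemma opb_diff: "\<lbrakk>opb f C; opb g D\<rbrakk> \<Longrightarrow> opb (\<lambda>\<gamma>. f \<gamma> - g \<gamma>) (C + D)"
  using opb_add[of f C "\<lambda>\<gamma>. (-1) * g \<gamma>" D] opb_scale[of g D "-1"] by simp

lemma opb_convolution:
  assumes "opb f C" "opb g D"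
  shows "opb (convolution G f g) (C * D)"
proof -
  have "bounded_kernel (source_fibre G x) (kern (convolution G f g)) (C * D)" if x: "x \<in> units G" for x
    using bounded_kernel_mult(1)[OF opbD[OF assms(1) x] opbD[OF assms(2) x]]
    by (subst bounded_kernel_cong[OF kern_convolution])
  then show ?thesis using assms by (simp add: opb_def)
qed

lemma kern_involution:
  assumes "\<alpha> \<in> source_fibre G x" "\<beta> \<in> source_fibre G x"
  shows "kern (involution G f) \<alpha> \<beta> = cnj (kern f \<beta> \<alpha>)"
  by (simp add: kern_def involution_def quotient[OF assms] inv_quotient[OF assms])

lemma opb_involution:
  assumes "opb f C"
  shows "opb (involution G f) C"
proof -
  have "bounded_kernel (source_fibre G x) (kern (involution G f)) C" if x: "x \<in> units G" for x
    using bounded_kernel_cnj[OF bounded_kernel_transpose[OF opbD[OF assms x]]]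
    by (subst bounded_kernel_cong[OF kern_involution])
  then show ?thesis using assms by (simp add: opb_def)
qed

lemma opb_lim:
  assumes "\<And>n. opb (f n) C" "\<And>\<gamma>. \<gamma> \<in> arrows G \<Longrightarrow> (\<lambda>n::nat. f n \<gamma>) \<longlonglongrightarrow> g \<gamma>"
  shows "opb g C"
proof -
  have "bounded_kernel (source_fibre G x) (kern g) C" if x: "x \<in> units G" for x
    by (rule bounded_kernel_lim[where M="\<lambda>n. kern (f n)", OF opbD[OF assms(1) x]]) (simp add: kern_def assms(2) quotient)
  then show ?thesis using assms(1) by (simp add: opb_def)
qed

text \<open>The value at \<gamma> is the matrix entry in the row of \<gamma> and the column of its
  source, and a single entry is a block.\<close>

lemma opb_pointwise:
  assumes "opb f C" "\<gamma> \<in> arrows G"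
  shows "norm (f \<gamma>) \<le> C"
proof -
  let ?x = "gdom G \<gamma>"
  have g: "\<gamma> \<in> source_fibre G ?x" "?x \<in> units G" "?x \<in> source_fibre G ?x"
    using assms by (auto simp: in_fibre dom_in_units unit_in_source_fibre)
  have "norm (\<Sum>a\<in>{\<gamma>}. \<Sum>b\<in>{?x}. 1 * kern f a b * 1)
      \<le> C * L2_set (\<lambda>b. norm (1::complex)) {?x} * L2_set (\<lambda>a. norm (1::complex)) {\<gamma>}"
    by (rule bounded_kernel_rect[OF opbD[OF assms(1) g(2)]]) (use g in auto)
  then show ?thesis using g by (simp add: kern_unit)
qed

lemma sq_summable_fibre:
  assumes "opb f C" "x \<in> units G"
  shows "f sq_summable_on (source_fibre G x)"
proof -
  have "(\<lambda>\<alpha>. kern f \<alpha> x) sq_summable_on (source_fibre G x)"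
    using bounded_kernel_row(1)[OF bounded_kernel_transpose[OF opbD[OF assms]]] assms unit_in_source_fibre by blast
  then show ?thesis by (subst summable_on_cong[of _ _ "\<lambda>a. (norm (kern f a x))\<^sup>2"]) (auto simp: kern_unit)
qed

lemma apply_convolution:
  assumes "opb f C" "opb g D" "\<gamma> \<in> source_fibre G x" "\<xi> sq_summable_on (source_fibre G x)"
  shows "apply_kernel (source_fibre G x) (kern (convolution G f g)) \<xi> \<gamma>
    = apply_kernel (source_fibre G x) (kern f) (apply_kernel (source_fibre G x) (kern g) \<xi>) \<gamma>"
proof -
  have x: "x \<in> units G" using source_fibreD[OF assms(3)] by simp
  have "apply_kernel (source_fibre G x) (kern (convolution G f g)) \<xi> \<gamma>
      = apply_kernel (source_fibre G x) (\<lambda>a b. \<Sum>\<^sub>\<infinity>k\<in>source_fibre G x. kern f a k * kern g k b) \<xi> \<gamma>"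
    by (rule apply_kernel_cong) (simp_all add: kern_convolution assms)
  then show ?thesis using bounded_kernel_mult(2)[OF opbD[OF assms(1) x] opbD[OF assms(2) x] assms(3,4)] by simp
qed

text \<open>On each fibre \<open>h\<close> is a square-summable vector, so associativity becomes the
  composition rule \<open>apply_convolution\<close>, and the delicate interchange of series has
  already been settled there.\<close>

lemma convolution_assoc:
  assumes "opb f C" "opb g D" "opb h E"
  shows "convolution G (convolution G f g) h = convolution G f (convolution G g h)"
proof
  fix \<gamma>
  show "convolution G (convolution G f g) h \<gamma> = convolution G f (convolution G g h) \<gamma>"
  proof (cases "\<gamma> \<in> arrows G")
    case True
    then have g: "\<gamma> \<in> source_fibre G (gdom G \<gamma>)" by (rule in_fibre)
    note x = source_fibreD(3)[OF g]
    let ?S = "source_fibre G (gdom G \<gamma>)"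
    have "convolution G (convolution G f g) h \<gamma> = apply_kernel ?S (kern f) (apply_kernel ?S (kern g) h) \<gamma>"
      by (simp add: convolution_eq_apply[OF g] apply_convolution[OF assms(1,2) g sq_summable_fibre[OF assms(3) x]])
    also have "\<dots> = apply_kernel ?S (kern f) (convolution G g h) \<gamma>"
      by (rule apply_kernel_cong) (simp_all add: convolution_eq_apply)
    finally show ?thesis by (simp add: convolution_eq_apply[OF g])
  qed (simp add: convolution_outside)
qed

lemma convolution_summable:
  assumes "opb f C" "opb g D" "\<gamma> \<in> source_fibre G x"
  shows "(\<lambda>\<kappa>. kern f \<gamma> \<kappa> * g \<kappa>) summable_on (source_fibre G x)"
  by (rule row_summable[OF opbD[OF assms(1)] assms(3) sq_summable_fibre[OF assms(2)]])
     (use source_fibreD[OF assms(3)] in simp_all)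

lemma convolution_add_left:
  assumes "opb f C" "opb g D" "opb h E"
  shows "convolution G (\<lambda>\<gamma>. f \<gamma> + g \<gamma>) h = (\<lambda>\<gamma>. convolution G f h \<gamma> + convolution G g h \<gamma>)"
proof
  fix \<gamma>
  show "convolution G (\<lambda>\<gamma>. f \<gamma> + g \<gamma>) h \<gamma> = convolution G f h \<gamma> + convolution G g h \<gamma>"
  proof (cases "\<gamma> \<in> arrows G")
    case True
    note g = in_fibre[OF True]
    show ?thesis unfolding convolution_eq_apply[OF g] apply_kernel_def
      using infsum_add[OF convolution_summable[OF assms(1,3) g] convolution_summable[OF assms(2,3) g]]
      by (simp add: kern_def distrib_right)
  qed (simp add: convolution_outside)
qed

lemma convolution_add_right:
  assumes "opb f C" "opb g D" "opb h E"
  shows "convolution G f (\<lambda>\<gamma>. g \<gamma> + h \<gamma>) = (\<lambda>\<gamma>. convolution G f g \<gamma> + convolution G f h \<gamma>)"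
proof
  fix \<gamma>
  show "convolution G f (\<lambda>\<gamma>. g \<gamma> + h \<gamma>) \<gamma> = convolution G f g \<gamma> + convolution G f h \<gamma>"
  proof (cases "\<gamma> \<in> arrows G")
    case True
    note g = in_fibre[OF True]
    show ?thesis unfolding convolution_eq_apply[OF g] apply_kernel_def
      using infsum_add[OF convolution_summable[OF assms(1,2) g] convolution_summable[OF assms(1,3) g]]
      by (simp add: distrib_left)
  qed (simp add: convolution_outside)
qed

lemma convolution_scale_left: "convolution G (\<lambda>\<gamma>. c * f \<gamma>) g = (\<lambda>\<gamma>. c * convolution G f g \<gamma>)"
proof
  fix \<gamma>
  show "convolution G (\<lambda>\<gamma>. c * f \<gamma>) g \<gamma> = c * convolution G f g \<gamma>"
  proof (cases "\<gamma> \<in> arrows G")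
    case True
    show ?thesis unfolding convolution_eq_apply[OF in_fibre[OF True]] apply_kernel_def
      by (simp add: kern_def infsum_cmult_right'[symmetric] mult.assoc)
  qed (simp add: convolution_outside)
qed

lemma convolution_scale_right: "convolution G f (\<lambda>\<gamma>. c * g \<gamma>) = (\<lambda>\<gamma>. c * convolution G f g \<gamma>)"
proof
  fix \<gamma>
  show "convolution G f (\<lambda>\<gamma>. c * g \<gamma>) \<gamma> = c * convolution G f g \<gamma>"
  proof (cases "\<gamma> \<in> arrows G")
    case True
    show ?thesis unfolding convolution_eq_apply[OF in_fibre[OF True]] apply_kernel_def
      by (simp add: infsum_cmult_right'[symmetric] mult.left_commute)
  qed (simp add: convolution_outside)
qed

text \<open>The involution transposes and conjugates kernels, so the two series agree term by term
  in the column of the source.\<close>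

lemma involution_convolution:
  "involution G (convolution G f g) = convolution G (involution G g) (involution G f)"
proof
  fix \<gamma>
  show "involution G (convolution G f g) \<gamma> = convolution G (involution G g) (involution G f) \<gamma>"
  proof (cases "\<gamma> \<in> arrows G")
    case True
    let ?x = "gdom G \<gamma>" and ?S = "source_fibre G (gdom G \<gamma>)"
    note g = in_fibre[OF True]
    have x: "?x \<in> ?S" using source_fibreD[OF g] unit_in_source_fibre by simp
    have "involution G (convolution G f g) \<gamma> = kern (involution G (convolution G f g)) \<gamma> ?x"
      by (simp add: kern_unit[OF g])
    also have "\<dots> = cnj (\<Sum>\<^sub>\<infinity>\<kappa>\<in>?S. kern f ?x \<kappa> * kern g \<kappa> \<gamma>)"
      by (simp add: kern_involution[OF g x] kern_convolution[OF x g])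
    also have "\<dots> = (\<Sum>\<^sub>\<infinity>\<kappa>\<in>?S. kern (involution G g) \<gamma> \<kappa> * kern (involution G f) \<kappa> ?x)"
      unfolding infsum_cnj[symmetric] using g x
      by (intro infsum_cong) (simp add: kern_involution[where x="?x"])
    also have "\<dots> = convolution G (involution G g) (involution G f) \<gamma>"
      unfolding kern_convolution[OF g x, symmetric] by (simp add: kern_unit[OF g])
    finally show ?thesis .
  qed (simp add: convolution_outside involution_outside)
qed

lemma involution_involution:
  "(\<And>\<gamma>. \<gamma> \<notin> arrows G \<Longrightarrow> f \<gamma> = 0) \<Longrightarrow> involution G (involution G f) = f"
  by (auto simp: involution_def inv_closed fun_eq_iff)

text \<open>The usual identity between the quadratic form of \<open>f* f\<close> and the squared
  norm of \<open>f \<xi>\<close>: one copy of the kernel is moved across the pairing as its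
  transpose.\<close>

lemma apply_adjoint_square:
  assumes "opb f C" "x \<in> units G" "\<xi> sq_summable_on (source_fibre G x)"
  shows "(\<Sum>\<^sub>\<infinity>\<beta>\<in>source_fibre G x.
      cnj (apply_kernel (source_fibre G x) (kern (convolution G (involution G f) f)) \<xi> \<beta>) * \<xi> \<beta>)
    = of_real ((l2_norm (source_fibre G x) (apply_kernel (source_fibre G x) (kern f) \<xi>))\<^sup>2)"
proof -
  let ?S = "source_fibre G x"
  let ?M = "apply_kernel ?S (kern f) \<xi>"
  note M = opbD[OF assms(1,2)]
  have "(\<Sum>\<^sub>\<infinity>\<beta>\<in>?S. cnj (apply_kernel ?S (kern (convolution G (involution G f) f)) \<xi> \<beta>) * \<xi> \<beta>)
      = (\<Sum>\<^sub>\<infinity>\<beta>\<in>?S. apply_kernel ?S (\<lambda>a b. kern f b a) (\<lambda>a. cnj (?M a)) \<beta> * \<xi> \<beta>)"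
  proof (rule infsum_cong)
    fix \<beta> assume b: "\<beta> \<in> ?S"
    have "cnj (apply_kernel ?S (kern (convolution G (involution G f) f)) \<xi> \<beta>)
        = cnj (apply_kernel ?S (kern (involution G f)) ?M \<beta>)"
      by (simp add: apply_convolution[OF opb_involution[OF assms(1)] assms(1) b assms(3)])
    also have "\<dots> = apply_kernel ?S (\<lambda>a b. kern f b a) (\<lambda>a. cnj (?M a)) \<beta>"
      unfolding apply_kernel_def[of _ _ ?M] apply_kernel_def[of _ _ "\<lambda>a. cnj (?M a)"] infsum_cnj[symmetric]
      by (rule infsum_cong) (simp add: kern_involution[OF b])
    finally show "cnj (apply_kernel ?S (kern (convolution G (involution G f) f)) \<xi> \<beta>) * \<xi> \<beta>
        = apply_kernel ?S (\<lambda>a b. kern f b a) (\<lambda>a. cnj (?M a)) \<beta> * \<xi> \<beta>" by simp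
  qed
  also have "\<dots> = (\<Sum>\<^sub>\<infinity>a\<in>?S. cnj (?M a) * ?M a)"
    by (rule apply_kernel_pairing_swap[symmetric, OF M assms(3)])
       (use apply_kernel_bounded(1)[OF M assms(3)] in simp)
  also have "\<dots> = (\<Sum>\<^sub>\<infinity>a\<in>?S. of_real ((norm (?M a))\<^sup>2))"
    by (rule infsum_cong) (simp only: complex_norm_square mult.commute)
  also have "\<dots> = of_real (\<Sum>\<^sub>\<infinity>a\<in>?S. (norm (?M a))\<^sup>2)"
    by (rule infsumI[OF has_sum_of_real[OF has_sum_infsum[OF apply_kernel_bounded(1)[OF M assms(3)]]]])
  finally show ?thesis by (simp only: l2_norm_square)
qed

text \<open>If \<open>f* f = 1 - (1 - s)\<^sup>2\<close> with \<open>s\<close> self-adjoint, then \<open>f* f \<le> 1\<close>.\<close>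

lemma opb_one_if_square_root:
  assumes f: "opb f C" and s: "opb s D" "involution G s = s"
    and eq: "\<And>\<gamma>. \<gamma> \<in> arrows G \<Longrightarrow>
      convolution G (involution G f) f \<gamma> = 2 * s \<gamma> - convolution G s s \<gamma>"
  shows "opb f 1"
proof -
  have "bounded_kernel (source_fibre G x) (kern f) 1" if x: "x \<in> units G" for x
  proof (rule bounded_kernelI)
    let ?S = "source_fibre G x"
    fix \<xi> assume "\<xi> \<in> l2 ?S"
    then have \<xi>: "\<xi> sq_summable_on ?S" by (simp add: l2_def)
    let ?M = "apply_kernel ?S (kern f) \<xi>" and ?N = "apply_kernel ?S (kern s) \<xi>"
      and ?P = "apply_kernel ?S (kern (convolution G s s)) \<xi>"
    show "?M sq_summable_on ?S" by (rule apply_kernel_bounded[OF opbD[OF f x] \<xi>])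
    have N: "?N sq_summable_on ?S" by (rule apply_kernel_bounded[OF opbD[OF s(1) x] \<xi>])
    have P: "?P sq_summable_on ?S"
      by (rule apply_kernel_bounded[OF opbD[OF opb_convolution[OF s(1) s(1)] x] \<xi>])
    have e: "apply_kernel ?S (kern (convolution G (involution G f) f)) \<xi> \<beta> = 2 * ?N \<beta> - ?P \<beta>" if b: "\<beta> \<in> ?S" for \<beta>
    proof -
      have "apply_kernel ?S (kern (convolution G (involution G f) f)) \<xi> \<beta>
          = (\<Sum>\<^sub>\<infinity>b\<in>?S. 2 * (kern s \<beta> b * \<xi> b) - kern (convolution G s s) \<beta> b * \<xi> b)"
        unfolding apply_kernel_def
        by (rule infsum_cong) (simp add: kern_def eq quotient[OF b] left_diff_distrib)
      also have "\<dots> = 2 * ?N \<beta> - ?P \<beta>"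
        unfolding apply_kernel_def infsum_cmult_right'[symmetric]
        by (rule infsum_diff[OF summable_on_cmult_right[OF row_summable[OF opbD[OF s(1) x] b \<xi>]]
            row_summable[OF opbD[OF opb_convolution[OF s(1) s(1)] x] b \<xi>]])
      finally show ?thesis .
    qed
    have cs: "(\<lambda>b. cnj (?N b) * \<xi> b) summable_on ?S" "(\<lambda>b. cnj (?P b) * \<xi> b) summable_on ?S"
      using N P \<xi> by (auto intro!: abs_summable_summable[OF sq_summable_prod])
    let ?I = "\<Sum>\<^sub>\<infinity>b\<in>?S. cnj (?N b) * \<xi> b"
    have "of_real ((l2_norm ?S ?M)\<^sup>2) = (\<Sum>\<^sub>\<infinity>b\<in>?S. 2 * (cnj (?N b) * \<xi> b) - cnj (?P b) * \<xi> b)"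
      unfolding apply_adjoint_square[OF f x \<xi>, symmetric]
      by (rule infsum_cong) (simp add: e left_diff_distrib)
    also have "\<dots> = 2 * ?I - (\<Sum>\<^sub>\<infinity>b\<in>?S. cnj (?P b) * \<xi> b)"
      unfolding infsum_cmult_right'[symmetric]
      by (rule infsum_diff[OF summable_on_cmult_right[OF cs(1)] cs(2)])
    also have "(\<Sum>\<^sub>\<infinity>b\<in>?S. cnj (?P b) * \<xi> b) = of_real ((l2_norm ?S ?N)\<^sup>2)"
      using apply_adjoint_square[OF s(1) x \<xi>] s(2) by simp
    finally have A0: "of_real ((l2_norm ?S ?M)\<^sup>2) = 2 * ?I - of_real ((l2_norm ?S ?N)\<^sup>2)" .
    have A: "(l2_norm ?S ?M)\<^sup>2 = 2 * Re ?I - (l2_norm ?S ?N)\<^sup>2"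
      using arg_cong[where f=Re, OF A0] by (simp only: Re_complex_of_real minus_complex.sel mult_2 plus_complex.sel)
    have R: "Re ?I = (\<Sum>\<^sub>\<infinity>b\<in>?S. Re (cnj (?N b) * \<xi> b))"
      by (rule infsum_Re[symmetric, OF cs(1)])
    have Rs: "(\<lambda>b. Re (cnj (?N b) * \<xi> b)) summable_on ?S" by (rule summable_on_Re[OF cs(1)])
    \<comment> \<open>By \<open>A\<close> it remains to bound twice the real part of the pairing of
      \<open>s \<xi>\<close> with \<xi> by the sum of their squared norms. This holds term by term,
      and the norm of \<open>s \<xi>\<close> then drops out.\<close>
    have "2 * Re ?I = (\<Sum>\<^sub>\<infinity>b\<in>?S. 2 * Re (cnj (?N b) * \<xi> b))"
      unfolding R by (rule infsum_cmult_right'[symmetric])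
    also have "\<dots> \<le> (\<Sum>\<^sub>\<infinity>b\<in>?S. (norm (\<xi> b))\<^sup>2 + (norm (?N b))\<^sup>2)"
    proof (rule infsum_mono)
      show "(\<lambda>b. 2 * Re (cnj (?N b) * \<xi> b)) summable_on ?S" by (rule summable_on_cmult_right[OF Rs])
      show "(\<lambda>b. (norm (\<xi> b))\<^sup>2 + (norm (?N b))\<^sup>2) summable_on ?S" by (rule summable_on_add[OF \<xi> N])
      fix b
      have "2 * Re (cnj (?N b) * \<xi> b) \<le> 2 * (norm (?N b) * norm (\<xi> b))"
        using complex_Re_le_cmod[of "cnj (?N b) * \<xi> b"] by (simp add: norm_mult)
      also have "\<dots> \<le> (norm (\<xi> b))\<^sup>2 + (norm (?N b))\<^sup>2"
        using sum_squares_bound[of "norm (?N b)" "norm (\<xi> b)"] by simp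
      finally show "2 * Re (cnj (?N b) * \<xi> b) \<le> (norm (\<xi> b))\<^sup>2 + (norm (?N b))\<^sup>2" .
    qed
    also have "\<dots> = (l2_norm ?S \<xi>)\<^sup>2 + (l2_norm ?S ?N)\<^sup>2"
      unfolding l2_norm_square by (rule infsum_add[OF \<xi> N])
    finally have "(l2_norm ?S ?M)\<^sup>2 \<le> (l2_norm ?S \<xi>)\<^sup>2" using A by simp
    then show "l2_norm ?S ?M \<le> 1 * l2_norm ?S \<xi>" by (simp add: power2_le_iff_abs_le)
  qed simp
  then show ?thesis by (simp add: opb_def)
qed

section \<open>The reduced norm as the optimal operator bound\<close>

lemma l2_norm_regular_rep:
  "l2_norm (source_fibre G x) (regular_rep G x f \<xi>) = l2_norm (source_fibre G x) (apply_kernel (source_fibre G x) (kern f) \<xi>)"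
  unfolding l2_norm_def
  by (rule arg_cong[where f=sqrt], rule infsum_cong) (simp add: regular_rep_def apply_kernel_def kern_def)

lemma regular_rep_le:
  assumes "opb f C" "x \<in> units G" "\<xi> \<in> l2 (source_fibre G x)" "l2_norm (source_fibre G x) \<xi> \<le> 1"
  shows "l2_norm (source_fibre G x) (regular_rep G x f \<xi>) \<le> C"
proof -
  have "l2_norm (source_fibre G x) (regular_rep G x f \<xi>) \<le> C * l2_norm (source_fibre G x) \<xi>"
    unfolding l2_norm_regular_rep
    by (rule apply_kernel_bounded[OF opbD[OF assms(1,2)]]) (use assms in \<open>simp add: l2_def\<close>)
  also have "\<dots> \<le> C * 1" using assms opbD0 by (intro mult_left_mono) auto
  finally show ?thesis by simp
qed

lemma regular_rep_norm_le:
  assumes "opb f C" "x \<in> units G"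
  shows "regular_rep_norm G x f \<le> C"
  unfolding regular_rep_norm_def
proof (rule cSup_least)
  have "(\<lambda>_. 0) \<in> l2 (source_fibre G x)" "l2_norm (source_fibre G x) (\<lambda>_. 0) \<le> 1"
    by (simp_all add: l2_def l2_norm_def)
  then show "{l2_norm (source_fibre G x) (regular_rep G x f \<xi>) |\<xi>.
     \<xi> \<in> l2 (source_fibre G x) \<and> l2_norm (source_fibre G x) \<xi> \<le> 1} \<noteq> {}" by blast
qed (use assms regular_rep_le in auto)

lemma reduced_norm_le: "opb f C \<Longrightarrow> reduced_norm G f \<le> C"
  unfolding reduced_norm_def
  by (rule cSup_least) (auto simp: regular_rep_norm_le opbD0)

text \<open>The a priori bound \<open>C\<close> makes the suprema in \<open>reduced_norm\<close>
  suprema of bounded sets; a nonzero vector is then normalized to fall under them.\<close>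

lemma opb_reduced_norm:
  assumes "opb f C"
  shows "opb f (reduced_norm G f)"
proof -
  have bd: "bdd_above (insert 0 ((\<lambda>x. regular_rep_norm G x f) ` units G))"
    by (rule bdd_aboveI[of _ C]) (use assms in \<open>auto simp: regular_rep_norm_le opbD0\<close>)
  have N0: "0 \<le> reduced_norm G f" unfolding reduced_norm_def by (rule cSup_upper[OF _ bd]) simp
  have "bounded_kernel (source_fibre G x) (kern f) (reduced_norm G f)" if x: "x \<in> units G" for x
  proof (rule bounded_kernelI[OF N0])
    let ?S = "source_fibre G x"
    fix \<xi> assume l2: "\<xi> \<in> l2 ?S"
    then have \<xi>: "\<xi> sq_summable_on ?S" by (simp add: l2_def)
    note b = apply_kernel_bounded[OF opbD[OF assms x] \<xi>]
    show "apply_kernel ?S (kern f) \<xi> sq_summable_on ?S" by (rule b)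
    show "l2_norm ?S (apply_kernel ?S (kern f) \<xi>) \<le> reduced_norm G f * l2_norm ?S \<xi>"
    proof (cases "l2_norm ?S \<xi> = 0")
      case True then show ?thesis using b(2) by simp
    next
      case False
      then have pos: "0 < l2_norm ?S \<xi>" by (simp add: less_le)
      define c where "c = complex_of_real (1 / l2_norm ?S \<xi>)"
      let ?\<zeta> = "\<lambda>a. c * \<xi> a"
      have z: "?\<zeta> \<in> l2 ?S" "l2_norm ?S ?\<zeta> \<le> 1"
        using l2 sq_summable_scale[OF \<xi>, of c] pos by (auto simp: l2_def l2_norm_scale, auto simp: c_def norm_divide)
      have "apply_kernel ?S (kern f) ?\<zeta> = (\<lambda>a. c * apply_kernel ?S (kern f) \<xi> a)"
        by (simp add: apply_kernel_def[abs_def] infsum_cmult_right'[symmetric] mult.left_commute)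
      then have "l2_norm ?S (regular_rep G x f ?\<zeta>) = l2_norm ?S (apply_kernel ?S (kern f) \<xi>) / l2_norm ?S \<xi>"
        unfolding l2_norm_regular_rep by (simp add: l2_norm_scale) (simp add: c_def norm_divide)
      moreover have "l2_norm ?S (regular_rep G x f ?\<zeta>) \<le> regular_rep_norm G x f"
        unfolding regular_rep_norm_def
      proof (rule cSup_upper)
        show "bdd_above {l2_norm ?S (regular_rep G x f \<xi>) |\<xi>. \<xi> \<in> l2 ?S \<and> l2_norm ?S \<xi> \<le> 1}"
          by (rule bdd_aboveI[of _ C]) (use regular_rep_le[OF assms x] in blast)
      qed (use z in blast)
      moreover have "regular_rep_norm G x f \<le> reduced_norm G f"
        unfolding reduced_norm_def by (rule cSup_upper[OF _ bd]) (use x in simp)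
      ultimately have "l2_norm ?S (apply_kernel ?S (kern f) \<xi>) / l2_norm ?S \<xi> \<le> reduced_norm G f"
        by linarith
      then show ?thesis using pos by (simp add: pos_divide_le_eq)
    qed
  qed
  then show ?thesis using N0 by (simp add: opb_def)
qed

end

section \<open>Topology of etale groupoids\<close>

lemma continuous_map_locally:
  assumes "\<And>x. x \<in> topspace X \<Longrightarrow> \<exists>U. openin X U \<and> x \<in> U \<and> continuous_map (subtopology X U) Y f"
  shows "continuous_map X Y f"
  unfolding continuous_map_def
proof (intro conjI allI impI)
  show "f \<in> topspace X \<rightarrow> topspace Y"
    using assms by (force simp: continuous_map_def Pi_iff)
  fix V assume V: "openin Y V"
  show "openin X {x \<in> topspace X. f x \<in> V}"
  proof (subst openin_subopen, intro ballI)
    fix x assume x: "x \<in> {x \<in> topspace X. f x \<in> V}"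
    then obtain U where U: "openin X U" "x \<in> U" "continuous_map (subtopology X U) Y f" using assms by blast
    then have "openin (subtopology X U) {y \<in> topspace (subtopology X U). f y \<in> V}"
      using V by (simp only: continuous_map_def)
    then have "openin X {y \<in> topspace (subtopology X U). f y \<in> V}"
      using U(1) by (rule openin_trans_full)
    then show "\<exists>T. openin X T \<and> x \<in> T \<and> T \<subseteq> {x \<in> topspace X. f x \<in> V}"
      using x U(2) by (intro exI[of _ "{y \<in> topspace (subtopology X U). f y \<in> V}"]) auto
  qed
qed

lemma continuous_map_compose_continuous_on:
  assumes "continuous_map X euclidean f" "continuous_on UNIV h"
  shows "continuous_map X euclidean (\<lambda>x. h (f x))"
  using continuous_map_compose[OF assms(1), of euclidean h] assms(2) by (simp add: o_def)

lemma continuous_map_times: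
  fixes f g :: "'a \<Rightarrow> complex"
  assumes "continuous_map X euclidean f" "continuous_map X euclidean g"
  shows "continuous_map X euclidean (\<lambda>x. f x * g x)"
  using assms by (simp add: continuous_map_atin tendsto_mult)

lemma C_c_iff:
  assumes "Hausdorff_space X"
  shows "f \<in> C_c X \<longleftrightarrow> continuous_map X euclidean f \<and> (\<forall>x. x \<notin> topspace X \<longrightarrow> f x = 0)
    \<and> (\<exists>K. compactin X K \<and> (\<forall>x. x \<notin> K \<longrightarrow> f x = 0))"
proof
  assume f: "f \<in> C_c X"
  let ?K = "X closure_of {x \<in> topspace X. f x \<noteq> 0}"
  have "f x = 0" if "x \<notin> ?K" for x
    using that f closure_of_subset[of "{x \<in> topspace X. f x \<noteq> 0}" X] by (auto simp: C_c_def)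
  then show "continuous_map X euclidean f \<and> (\<forall>x. x \<notin> topspace X \<longrightarrow> f x = 0)
    \<and> (\<exists>K. compactin X K \<and> (\<forall>x. x \<notin> K \<longrightarrow> f x = 0))"
    using f by (auto simp: C_c_def)
next
  assume "continuous_map X euclidean f \<and> (\<forall>x. x \<notin> topspace X \<longrightarrow> f x = 0)
    \<and> (\<exists>K. compactin X K \<and> (\<forall>x. x \<notin> K \<longrightarrow> f x = 0))"
  then obtain K where f: "continuous_map X euclidean f" "\<And>x. x \<notin> topspace X \<Longrightarrow> f x = 0"
    and K: "compactin X K" "\<And>x. x \<notin> K \<Longrightarrow> f x = 0" by blast
  have "X closure_of {x \<in> topspace X. f x \<noteq> 0} \<subseteq> K"
    using compactin_imp_closedin[OF assms K(1)] K(2) by (intro closure_of_minimal) auto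
  then have "compactin X (X closure_of {x \<in> topspace X. f x \<noteq> 0})"
    by (rule closed_compactin[OF K(1)]) simp
  then show "f \<in> C_c X" using f by (simp add: C_c_def)
qed

lemma C_cE:
  assumes "Hausdorff_space X" "f \<in> C_c X"
  obtains K where "compactin X K" "\<forall>x. x \<notin> K \<longrightarrow> f x = 0" "continuous_map X euclidean f"
  using assms(2) unfolding C_c_iff[OF assms(1)] by blast

lemma C_cI:
  assumes "Hausdorff_space X" "continuous_map X euclidean f" "compactin X K" "\<And>x. x \<notin> K \<Longrightarrow> f x = 0"
  shows "f \<in> C_c X"
  unfolding C_c_iff[OF assms(1)] using assms compactin_subset_topspace[OF assms(3)] by blast

lemma C_c_add:
  assumes "Hausdorff_space X" "f \<in> C_c X" "g \<in> C_c X"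
  shows "(\<lambda>x. f x + g x) \<in> C_c X"
proof -
  obtain K where K: "compactin X K" "\<forall>x. x \<notin> K \<longrightarrow> f x = 0" "continuous_map X euclidean f"
    by (rule C_cE[OF assms(1,2)])
  obtain L where L: "compactin X L" "\<forall>x. x \<notin> L \<longrightarrow> g x = 0" "continuous_map X euclidean g"
    by (rule C_cE[OF assms(1,3)])
  have "continuous_map X euclidean (\<lambda>x. f x + g x)"
    by (intro continuous_map_add K L)
  then show ?thesis by (rule C_cI[OF assms(1) _ compactin_Un[OF K(1) L(1)]]) (simp add: K L)
qed

lemma C_c_mult:
  assumes "Hausdorff_space X" "f \<in> C_c X" "continuous_map X euclidean g"
  shows "(\<lambda>x. g x * f x) \<in> C_c X"
proof -
  obtain K where K: "compactin X K" "\<forall>x. x \<notin> K \<longrightarrow> f x = 0" "continuous_map X euclidean f"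
    by (rule C_cE[OF assms(1,2)])
  have "continuous_map X euclidean (\<lambda>x. g x * f x)"
    by (intro continuous_map_times K assms(3))
  then show ?thesis by (rule C_cI[OF assms(1) _ K(1)]) (simp add: K)
qed

lemma C_c_scale: "\<lbrakk>Hausdorff_space X; f \<in> C_c X\<rbrakk> \<Longrightarrow> (\<lambda>x. c * f x) \<in> C_c X"
  using C_c_mult[of X f "\<lambda>_. c"] by simp

lemma C_c_zero: "Hausdorff_space X \<Longrightarrow> (\<lambda>x. 0) \<in> C_c X"
  by (rule C_cI[where K="{}"]) auto

lemma C_c_sum:
  assumes "Hausdorff_space X" "\<And>i. i \<in> I \<Longrightarrow> f i \<in> C_c X"
  shows "(\<lambda>x. \<Sum>i\<in>I. f i x) \<in> C_c X"
  using assms(2)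
  by (induction I rule: infinite_finite_induct) (auto intro: C_c_add C_c_zero assms(1))

lemma subsingleton_card:
  assumes "\<And>a b. \<lbrakk>a \<in> A; b \<in> A\<rbrakk> \<Longrightarrow> a = b"
  shows "finite A \<and> card A \<le> 1"
proof (cases "A = {}")
  case False
  then obtain a where "A = {a}" using assms by blast
  then show ?thesis by simp
qed simp

lemma compactin_norm_bounded:
  fixes f :: "'a \<Rightarrow> complex"
  assumes "continuous_map X euclidean f" "compactin X K"
  obtains M where "0 \<le> M" "\<And>x. x \<in> K \<Longrightarrow> norm (f x) \<le> M"
proof -
  have "compact (f ` K)" using image_compactin[OF assms(2,1)] by simp
  then obtain M where M: "\<And>y. y \<in> f ` K \<Longrightarrow> norm y \<le> M" using compact_imp_bounded bounded_iff by metis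
  show ?thesis by (rule that[of "max 0 M"]) (use M in \<open>auto simp: le_max_iff_disj\<close>)
qed

section \<open>Clopen units, open range map and bisections\<close>

locale hausdorff_etale_groupoid = etale_groupoid G
  for G :: "('g, 'm) topological_groupoid_data_scheme" (structure) +
  assumes Hausdorff: "Hausdorff_space (gtop G)"
    and locally_compact: "locally_compact_space (gtop G)"
begin

lemma topspace_gtop: "topspace (gtop G) = arrows G" by (simp add: arrows_def)

lemma units_subset: "units G \<subseteq> arrows G" using unitsD by auto

lemma topspace_unit_space: "topspace (unit_space G) = units G"
  using units_subset by (auto simp: unit_space_def topspace_gtop)

lemma local_chart:
  assumes "\<alpha> \<in> arrows G"
  obtains U where "openin (gtop G) U" "\<alpha> \<in> U" "openin (unit_space G) (gdom G ` U)"
    "homeomorphic_map (subtopology (gtop G) U) (subtopology (unit_space G) (gdom G ` U)) (gdom G)"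
  using local_homeomorphism_dom assms unfolding local_homeomorphism_map_def topspace_gtop by blast

lemma continuous_dom: "continuous_map (gtop G) (gtop G) (gdom G)"
proof (rule continuous_map_locally)
  fix \<alpha> assume "\<alpha> \<in> topspace (gtop G)"
  then obtain U where U: "openin (gtop G) U" "\<alpha> \<in> U"
    "homeomorphic_map (subtopology (gtop G) U) (subtopology (unit_space G) (gdom G ` U)) (gdom G)"
    using local_chart topspace_gtop by metis
  then have "continuous_map (subtopology (gtop G) U) (gtop G) (gdom G)"
    using homeomorphic_imp_continuous_map[OF U(3)] by (simp add: unit_space_def continuous_map_in_subtopology)
  then show "\<exists>U. openin (gtop G) U \<and> \<alpha> \<in> U \<and> continuous_map (subtopology (gtop G) U) (gtop G) (gdom G)"
    using U by blast
qed

lemma continuous_ran: "continuous_map (gtop G) (gtop G) (gran G)"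
  by (rule continuous_map_eq[OF continuous_map_compose[OF continuous_inv continuous_dom]])
     (simp add: topspace_gtop dom_inv)

text \<open>Take a chart \<open>U\<close> around the unit. If an arrow and its source both lie in
  \<open>U\<close>, they have the same source, and injectivity of \<open>gdom\<close> on
  \<open>U\<close> makes them equal.\<close>

lemma open_units: "openin (gtop G) (units G)"
proof (subst openin_subopen, intro ballI)
  fix u assume u: "u \<in> units G"
  then obtain U where U: "openin (gtop G) U" "u \<in> U"
    "homeomorphic_map (subtopology (gtop G) U) (subtopology (unit_space G) (gdom G ` U)) (gdom G)"
    using local_chart unitsD(1) by metis
  have UA: "U \<subseteq> arrows G" using openin_subset[OF U(1)] by (simp add: topspace_gtop)
  then have inj: "inj_on (gdom G) U"
    using U(3) by (simp add: homeomorphic_eq_everything_map topspace_gtop Int_absorb1)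
  let ?W = "U \<inter> {\<alpha> \<in> topspace (gtop G). gdom G \<alpha> \<in> U}"
  have "openin (gtop G) ?W"
    by (intro openin_Int U openin_continuous_map_preimage[OF continuous_dom])
  moreover have "u \<in> ?W" using u U unitsD by (auto simp: topspace_gtop)
  moreover have "?W \<subseteq> units G"
  proof
    fix \<alpha> assume a: "\<alpha> \<in> ?W"
    then have "gdom G (gdom G \<alpha>) = gdom G \<alpha>" using UA dom_dom by auto
    then have "gdom G \<alpha> = \<alpha>" using inj a by (auto dest: inj_onD)
    then show "\<alpha> \<in> units G" using a UA by (auto simp: units_iff)
  qed
  ultimately show "\<exists>T. openin (gtop G) T \<and> u \<in> T \<and> T \<subseteq> units G" by blast
qed

text \<open>The units are the equalizer of \<open>gdom\<close> and the identity, and equalizers are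
  closed in a Hausdorff space.\<close>

lemma closed_units: "closedin (gtop G) (units G)"
proof -
  have "units G = {\<alpha> \<in> topspace (gtop G). gdom G \<alpha> = id \<alpha>}" by (auto simp: units_iff topspace_gtop)
  moreover have "closedin (gtop G) {\<alpha> \<in> topspace (gtop G). gdom G \<alpha> = id \<alpha>}"
    by (rule closedin_continuous_maps_eq[OF Hausdorff continuous_dom continuous_map_id])
  ultimately show ?thesis by simp
qed

lemma openin_unit_space_iff: "openin (unit_space G) U \<longleftrightarrow> openin (gtop G) U \<and> U \<subseteq> units G"
  unfolding unit_space_def by (rule openin_open_subtopology[OF open_units])

lemma Hausdorff_unit_space: "Hausdorff_space (unit_space G)"
  unfolding unit_space_def by (rule Hausdorff_space_subtopology[OF Hausdorff])

lemma compactin_unit_space: "compactin (unit_space G) K \<longleftrightarrow> compactin (gtop G) K \<and> K \<subseteq> units G"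
  by (simp add: unit_space_def compactin_subtopology)

lemma continuous_on_units_extend:
  assumes "continuous_map (unit_space G) euclidean f" "\<And>x. x \<notin> units G \<Longrightarrow> f x = (0::complex)"
  shows "continuous_map (gtop G) euclidean f"
proof (rule continuous_map_locally)
  fix \<alpha> assume a: "\<alpha> \<in> topspace (gtop G)"
  show "\<exists>U. openin (gtop G) U \<and> \<alpha> \<in> U \<and> continuous_map (subtopology (gtop G) U) euclidean f"
  proof (cases "\<alpha> \<in> units G")
    case True then show ?thesis using assms(1) open_units by (auto simp: unit_space_def)
  next
    case False
    have "continuous_map (subtopology (gtop G) (topspace (gtop G) - units G)) euclidean f"
      by (rule continuous_map_eq[of _ _ "\<lambda>_. 0"]) (use assms(2) in auto)
    then show ?thesis using closed_units a False by (intro exI[of _ "topspace (gtop G) - units G"]) auto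
  qed
qed

lemma C_c_units_iff: "f \<in> C_c (unit_space G) \<longleftrightarrow> f \<in> C_c (gtop G) \<and> (\<forall>x. x \<notin> units G \<longrightarrow> f x = 0)"
proof
  assume f: "f \<in> C_c (unit_space G)"
  obtain K where K': "compactin (unit_space G) K" "\<forall>x. x \<notin> K \<longrightarrow> f x = 0" "continuous_map (unit_space G) euclidean f"
    by (rule C_cE[OF Hausdorff_unit_space f])
  then have K: "compactin (gtop G) K" "\<And>x. x \<notin> K \<Longrightarrow> f x = 0" by (auto simp: compactin_unit_space)
  have z: "\<And>x. x \<notin> units G \<Longrightarrow> f x = 0" and "continuous_map (unit_space G) euclidean f"
    using f by (auto simp: C_c_iff[OF Hausdorff_unit_space] topspace_unit_space)
  then have "continuous_map (gtop G) euclidean f" using continuous_on_units_extend by blast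
  then show "f \<in> C_c (gtop G) \<and> (\<forall>x. x \<notin> units G \<longrightarrow> f x = 0)"
    using C_cI[OF Hausdorff _ K(1), of f] K(2) z by blast
next
  assume "f \<in> C_c (gtop G) \<and> (\<forall>x. x \<notin> units G \<longrightarrow> f x = 0)"
  then have f: "f \<in> C_c (gtop G)" and z: "\<And>x. x \<notin> units G \<Longrightarrow> f x = 0" by auto
  obtain K where K: "compactin (gtop G) K" "\<forall>x. x \<notin> K \<longrightarrow> f x = 0" "continuous_map (gtop G) euclidean f"
    by (rule C_cE[OF Hausdorff f])
  have "compactin (unit_space G) (units G \<inter> K)"
    unfolding compactin_unit_space using closed_Int_compactin[OF closed_units K(1)] by auto
  moreover have "continuous_map (unit_space G) euclidean f"
    unfolding unit_space_def by (intro continuous_map_from_subtopology K)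
  ultimately show "f \<in> C_c (unit_space G)"
    using z K(2) by (intro C_cI[OF Hausdorff_unit_space, of f "units G \<inter> K"]) auto
qed

lemma open_map_dom: "openin (gtop G) V \<Longrightarrow> openin (gtop G) (gdom G ` V)"
proof (subst openin_subopen, intro ballI)
  fix u assume V: "openin (gtop G) V" and "u \<in> gdom G ` V"
  then obtain \<alpha> where a: "\<alpha> \<in> V" "u = gdom G \<alpha>" by auto
  then have "\<alpha> \<in> arrows G" using openin_subset[OF V] by (auto simp: topspace_gtop)
  then obtain U where U: "openin (gtop G) U" "\<alpha> \<in> U" "openin (unit_space G) (gdom G ` U)"
    "homeomorphic_map (subtopology (gtop G) U) (subtopology (unit_space G) (gdom G ` U)) (gdom G)"
    using local_chart by metis
  have "openin (subtopology (gtop G) U) (U \<inter> V)"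
    using V by (auto simp: openin_subtopology)
  then have "openin (subtopology (unit_space G) (gdom G ` U)) (gdom G ` (U \<inter> V))"
    using U(4) by (auto simp: homeomorphic_eq_everything_map open_map_def)
  then have "openin (unit_space G) (gdom G ` (U \<inter> V))" using U(3) by (rule openin_trans_full)
  then show "\<exists>T. openin (gtop G) T \<and> u \<in> T \<and> T \<subseteq> gdom G ` V"
    using a U(2) by (intro exI[of _ "gdom G ` (U \<inter> V)"]) (auto simp: openin_unit_space_iff)
qed

lemma openin_image_inv: 
  assumes "openin (gtop G) V"
  shows "openin (gtop G) (ginv G ` V)"
proof -
  have "V \<subseteq> arrows G" using openin_subset[OF assms] by (simp add: topspace_gtop)
  then have "ginv G ` V = {\<alpha> \<in> topspace (gtop G). ginv G \<alpha> \<in> V}"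
    by (auto simp: topspace_gtop inv_closed image_iff subset_iff) (metis inv_inv)
  then show ?thesis using openin_continuous_map_preimage[OF continuous_inv assms] by simp
qed

lemma open_map_ran: 
  assumes "openin (gtop G) V"
  shows "openin (gtop G) (gran G ` V)"
proof -
  have "V \<subseteq> arrows G" using openin_subset[OF assms] by (simp add: topspace_gtop)
  then have "gran G ` V = gdom G ` (ginv G ` V)"
    unfolding image_image by (intro image_cong) (auto simp: dom_inv)
  then show ?thesis using open_map_dom[OF openin_image_inv[OF assms]] by simp
qed

definition bisection :: "'g set \<Rightarrow> bool" where
  "bisection U \<longleftrightarrow> openin (gtop G) U \<and> inj_on (gdom G) U \<and> inj_on (gran G) U"

lemma bisectionD:
  assumes "bisection U"
  shows "openin (gtop G) U" "U \<subseteq> arrows G"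
    "\<And>\<alpha> \<beta>. \<lbrakk>\<alpha> \<in> U; \<beta> \<in> U; gdom G \<alpha> = gdom G \<beta>\<rbrakk> \<Longrightarrow> \<alpha> = \<beta>"
    "\<And>\<alpha> \<beta>. \<lbrakk>\<alpha> \<in> U; \<beta> \<in> U; gran G \<alpha> = gran G \<beta>\<rbrakk> \<Longrightarrow> \<alpha> = \<beta>"
  using assms openin_subset[of "gtop G" U] by (auto simp: bisection_def topspace_gtop dest: inj_onD)

text \<open>Intersect a chart for \<open>gdom\<close> at the arrow with the inverse of a chart at
  the inverse arrow, because \<open>gran\<close> is \<open>gdom\<close> after inversion.\<close>

lemma bisection_exists:
  assumes "\<alpha> \<in> arrows G"
  obtains U where "bisection U" "\<alpha> \<in> U"
proof -
  have inj: "\<exists>U. openin (gtop G) U \<and> \<alpha> \<in> U \<and> inj_on (gdom G) U" if a: "\<alpha> \<in> arrows G" for \<alpha>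
  proof -
    obtain U where U: "openin (gtop G) U" "\<alpha> \<in> U"
      "homeomorphic_map (subtopology (gtop G) U) (subtopology (unit_space G) (gdom G ` U)) (gdom G)"
      using local_chart[OF a] by metis
    have "U \<subseteq> arrows G" using openin_subset[OF U(1)] by (simp add: topspace_gtop)
    then have "inj_on (gdom G) U"
      using U(3) by (simp add: homeomorphic_eq_everything_map topspace_gtop Int_absorb1)
    then show ?thesis using U by blast
  qed
  obtain U where U: "openin (gtop G) U" "\<alpha> \<in> U" "inj_on (gdom G) U" using inj[OF assms] by blast
  obtain V where V: "openin (gtop G) V" "ginv G \<alpha> \<in> V" "inj_on (gdom G) V" using inj[OF inv_closed[OF assms]] by blast
  let ?W = "U \<inter> ginv G ` V"
  have VA: "V \<subseteq> arrows G" using openin_subset[OF V(1)] by (simp add: topspace_gtop)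
  have "openin (gtop G) ?W" using U V by (intro openin_Int openin_image_inv)
  moreover have "\<alpha> \<in> ?W" using U V assms by (auto simp: image_iff intro!: bexI[of _ "ginv G \<alpha>"])
  moreover have "inj_on (gdom G) ?W" using U(3) by (auto simp: inj_on_def)
  moreover have "inj_on (gran G) ?W"
  proof (rule inj_onI)
    fix \<beta> \<gamma> assume b: "\<beta> \<in> ?W" "\<gamma> \<in> ?W" "gran G \<beta> = gran G \<gamma>"
    then obtain \<beta>' \<gamma>' where v: "\<beta>' \<in> V" "\<gamma>' \<in> V" "\<beta> = ginv G \<beta>'" "\<gamma> = ginv G \<gamma>'" by auto
    then have "gdom G \<beta>' = gdom G \<gamma>'" using b(3) VA by (auto simp: ran_inv subset_iff)
    then show "\<beta> = \<gamma>" using v V(3) by (auto dest: inj_onD)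
  qed
  ultimately show ?thesis using that[of ?W] by (simp add: bisection_def)
qed

section \<open>Convolution series that reduce to one term\<close>

lemma convolution_unit_supported_right:
  assumes "\<And>\<gamma>. \<gamma> \<notin> units G \<Longrightarrow> h \<gamma> = 0" "\<gamma> \<in> arrows G"
  shows "convolution G a h \<gamma> = a \<gamma> * h (gdom G \<gamma>)"
proof -
  let ?x = "gdom G \<gamma>"
  note g = in_fibre[OF assms(2)]
  have x: "?x \<in> source_fibre G ?x" using source_fibreD[OF g] unit_in_source_fibre by simp
  have "h \<kappa> = 0" if "\<kappa> \<in> source_fibre G ?x - {?x}" for \<kappa>
    using that assms(1)[of \<kappa>] unitsD(2)[of \<kappa>] by (auto simp: source_fibre_def)
  then have "convolution G a h \<gamma> = (\<Sum>\<kappa>\<in>{?x}. kern a \<gamma> \<kappa> * h \<kappa>)"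
    unfolding convolution_eq_apply[OF g] by (intro apply_kernel_finite) (use x in auto)
  then show ?thesis by (simp add: kern_unit[OF g])
qed

lemma convolution_unit_supported_left:
  assumes "\<And>\<gamma>. \<gamma> \<notin> units G \<Longrightarrow> h \<gamma> = 0" "\<gamma> \<in> arrows G"
  shows "convolution G h a \<gamma> = h (gran G \<gamma>) * a \<gamma>"
proof -
  let ?x = "gdom G \<gamma>"
  note g = in_fibre[OF assms(2)]
  have "kern h \<gamma> \<kappa> = 0" if "\<kappa> \<in> source_fibre G ?x - {\<gamma>}" for \<kappa>
    using that assms(1) quotient_in_units_iff[OF g] by (auto simp: kern_def)
  then have "apply_kernel (source_fibre G ?x) (kern h) a \<gamma> = (\<Sum>\<^sub>\<infinity>\<kappa>\<in>{\<gamma>}. kern h \<gamma> \<kappa> * a \<kappa>)"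
    unfolding apply_kernel_def using g by (intro infsum_cong_neutral) auto
  then show ?thesis using assms(2) by (simp add: convolution_eq_apply[OF g] kern_def mult_inv)
qed

lemma convolution_bisection_supported:
  assumes U: "bisection U" and f: "\<And>\<gamma>. \<gamma> \<notin> U \<Longrightarrow> f \<gamma> = 0" and "\<alpha> \<in> arrows G" "\<beta> \<in> U" "gran G \<beta> = gran G \<alpha>"
  shows "convolution G f g \<alpha> = f \<beta> * g (gmult G (ginv G \<beta>) \<alpha>)"
proof -
  have "convolution G f g \<alpha> = (\<Sum>\<^sub>\<infinity>\<beta>\<in>{\<beta>}. f \<beta> * g (gmult G (ginv G \<beta>) \<alpha>))"
    using assms(3) unfolding convolution_def
    by (simp only: if_True, intro infsum_cong_neutral)
       (use assms bisectionD[OF U] in auto, metis)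
  then show ?thesis by simp
qed

lemma convolution_nonzeroD:
  assumes "convolution G f g \<alpha> \<noteq> 0"
  obtains \<beta> where "\<alpha> \<in> arrows G" "\<beta> \<in> arrows G" "gran G \<beta> = gran G \<alpha>" "f \<beta> \<noteq> 0" "g (gmult G (ginv G \<beta>) \<alpha>) \<noteq> 0"
proof -
  have a: "\<alpha> \<in> arrows G" using assms convolution_outside by blast
  have "\<exists>\<beta>. \<beta> \<in> arrows G \<and> gran G \<beta> = gran G \<alpha> \<and> f \<beta> \<noteq> 0 \<and> g (gmult G (ginv G \<beta>) \<alpha>) \<noteq> 0"
  proof (rule ccontr)
    assume "\<not> ?thesis"
    then have "convolution G f g \<alpha> = (\<Sum>\<^sub>\<infinity>\<beta>\<in>{\<beta> \<in> arrows G. gran G \<beta> = gran G \<alpha>}. 0)"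
      using a unfolding convolution_def by (simp only: if_True, intro infsum_cong) auto
    then show False using assms by simp
  qed
  then show ?thesis using that a by blast
qed

text \<open>A compact set inside the bisection is demanded, which is stronger than vanishing off
  \<open>U\<close>. Compactness gives a norm bound, and the gap between \<open>K\<close> and the
  complement of \<open>U\<close> makes extension by zero continuous.\<close>

definition bisection_functions :: "('g \<Rightarrow> complex) set" where
  "bisection_functions = {f. continuous_map (gtop G) euclidean f \<and>
     (\<exists>K U. compactin (gtop G) K \<and> bisection U \<and> K \<subseteq> U \<and> (\<forall>\<gamma>. \<gamma> \<notin> K \<longrightarrow> f \<gamma> = 0))}"

lemma bisection_functions_C_c: "f \<in> bisection_functions \<Longrightarrow> f \<in> C_c (gtop G)"
  unfolding bisection_functions_def using C_cI[OF Hausdorff] by blast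

text \<open>A partition of unity built by hand: complete regularity gives, for each point of
  \<open>K\<close>, a function that is 0 at the point and 1 off a bisection around it.\<close>

lemma C_c_partition:
  assumes "f \<in> C_c (gtop G)"
  obtains I :: "'g set" and g where "finite I" "\<And>i. i \<in> I \<Longrightarrow> g i \<in> bisection_functions"
    "\<And>\<gamma>. f \<gamma> = (\<Sum>i\<in>I. g i \<gamma>)"
proof -
  let ?X = "gtop G"
  obtain K where K: "compactin ?X K" "\<forall>x. x \<notin> K \<longrightarrow> f x = 0" "continuous_map ?X euclidean f"
    by (rule C_cE[OF Hausdorff assms])
  note fc = K(3)
  have KA: "K \<subseteq> arrows G" using compactin_subset_topspace[OF K(1)] by (simp add: topspace_gtop)
  have cr: "completely_regular_space ?X"
    using locally_compact_regular_imp_completely_regular_space locally_compact Hausdorff by blast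
  have "\<exists>U \<phi>. bisection U \<and> continuous_map ?X euclideanreal \<phi> \<and> \<phi> \<alpha> = 0 \<and> (\<forall>x\<in>arrows G - U. \<phi> x = 1)"
    if a: "\<alpha> \<in> K" for \<alpha>
  proof -
    obtain U where U: "bisection U" "\<alpha> \<in> U" using bisection_exists a KA by blast
    have "closedin ?X (topspace ?X - U)" using bisectionD(1)[OF U(1)] by blast
    moreover have "\<alpha> \<in> topspace ?X - (topspace ?X - U)" using U(2) a KA by (auto simp: topspace_gtop)
    ultimately obtain \<phi> :: "'g \<Rightarrow> real" where "continuous_map ?X (top_of_set {0..1}) \<phi>" "\<phi> \<alpha> = 0"
      "\<phi> ` (topspace ?X - U) \<subseteq> {1}"
      using cr unfolding completely_regular_space_def by blast
    then show ?thesis using U(1) by (auto simp: continuous_map_in_subtopology topspace_gtop)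
  qed
  then have "\<forall>\<alpha>\<in>K. \<exists>U \<phi>. bisection U \<and> continuous_map ?X euclideanreal \<phi> \<and> \<phi> \<alpha> = 0 \<and> (\<forall>x\<in>arrows G - U. \<phi> x = 1)" by blast
  then obtain U \<phi> where U: "\<And>\<alpha>. \<alpha> \<in> K \<Longrightarrow> bisection (U \<alpha>)" and \<phi>: "\<And>\<alpha>. \<alpha> \<in> K \<Longrightarrow> continuous_map ?X euclideanreal (\<phi> \<alpha>)"
    "\<And>\<alpha>. \<alpha> \<in> K \<Longrightarrow> \<phi> \<alpha> \<alpha> = 0" "\<And>\<alpha> x. \<lbrakk>\<alpha> \<in> K; x \<in> arrows G - U \<alpha>\<rbrakk> \<Longrightarrow> \<phi> \<alpha> x = (1::real)" by metis
  \<comment> \<open>The sets where \<phi> is below 1/4 cover \<open>K\<close>. The bumps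
    \<open>h\<close> below are at least 1/4 there and vanish once \<phi> reaches 1/2, well inside
    the bisection, off which \<phi> is 1.\<close>
  let ?V = "\<lambda>\<alpha>. {x \<in> topspace ?X. \<phi> \<alpha> x \<in> {..<1/4}}"
  have "\<And>V. V \<in> ?V ` K \<Longrightarrow> openin ?X V"
    by (auto intro!: openin_continuous_map_preimage[OF \<phi>(1)] simp del: lessThan_iff)
  moreover have "K \<subseteq> \<Union> (?V ` K)" using \<phi>(2) KA by (auto simp: topspace_gtop)
  ultimately have "\<exists>\<F>. finite \<F> \<and> \<F> \<subseteq> ?V ` K \<and> K \<subseteq> \<Union>\<F>"
    using K(1) unfolding compactin_def by meson
  then obtain \<F> where F: "finite \<F>" "\<F> \<subseteq> ?V ` K" "K \<subseteq> \<Union>\<F>" by auto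
  obtain I where I: "I \<subseteq> K" "finite I" "\<F> = ?V ` I" using finite_subset_image[OF F(1,2)] by blast
  define h where "h = (\<lambda>i x. max (1/2 - \<phi> i x) 0)"
  \<comment> \<open>Cutting the sum off below at 1/4 makes the denominator positive everywhere and
    leaves it unchanged on \<open>K\<close>.\<close>
  define H where "H = (\<lambda>x. max (\<Sum>i\<in>I. h i x) (1/4))"
  have hc: "continuous_map ?X euclideanreal (h i)" if "i \<in> I" for i
    unfolding h_def using \<phi>(1)[of i] that I(1)
    by (intro continuous_map_compose_continuous_on[where f="\<phi> i" and h="\<lambda>t. max (1/2 - t) 0"]) (auto intro!: continuous_intros)
  have Hc: "continuous_map ?X euclideanreal H"
    unfolding H_def using I(2) hc
    by (intro continuous_map_compose_continuous_on[where h="\<lambda>t. max t (1/4)"] continuous_map_sum) (auto intro!: continuous_intros)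
  have Hp: "H x > 0" for x by (simp add: H_def less_max_iff_disj)
  define g where "g = (\<lambda>i x. f x * complex_of_real (h i x / H x))"
  show ?thesis
  proof (rule that[of I g])
    show "finite I" by fact
    fix i assume i: "i \<in> I"
    let ?L = "{x \<in> topspace ?X. \<phi> i x \<in> {..1/2}}"
    have L: "closedin ?X ?L" by (rule closedin_continuous_map_preimage[OF \<phi>(1)]) (use i I in auto)
    have "continuous_map ?X euclideanreal (\<lambda>x. h i x / H x)"
      using Hp by (intro continuous_map_real_divide hc Hc i) (simp add: less_imp_neq[symmetric])
    then have "continuous_map ?X euclidean (\<lambda>x. complex_of_real (h i x / H x))"
      by (rule continuous_map_compose_continuous_on) (auto intro!: continuous_intros)
    then have "continuous_map ?X euclidean (g i)"
      unfolding g_def by (intro continuous_map_times fc)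
    moreover have "compactin ?X (?L \<inter> K)" by (rule closed_Int_compactin[OF L K(1)])
    moreover have "?L \<inter> K \<subseteq> U i"
    proof
      fix x assume x: "x \<in> ?L \<inter> K"
      then have "\<phi> i x \<noteq> 1" by auto
      then show "x \<in> U i" using \<phi>(3)[of i x] x i I(1) by (auto simp: topspace_gtop)
    qed
    moreover have "g i \<gamma> = 0" if "\<gamma> \<notin> ?L \<inter> K" for \<gamma>
    proof (cases "\<gamma> \<in> K")
      case True
      then have "\<phi> i \<gamma> > 1/2" using that KA by (auto simp: topspace_gtop)
      then show ?thesis by (simp add: g_def h_def)
    qed (simp add: g_def K)
    ultimately show "g i \<in> bisection_functions"
      using U[of i] i I(1) unfolding bisection_functions_def by blast
  next
    fix \<gamma>
    show "f \<gamma> = (\<Sum>i\<in>I. g i \<gamma>)"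
    proof (cases "\<gamma> \<in> K")
      case True
      then obtain i where i: "i \<in> I" "\<phi> i \<gamma> < 1/4" using F(3) I(3) by auto
      have "1/4 \<le> h i \<gamma>" using i by (simp add: h_def)
      also have "\<dots> \<le> (\<Sum>i\<in>I. h i \<gamma>)"
        by (rule member_le_sum) (use i I in \<open>auto simp: h_def\<close>)
      finally have "H \<gamma> = (\<Sum>i\<in>I. h i \<gamma>)" by (simp add: H_def)
      then have "(\<Sum>i\<in>I. h i \<gamma> / H \<gamma>) = 1"
        using Hp[of \<gamma>] by (simp add: sum_divide_distrib[symmetric])
      then show ?thesis unfolding g_def sum_distrib_left[symmetric] of_real_sum[symmetric] by simp
    qed (simp add: g_def K)
  qed
qed

text \<open>Nonzero entries in one row come from arrows of the bisection with equal range, those in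
  one column from arrows with equal source. So each row and column has at most one, and the Schur
  test applies with \<open>n = 1\<close>.\<close>

lemma bisection_functions_opb:
  assumes "f \<in> bisection_functions"
  obtains C where "opb f C"
proof -
  obtain K U where K: "compactin (gtop G) K" "bisection U" "K \<subseteq> U" "\<And>\<gamma>. \<gamma> \<notin> K \<Longrightarrow> f \<gamma> = 0"
    and fc: "continuous_map (gtop G) euclidean f"
    using assms unfolding bisection_functions_def by blast
  obtain M where M: "0 \<le> M" "\<And>x. x \<in> K \<Longrightarrow> norm (f x) \<le> M" using compactin_norm_bounded[OF fc K(1)] by blast
  have "bounded_kernel (source_fibre G x) (kern f) (M * (1::nat))" for x
  proof (rule bounded_kernel_Schur_test[OF M(1)])
    let ?S = "source_fibre G x"
    show "norm (kern f a b) \<le> M" for a b unfolding kern_def using M K(4) by (cases "gmult G a (ginv G b) \<in> K") auto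
    have nz: "gmult G a (ginv G b) \<in> U" if "kern f a b \<noteq> 0" for a b
      using that K(3,4) unfolding kern_def by blast
    fix a assume a: "a \<in> ?S"
    have "b = b'" if "b \<in> ?S" "b' \<in> ?S" "kern f a b \<noteq> 0" "kern f a b' \<noteq> 0" for b b'
    proof -
      have "gmult G a (ginv G b) = gmult G a (ginv G b')"
        by (rule bisectionD(4)[OF K(2) nz nz]) (use that a quotient in auto)
      then show ?thesis using quotient_left_cancel that a by metis
    qed
    then show "finite {b\<in>?S. kern f a b \<noteq> 0} \<and> card {b\<in>?S. kern f a b \<noteq> 0} \<le> 1" by (intro subsingleton_card) blast
    have "b = b'" if "b \<in> ?S" "b' \<in> ?S" "kern f b a \<noteq> 0" "kern f b' a \<noteq> 0" for b b'
    proof -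
      have "gmult G b (ginv G a) = gmult G b' (ginv G a)"
        by (rule bisectionD(3)[OF K(2) nz nz]) (use that a quotient in auto)
      then show ?thesis using quotient_right_cancel that a by metis
    qed
    then show "finite {b\<in>?S. kern f b a \<noteq> 0} \<and> card {b\<in>?S. kern f b a \<noteq> 0} \<le> 1" by (intro subsingleton_card) blast
  qed
  then show ?thesis using that[of M] M(1) by (simp add: opb_def)
qed

lemma opb_zero: "opb (\<lambda>_. 0) 0"
  by (simp add: opb_def bounded_kernel_def kern_def)

lemma opb_sum:
  assumes "finite I" "\<And>i. i \<in> I \<Longrightarrow> \<exists>C. opb (f i) C"
  shows "\<exists>C. opb (\<lambda>\<gamma>. \<Sum>i\<in>I. f i \<gamma>) C"
  using assms
proof (induction I rule: finite_induct)
  case empty then show ?case using opb_zero by auto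
next
  case (insert i I)
  obtain C where "opb (f i) C" using insert.prems by blast
  moreover obtain D where "opb (\<lambda>\<gamma>. \<Sum>i\<in>I. f i \<gamma>) D" using insert by blast
  ultimately have "opb (\<lambda>\<gamma>. f i \<gamma> + (\<Sum>i\<in>I. f i \<gamma>)) (C + D)" by (rule opb_add)
  then show ?case using insert by (auto simp: fun_eq_iff)
qed

lemma C_c_opb:
  assumes "f \<in> C_c (gtop G)"
  obtains C where "opb f C"
proof -
  obtain I :: "'g set" and g where I: "finite I" "\<And>i. i \<in> I \<Longrightarrow> g i \<in> bisection_functions"
    "\<And>\<gamma>. f \<gamma> = (\<Sum>i\<in>I. g i \<gamma>)" using C_c_partition[OF assms] by blast
  have "\<exists>C. opb (\<lambda>\<gamma>. \<Sum>i\<in>I. g i \<gamma>) C" by (rule opb_sum[OF I(1)]) (use I(2) bisection_functions_opb in blast)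
  moreover have "f = (\<lambda>\<gamma>. \<Sum>i\<in>I. g i \<gamma>)" using I(3) by auto
  ultimately show ?thesis using that by auto
qed

text \<open>Composable pairs form a closed set because source and range take values in a Hausdorff
  space, so those in \<open>K \<times> L\<close> form a compact set on which multiplication is
  continuous.\<close>

lemma compact_product:
  assumes "compactin (gtop G) K" "compactin (gtop G) L"
  shows "compactin (gtop G) {gmult G \<alpha> \<beta> | \<alpha> \<beta>. \<alpha> \<in> K \<and> \<beta> \<in> L \<and> gdom G \<alpha> = gran G \<beta>}"
proof -
  let ?X = "gtop G" and ?P = "prod_topology (gtop G) (gtop G)"
  let ?Z = "{(\<alpha>, \<beta>). gdom G \<alpha> = gran G \<beta>}"
  have KL: "compactin ?P (K \<times> L)" using assms by (simp add: compactin_Times)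
  have c: "closedin ?P {p \<in> topspace ?P. (gdom G \<circ> fst) p = (gran G \<circ> snd) p}"
    by (rule closedin_continuous_maps_eq[OF Hausdorff continuous_map_compose[OF continuous_map_fst continuous_dom]
          continuous_map_compose[OF continuous_map_snd continuous_ran]])
  have "compactin ?P ({p \<in> topspace ?P. (gdom G \<circ> fst) p = (gran G \<circ> snd) p} \<inter> (K \<times> L))"
    by (rule closed_Int_compactin[OF c KL])
  moreover have "{p \<in> topspace ?P. (gdom G \<circ> fst) p = (gran G \<circ> snd) p} \<inter> (K \<times> L) = ?Z \<inter> (K \<times> L)"
    using compactin_subset_topspace[OF KL] by auto
  ultimately have "compactin (subtopology ?P ?Z) (?Z \<inter> (K \<times> L))" by (simp add: compactin_subtopology)
  from image_compactin[OF this continuous_mult]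
  have "compactin ?X ((\<lambda>(\<alpha>, \<beta>). gmult G \<alpha> \<beta>) ` (?Z \<inter> (K \<times> L)))" .
  moreover have "(\<lambda>(\<alpha>, \<beta>). gmult G \<alpha> \<beta>) ` (?Z \<inter> (K \<times> L)) = {gmult G \<alpha> \<beta> | \<alpha> \<beta>. \<alpha> \<in> K \<and> \<beta> \<in> L \<and> gdom G \<alpha> = gran G \<beta>}"
    by auto
  ultimately show ?thesis by simp
qed

text \<open>Where the range of an arrow is the range of a bisection arrow, the series has one term,
  a product of continuous functions. The support lies in the product of two compact sets.\<close>

lemma convolution_bisection_C_c:
  assumes f: "f \<in> bisection_functions" and g: "g \<in> C_c (gtop G)"
  shows "convolution G f g \<in> C_c (gtop G)"
proof -
  let ?X = "gtop G"
  obtain K U where K: "compactin ?X K" "bisection U" "K \<subseteq> U" "\<And>\<gamma>. \<gamma> \<notin> K \<Longrightarrow> f \<gamma> = 0"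
    and fc: "continuous_map ?X euclidean f"
    using f unfolding bisection_functions_def by blast
  obtain L where L: "compactin ?X L" "\<forall>\<gamma>. \<gamma> \<notin> L \<longrightarrow> g \<gamma> = 0" "continuous_map ?X euclidean g"
    by (rule C_cE[OF Hausdorff g])
  note gc = L(3)
  note U = bisectionD[OF K(2)]
  have fU: "\<And>\<gamma>. \<gamma> \<notin> U \<Longrightarrow> f \<gamma> = 0" using K by blast
  \<comment> \<open>The section of \<open>gran\<close> over the bisection. Its continuity is the
    openness of \<open>gran\<close>.\<close>
  define s where "s = inv_into U (gran G)"
  have s: "s (gran G \<beta>) = \<beta>" if "\<beta> \<in> U" for \<beta>
    unfolding s_def using K(2) that by (intro inv_into_f_f) (auto simp: bisection_def)
  let ?R = "gran G ` U"
  have R: "openin ?X ?R" by (rule open_map_ran[OF U(1)])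
  have sc: "continuous_map (subtopology ?X ?R) ?X s"
    unfolding continuous_map_def
  proof (intro conjI allI impI)
    show "s \<in> topspace (subtopology ?X ?R) \<rightarrow> topspace ?X" using s U(2) by (auto simp: topspace_gtop)
    fix V assume V: "openin ?X V"
    have "{y \<in> topspace (subtopology ?X ?R). s y \<in> V} = gran G ` (U \<inter> V)"
      using s U(2) ran_closed by (auto simp: topspace_gtop)
    moreover have "openin ?X (gran G ` (U \<inter> V))" using U(1) V by (intro open_map_ran openin_Int)
    ultimately show "openin (subtopology ?X ?R) {y \<in> topspace (subtopology ?X ?R). s y \<in> V}"
      using R by (auto simp: openin_open_subtopology)
  qed
  let ?W = "{\<alpha> \<in> topspace ?X. gran G \<alpha> \<in> ?R}"
  have W: "openin ?X ?W" by (rule openin_continuous_map_preimage[OF continuous_ran R])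
  have src: "continuous_map (subtopology ?X ?W) ?X (\<lambda>\<alpha>. s (gran G \<alpha>))"
  proof -
    have "continuous_map (subtopology ?X ?W) (subtopology ?X ?R) (gran G)"
      by (auto simp: continuous_map_in_subtopology continuous_map_from_subtopology[OF continuous_ran])
    from continuous_map_compose[OF this sc] show ?thesis by (simp add: o_def)
  qed
  have sr: "s (gran G \<alpha>) \<in> U" "gran G (s (gran G \<alpha>)) = gran G \<alpha>" if "\<alpha> \<in> ?W" for \<alpha>
    using that s by auto
  have mc: "continuous_map (subtopology ?X ?W) ?X (\<lambda>\<alpha>. gmult G (ginv G (s (gran G \<alpha>))) \<alpha>)"
  proof -
    let ?Z = "{(\<alpha>, \<beta>). gdom G \<alpha> = gran G \<beta>}"
    have 1: "continuous_map (subtopology ?X ?W) ?X (\<lambda>\<alpha>. ginv G (s (gran G \<alpha>)))"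
      using continuous_map_compose[OF src continuous_inv] by (simp add: o_def)
    have 2: "continuous_map (subtopology ?X ?W) ?X (\<lambda>\<alpha>. \<alpha>)"
      using continuous_map_from_subtopology[OF continuous_map_id] by (simp add: id_def)
    have "gdom G (ginv G (s (gran G \<alpha>))) = gran G \<alpha>" if "\<alpha> \<in> ?W" for \<alpha>
      using sr[OF that] U(2) by (auto simp: dom_inv subset_iff)
    then have "continuous_map (subtopology ?X ?W) (subtopology (prod_topology ?X ?X) ?Z) (\<lambda>\<alpha>. (ginv G (s (gran G \<alpha>)), \<alpha>))"
      unfolding continuous_map_in_subtopology using continuous_map_pairedI[OF 1 2] by auto
    from continuous_map_compose[OF this continuous_mult] show ?thesis by (simp add: o_def)
  qed
  have conv: "convolution G f g \<alpha> = f (s (gran G \<alpha>)) * g (gmult G (ginv G (s (gran G \<alpha>))) \<alpha>)" if "\<alpha> \<in> ?W" for \<alpha>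
    using that sr[OF that] by (intro convolution_bisection_supported[OF K(2) fU]) (auto simp: topspace_gtop)
  have c1: "continuous_map (subtopology ?X ?W) euclidean (convolution G f g)"
  proof (rule continuous_map_eq)
    show "continuous_map (subtopology ?X ?W) euclidean
        (\<lambda>\<alpha>. f (s (gran G \<alpha>)) * g (gmult G (ginv G (s (gran G \<alpha>))) \<alpha>))"
      using continuous_map_compose[OF src fc] continuous_map_compose[OF mc gc]
      by (intro continuous_map_times) (simp_all add: o_def)
  qed (simp add: conv)
  \<comment> \<open>A second open set, on which the convolution is zero. Together with
    \<open>?W\<close> it covers the space because \<open>K\<close> lies inside
    \<open>U\<close>.\<close>
  let ?V = "{\<alpha> \<in> topspace ?X. gran G \<alpha> \<in> topspace ?X - gran G ` K}"
  have "closedin ?X (gran G ` K)"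
    by (rule compactin_imp_closedin[OF Hausdorff image_compactin[OF K(1) continuous_ran]])
  then have V: "openin ?X ?V" by (intro openin_continuous_map_preimage[OF continuous_ran]) auto
  have "convolution G f g \<alpha> = 0" if "\<alpha> \<in> ?V" for \<alpha>
  proof (rule ccontr)
    assume "convolution G f g \<alpha> \<noteq> 0"
    then obtain \<beta> where b: "gran G \<beta> = gran G \<alpha>" "f \<beta> \<noteq> 0" by (rule convolution_nonzeroD)
    then have "\<beta> \<in> K" using K(4) by blast
    then have "gran G \<alpha> \<in> gran G ` K" using b(1) by (metis image_eqI)
    then show False using that by simp
  qed
  then have "convolution G f g \<alpha> = 0" if "\<alpha> \<in> topspace (subtopology ?X ?V)" for \<alpha>
    using that by simp
  then have c2: "continuous_map (subtopology ?X ?V) euclidean (convolution G f g)"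
    using continuous_map_eq[of "subtopology ?X ?V" euclidean "\<lambda>_. 0" "convolution G f g"] by simp
  have cont: "continuous_map ?X euclidean (convolution G f g)"
  proof (rule continuous_map_locally)
    fix \<alpha> assume a: "\<alpha> \<in> topspace ?X"
    then have "gran G \<alpha> \<in> topspace ?X" using ran_closed by (simp add: topspace_gtop)
    then have "\<alpha> \<in> ?W \<or> \<alpha> \<in> ?V" using a K(3) by (cases "gran G \<alpha> \<in> gran G ` K") auto
    then show "\<exists>U. openin ?X U \<and> \<alpha> \<in> U \<and> continuous_map (subtopology ?X U) euclidean (convolution G f g)"
    proof
      assume "\<alpha> \<in> ?W" with W c1 show ?thesis by (intro exI[of _ ?W] conjI)
    next
      assume "\<alpha> \<in> ?V" with V c2 show ?thesis by (intro exI[of _ ?V] conjI)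
    qed
  qed
  let ?KL = "{gmult G \<alpha> \<beta> | \<alpha> \<beta>. \<alpha> \<in> K \<and> \<beta> \<in> L \<and> gdom G \<alpha> = gran G \<beta>}"
  have "convolution G f g \<alpha> = 0" if "\<alpha> \<notin> ?KL" for \<alpha>
  proof (rule ccontr)
    assume "convolution G f g \<alpha> \<noteq> 0"
    then obtain \<beta> where b: "\<alpha> \<in> arrows G" "\<beta> \<in> arrows G" "gran G \<beta> = gran G \<alpha>" "f \<beta> \<noteq> 0"
      "g (gmult G (ginv G \<beta>) \<alpha>) \<noteq> 0" by (rule convolution_nonzeroD)
    let ?c = "gmult G (ginv G \<beta>) \<alpha>"
    have "\<beta> \<in> K" "?c \<in> L" using b K(4) L(2) by auto
    moreover have "gdom G \<beta> = gran G ?c" using b by (simp add: ran_mult inv_closed dom_inv ran_inv)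
    moreover have "\<alpha> = gmult G \<beta> ?c"
      using b by (simp add: mult_assoc[symmetric] inv_closed dom_inv ran_inv mult_inv ran_times)
    ultimately show False using that by blast
  qed
  then show ?thesis
    by (rule C_cI[OF Hausdorff cont compact_product[OF K(1) L(1)]])
qed

lemma convolution_sum_left:
  assumes "finite I" "\<And>i. i \<in> I \<Longrightarrow> \<exists>C. opb (f i) C" "opb g D"
  shows "convolution G (\<lambda>\<gamma>. \<Sum>i\<in>I. f i \<gamma>) g = (\<lambda>\<gamma>. \<Sum>i\<in>I. convolution G (f i) g \<gamma>)"
  using assms(1,2)
proof (induction I rule: finite_induct)
  case empty then show ?case using convolution_scale_left[of 0 "\<lambda>_. 0" g] by simp
next
  case (insert i I)
  obtain C where C: "opb (f i) C" using insert.prems by blast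
  obtain E where E: "opb (\<lambda>\<gamma>. \<Sum>i\<in>I. f i \<gamma>) E" using opb_sum[OF insert.hyps(1)] insert.prems by blast
  show ?case using convolution_add_left[OF C E assms(3)] insert by simp
qed

lemma convolution_C_c:
  assumes "f \<in> C_c (gtop G)" "g \<in> C_c (gtop G)"
  shows "convolution G f g \<in> C_c (gtop G)"
proof -
  obtain I :: "'g set" and h where I: "finite I" "\<And>i. i \<in> I \<Longrightarrow> h i \<in> bisection_functions"
    "\<And>\<gamma>. f \<gamma> = (\<Sum>i\<in>I. h i \<gamma>)" using C_c_partition[OF assms(1)] by blast
  obtain D where D: "opb g D" using C_c_opb[OF assms(2)] by blast
  have "f = (\<lambda>\<gamma>. \<Sum>i\<in>I. h i \<gamma>)" using I(3) by auto
  then have "convolution G f g = (\<lambda>\<gamma>. \<Sum>i\<in>I. convolution G (h i) g \<gamma>)"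
    using convolution_sum_left[OF I(1) _ D, of h] I(2) bisection_functions_opb by metis
  then show ?thesis using C_c_sum[OF Hausdorff convolution_bisection_C_c[OF I(2) assms(2)]] by simp
qed

lemma involution_C_c:
  assumes "f \<in> C_c (gtop G)"
  shows "involution G f \<in> C_c (gtop G)"
proof -
  obtain K where K: "compactin (gtop G) K" "\<forall>x. x \<notin> K \<longrightarrow> f x = 0" "continuous_map (gtop G) euclidean f"
    by (rule C_cE[OF Hausdorff assms])
  note fc = K(3)
  have "continuous_map (gtop G) euclidean (\<lambda>\<gamma>. cnj (f (ginv G \<gamma>)))"
    using continuous_map_compose[OF continuous_inv fc]
    by (intro continuous_map_compose_continuous_on[where h=cnj]) (auto simp: o_def intro!: continuous_intros)
  then have "continuous_map (gtop G) euclidean (involution G f)"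
    by (rule continuous_map_eq) (simp add: involution_def topspace_gtop)
  moreover have "compactin (gtop G) (ginv G ` K)" by (rule image_compactin[OF K(1) continuous_inv])
  moreover have "involution G f \<gamma> = 0" if "\<gamma> \<notin> ginv G ` K" for \<gamma>
  proof (cases "\<gamma> \<in> arrows G")
    case True
    then have "ginv G \<gamma> \<notin> K" using that inv_inv[OF True] by force
    then show ?thesis using K(2) by (simp add: involution_def)
  qed (simp add: involution_outside)
  ultimately show ?thesis by (rule C_cI[OF Hausdorff])
qed

end

section \<open>The function model of the reduced algebra\<close>

lemma C_0E:
  assumes "f \<in> C_0 X"
  shows "continuous_map X euclidean f" "x \<notin> topspace X \<Longrightarrow> f x = 0"
    "e > 0 \<Longrightarrow> compactin X {x \<in> topspace X. e \<le> norm (f x)}"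
  using assms by (auto simp: C_0_def)

lemma C_0_approx:
  assumes X: "Hausdorff_space X" and f: "f \<in> C_0 X" and e: "e > 0"
  obtains g where "g \<in> C_c X" "\<And>x. norm (f x - g x) \<le> e"
proof -
  \<comment> \<open>Soft thresholding: values of modulus at most \<open>e\<close> become 0 and all
    others move toward 0 by \<open>e\<close>. The \<open>max\<close> keeps the denominator
    positive.\<close>
  define g where "g = (\<lambda>x. complex_of_real (1 - e / max (norm (f x)) e) * f x)"
  have pos: "max (norm (f x)) e > 0" for x using e by (simp add: less_max_iff_disj)
  have "continuous_map X euclideanreal (\<lambda>x. 1 - e / max (norm (f x)) e)"
    using pos C_0E(1)[OF f]
    by (intro continuous_map_diff continuous_map_real_divide continuous_map_real_max continuous_map_norm)
       (simp_all add: less_imp_neq[symmetric])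
  then have "continuous_map X euclidean (\<lambda>x. complex_of_real (1 - e / max (norm (f x)) e))"
    by (rule continuous_map_compose_continuous_on) (auto intro!: continuous_intros)
  then have "continuous_map X euclidean g"
    unfolding g_def by (intro continuous_map_times C_0E(1)[OF f])
  moreover have "g x = 0" if "x \<notin> {x \<in> topspace X. e \<le> norm (f x)}" for x
  proof (cases "x \<in> topspace X")
    case True
    then have "max (norm (f x)) e = e" using that by auto
    then show ?thesis using e by (simp add: g_def)
  qed (simp add: g_def C_0E(2)[OF f])
  ultimately have "g \<in> C_c X" using C_cI[OF X _ C_0E(3)[OF f e]] by blast
  moreover have "norm (f x - g x) \<le> e" for x
  proof -
    have "f x - g x = complex_of_real (e / max (norm (f x)) e) * f x"
      by (simp add: g_def algebra_simps)
    then have "norm (f x - g x) = e * (norm (f x) / max (norm (f x)) e)"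
      using e pos[of x] by (simp add: norm_mult norm_divide)
    also have "\<dots> \<le> e * 1" using e pos[of x] by (intro mult_left_mono) (simp_all add: divide_le_eq_1)
    finally show ?thesis by simp
  qed
  ultimately show ?thesis by (rule that)
qed

context hausdorff_etale_groupoid
begin

lemma C_c_outside: "\<lbrakk>f \<in> C_c (gtop G); \<gamma> \<notin> arrows G\<rbrakk> \<Longrightarrow> f \<gamma> = 0"
  by (simp add: C_c_def topspace_gtop)

text \<open>A concrete model of the reduced algebra: its elements are functions on the arrows, with the
  same operations as \<open>convolution_algebra G\<close>.\<close>

definition redc :: "('g \<Rightarrow> complex) set" where
  "redc = {a. (\<forall>\<gamma>. \<gamma> \<notin> arrows G \<longrightarrow> a \<gamma> = 0) \<and> (\<forall>e>0. \<exists>f\<in>C_c (gtop G). opb (\<lambda>\<gamma>. a \<gamma> - f \<gamma>) e)}"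

section \<open>Algebra operations and completeness of the function model\<close>

lemma redc_outside: "\<lbrakk>a \<in> redc; \<gamma> \<notin> arrows G\<rbrakk> \<Longrightarrow> a \<gamma> = 0" by (simp add: redc_def)

lemma redc_approx: "\<lbrakk>a \<in> redc; e > 0\<rbrakk> \<Longrightarrow> \<exists>f\<in>C_c (gtop G). opb (\<lambda>\<gamma>. a \<gamma> - f \<gamma>) e"
  by (simp add: redc_def)

lemma redcI:
  assumes "\<And>\<gamma>. \<gamma> \<notin> arrows G \<Longrightarrow> a \<gamma> = 0" "\<And>e. e > 0 \<Longrightarrow> \<exists>f\<in>C_c (gtop G). opb (\<lambda>\<gamma>. a \<gamma> - f \<gamma>) e"
  shows "a \<in> redc"
  using assms by (simp add: redc_def)

lemma redc_opb: "a \<in> redc \<Longrightarrow> \<exists>C. opb a C"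
proof -
  assume "a \<in> redc"
  then obtain f where f: "f \<in> C_c (gtop G)" "opb (\<lambda>\<gamma>. a \<gamma> - f \<gamma>) 1" using redc_approx[of a 1] by auto
  obtain C where "opb f C" using C_c_opb[OF f(1)] by blast
  from opb_add[OF f(2) this] show ?thesis by auto
qed

lemma redc_opb_pos: "a \<in> redc \<Longrightarrow> \<exists>C>0. opb a C"
  using redc_opb[of a] opb_mono[of a _ "max 1 _"] by (metis less_max_iff_disj max.cobounded2 zero_less_one)

lemma C_c_redc: "f \<in> C_c (gtop G) \<Longrightarrow> f \<in> redc"
  using opb_mono[OF opb_zero] by (intro redcI) (auto simp: C_c_outside intro!: bexI[of _ f])

lemma redc_lim:
  assumes "\<And>\<gamma>. \<gamma> \<notin> arrows G \<Longrightarrow> a \<gamma> = 0" "\<And>e. e > 0 \<Longrightarrow> \<exists>b\<in>redc. opb (\<lambda>\<gamma>. a \<gamma> - b \<gamma>) e"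
  shows "a \<in> redc"
proof (rule redcI)
  fix e :: real assume e: "e > 0"
  obtain b where b: "b \<in> redc" "opb (\<lambda>\<gamma>. a \<gamma> - b \<gamma>) (e/2)" using assms(2)[of "e/2"] e by auto
  obtain f where f: "f \<in> C_c (gtop G)" "opb (\<lambda>\<gamma>. b \<gamma> - f \<gamma>) (e/2)" using redc_approx[OF b(1), of "e/2"] e by auto
  have "opb (\<lambda>\<gamma>. a \<gamma> - f \<gamma>) e" using opb_add[OF b(2) f(2)] by simp
  then show "\<exists>f\<in>C_c (gtop G). opb (\<lambda>\<gamma>. a \<gamma> - f \<gamma>) e" using f by blast
qed (rule assms)

lemma redc_add [simp]:
  assumes "a \<in> redc" "b \<in> redc"
  shows "(\<lambda>\<gamma>. a \<gamma> + b \<gamma>) \<in> redc"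
proof (rule redcI)
  fix e :: real assume e: "e > 0"
  obtain f where f: "f \<in> C_c (gtop G)" "opb (\<lambda>\<gamma>. a \<gamma> - f \<gamma>) (e/2)" using redc_approx[OF assms(1), of "e/2"] e by auto
  obtain g where g: "g \<in> C_c (gtop G)" "opb (\<lambda>\<gamma>. b \<gamma> - g \<gamma>) (e/2)" using redc_approx[OF assms(2), of "e/2"] e by auto
  have "opb (\<lambda>\<gamma>. (a \<gamma> + b \<gamma>) - (f \<gamma> + g \<gamma>)) e" using opb_add[OF f(2) g(2)] by (simp add: algebra_simps)
  then show "\<exists>f\<in>C_c (gtop G). opb (\<lambda>\<gamma>. (a \<gamma> + b \<gamma>) - f \<gamma>) e" by (rule bexI[OF _ C_c_add[OF Hausdorff f(1) g(1)]])
qed (simp add: assms redc_outside)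

lemma redc_scale [simp]:
  assumes "a \<in> redc"
  shows "(\<lambda>\<gamma>. c * a \<gamma>) \<in> redc"
proof (rule redcI)
  fix e :: real assume e: "e > 0"
  let ?d = "e / (norm c + 1)"
  have p: "norm c + 1 > 0" by (simp add: add_nonneg_pos)
  obtain f where f: "f \<in> C_c (gtop G)" "opb (\<lambda>\<gamma>. a \<gamma> - f \<gamma>) ?d" using redc_approx[OF assms, of ?d] e p by auto
  have "norm c * ?d \<le> e" using e p by (simp add: field_simps)
  then have "opb (\<lambda>\<gamma>. c * a \<gamma> - c * f \<gamma>) e"
    using opb_mono[OF opb_scale[OF f(2), of c]] by (simp add: right_diff_distrib)
  then show "\<exists>f\<in>C_c (gtop G). opb (\<lambda>\<gamma>. c * a \<gamma> - f \<gamma>) e" by (rule bexI[OF _ C_c_scale[OF Hausdorff f(1)]])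
qed (simp add: assms redc_outside)

lemma redc_diff [simp]: "\<lbrakk>a \<in> redc; b \<in> redc\<rbrakk> \<Longrightarrow> (\<lambda>\<gamma>. a \<gamma> - b \<gamma>) \<in> redc"
  using redc_add[of a "\<lambda>\<gamma>. (-1) * b \<gamma>"] redc_scale[of b "-1"] by simp

lemma redc_zero [simp]: "(\<lambda>_. 0) \<in> redc"
  by (rule C_c_redc[OF C_c_zero[OF Hausdorff]])

lemma redc_sum: "(\<And>i. i \<in> I \<Longrightarrow> f i \<in> redc) \<Longrightarrow> (\<lambda>\<gamma>. \<Sum>i\<in>I. f i \<gamma>) \<in> redc"
  by (induction I rule: infinite_finite_induct) simp_all

lemma redc_involution [simp]:
  assumes "a \<in> redc"
  shows "involution G a \<in> redc"
proof (rule redcI)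
  fix e :: real assume e: "e > 0"
  obtain f where f: "f \<in> C_c (gtop G)" "opb (\<lambda>\<gamma>. a \<gamma> - f \<gamma>) e" using redc_approx[OF assms e] by auto
  have "(\<lambda>\<gamma>. involution G a \<gamma> - involution G f \<gamma>) = involution G (\<lambda>\<gamma>. a \<gamma> - f \<gamma>)"
    by (auto simp: involution_def)
  then show "\<exists>f\<in>C_c (gtop G). opb (\<lambda>\<gamma>. involution G a \<gamma> - f \<gamma>) e"
    using opb_involution[OF f(2)] involution_C_c[OF f(1)] by metis
qed (simp add: involution_outside)

lemma redc_convolution_add_left:
  "\<lbrakk>a \<in> redc; b \<in> redc; c \<in> redc\<rbrakk> \<Longrightarrow>
     convolution G (\<lambda>\<gamma>. a \<gamma> + b \<gamma>) c = (\<lambda>\<gamma>. convolution G a c \<gamma> + convolution G b c \<gamma>)"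
  using convolution_add_left redc_opb by metis

lemma redc_convolution_add_right:
  "\<lbrakk>a \<in> redc; b \<in> redc; c \<in> redc\<rbrakk> \<Longrightarrow>
     convolution G a (\<lambda>\<gamma>. b \<gamma> + c \<gamma>) = (\<lambda>\<gamma>. convolution G a b \<gamma> + convolution G a c \<gamma>)"
  using convolution_add_right redc_opb by metis

lemma redc_convolution_assoc:
  "\<lbrakk>a \<in> redc; b \<in> redc; c \<in> redc\<rbrakk> \<Longrightarrow>
     convolution G (convolution G a b) c = convolution G a (convolution G b c)"
  using convolution_assoc redc_opb by metis

text \<open>From the splitting \<open>a b - f g = (a - f) b + f (b - g)\<close>, where the
  approximant \<open>f\<close> shares the bound \<open>A\<close> with \<open>a\<close>.\<close>

lemma convolution_diff_opb:
  assumes "opb a A" "opb f A" "opb b B" "opb g B" "opb (\<lambda>\<gamma>. a \<gamma> - f \<gamma>) d" "opb (\<lambda>\<gamma>. b \<gamma> - g \<gamma>) e"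
  shows "opb (\<lambda>\<gamma>. convolution G a b \<gamma> - convolution G f g \<gamma>) (d * B + A * e)"
proof -
  have "convolution G a b = (\<lambda>\<gamma>. convolution G (\<lambda>\<gamma>. a \<gamma> - f \<gamma>) b \<gamma> + convolution G f b \<gamma>)"
    using convolution_add_left[OF assms(5,2,3)] by simp
  moreover have "convolution G f b = (\<lambda>\<gamma>. convolution G f (\<lambda>\<gamma>. b \<gamma> - g \<gamma>) \<gamma> + convolution G f g \<gamma>)"
    using convolution_add_right[OF assms(2,6,4)] by simp
  ultimately have "(\<lambda>\<gamma>. convolution G a b \<gamma> - convolution G f g \<gamma>)
      = (\<lambda>\<gamma>. convolution G (\<lambda>\<gamma>. a \<gamma> - f \<gamma>) b \<gamma> + convolution G f (\<lambda>\<gamma>. b \<gamma> - g \<gamma>) \<gamma>)"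
    by (metis (no_types, lifting) add.assoc add_diff_cancel_right')
  then show ?thesis
    using opb_add[OF opb_convolution[OF assms(5,3)] opb_convolution[OF assms(2,6)]] by simp
qed

lemma redc_convolution [simp]:
  assumes "a \<in> redc" "b \<in> redc"
  shows "convolution G a b \<in> redc"
proof (rule redcI)
  fix e :: real assume e: "e > 0"
  obtain A where A: "A > 0" "opb a A" using redc_opb_pos[OF assms(1)] by blast
  obtain B where B: "B > 0" "opb b B" using redc_opb_pos[OF assms(2)] by blast
  \<comment> \<open>With \<open>d \<le> 1\<close> the approximants are bounded by
    \<open>A + 1\<close> and \<open>B + 1\<close>, and the total error becomes
    \<open>d * (A + B + 2)\<close>.\<close>
  define d where "d = min 1 (e / (A + B + 2))"
  have ABp: "A + B + 2 > 0" using A B by simp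
  have d: "d > 0" "d \<le> 1" "d * (A + B + 2) \<le> e"
    using e ABp by (auto simp: d_def min_le_iff_disj pos_le_divide_eq[symmetric])
  obtain f where f: "f \<in> C_c (gtop G)" "opb (\<lambda>\<gamma>. a \<gamma> - f \<gamma>) d" using redc_approx[OF assms(1) d(1)] by auto
  obtain g where g: "g \<in> C_c (gtop G)" "opb (\<lambda>\<gamma>. b \<gamma> - g \<gamma>) d" using redc_approx[OF assms(2) d(1)] by auto
  have f': "opb f (A + 1)" using opb_mono[OF opb_diff[OF A(2) f(2)], of "A + 1"] d(2) by simp
  have g': "opb g (B + 1)" using opb_mono[OF opb_diff[OF B(2) g(2)], of "B + 1"] d(2) by simp
  have "opb (\<lambda>\<gamma>. convolution G a b \<gamma> - convolution G f g \<gamma>) (d * (B + 1) + (A + 1) * d)"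
    by (rule convolution_diff_opb[OF opb_mono[OF A(2)] f' opb_mono[OF B(2)] g' f(2) g(2)]) simp_all
  moreover have "d * (B + 1) + (A + 1) * d \<le> e" using d(3) by (simp add: algebra_simps)
  ultimately show "\<exists>f\<in>C_c (gtop G). opb (\<lambda>\<gamma>. convolution G a b \<gamma> - f \<gamma>) e"
    using convolution_C_c[OF f(1) g(1)] opb_mono by blast
qed (simp add: convolution_outside)

text \<open>Operator bounds dominate the supremum norm, so the approximants from \<open>C_c\<close>
  converge uniformly.\<close>

lemma redc_continuous:
  assumes "a \<in> redc"
  shows "continuous_map (gtop G) euclidean a"
proof -
  have "\<exists>f\<in>C_c (gtop G). opb (\<lambda>\<gamma>. a \<gamma> - f \<gamma>) (inverse (Suc n))" for n
    by (rule redc_approx[OF assms]) simp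
  then obtain f where f: "\<And>n::nat. f n \<in> C_c (gtop G)" "\<And>n. opb (\<lambda>\<gamma>. a \<gamma> - f n \<gamma>) (inverse (Suc n))" by metis
  have "continuous_map (gtop G) Met_TC.mtopology a"
  proof (rule Met_TC.continuous_map_uniform_limit[where F=sequentially and f=f])
    show "\<forall>\<^sub>F n in sequentially. continuous_map (gtop G) Met_TC.mtopology (f n)"
      using f(1) by (simp add: C_c_def)
    fix e :: real assume "e > 0"
    then have "\<forall>\<^sub>F n in sequentially. inverse (Suc n) < e"
      using LIMSEQ_inverse_real_of_nat order_tendstoD(2) by blast
    then show "\<forall>\<^sub>F n in sequentially. \<forall>x\<in>topspace (gtop G). a x \<in> UNIV \<and> dist (f n x) (a x) < e"
    proof eventually_elim
      case (elim n)
      show ?case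
      proof
        fix x assume "x \<in> topspace (gtop G)"
        then have "norm (a x - f n x) \<le> inverse (Suc n)"
          using opb_pointwise[OF f(2)] by (simp add: topspace_gtop)
        then show "a x \<in> UNIV \<and> dist (f n x) (a x) < e" using elim by (simp add: dist_norm norm_minus_commute)
      qed
    qed
  qed simp
  then show ?thesis by simp
qed

text \<open>The limit is formed pointwise. Letting \<open>m\<close> grow in the Cauchy estimate with
  \<open>n\<close> fixed then preserves the operator bound by \<open>opb_lim\<close>.\<close>

lemma redc_complete:
  assumes "\<And>n. x n \<in> redc" "\<And>e. e > 0 \<Longrightarrow> \<exists>N. \<forall>m\<ge>N. \<forall>n\<ge>N. opb (\<lambda>\<gamma>. x m \<gamma> - x n \<gamma>) e"
  obtains a where "a \<in> redc" "\<And>e. e > 0 \<Longrightarrow> \<exists>N. \<forall>n\<ge>N. opb (\<lambda>\<gamma>. a \<gamma> - x n \<gamma>) e"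
    "\<And>\<gamma>. (\<lambda>n::nat. x n \<gamma>) \<longlonglongrightarrow> a \<gamma>"
proof -
  have "convergent (\<lambda>n. x n \<gamma>)" for \<gamma>
  proof (cases "\<gamma> \<in> arrows G")
    case True
    have "Cauchy (\<lambda>n. x n \<gamma>)"
    proof (rule metric_CauchyI)
      fix e :: real assume e: "e > 0"
      obtain N where N: "\<And>m n. \<lbrakk>m \<ge> N; n \<ge> N\<rbrakk> \<Longrightarrow> opb (\<lambda>\<gamma>. x m \<gamma> - x n \<gamma>) (e/2)"
        using assms(2)[of "e/2"] e by auto
      have "dist (x m \<gamma>) (x n \<gamma>) < e" if "m \<ge> N" "n \<ge> N" for m n
        using opb_pointwise[OF N[OF that] True] e by (simp add: dist_norm)
      then show "\<exists>M. \<forall>m\<ge>M. \<forall>n\<ge>M. dist (x m \<gamma>) (x n \<gamma>) < e" by blast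
    qed
    then show ?thesis by (simp add: Cauchy_convergent_iff)
  next
    case False
    then have "(\<lambda>n. x n \<gamma>) = (\<lambda>_. 0)" using redc_outside assms(1) by auto
    then show ?thesis by (simp add: convergent_const)
  qed
  then obtain a where a: "\<And>\<gamma>. (\<lambda>n. x n \<gamma>) \<longlonglongrightarrow> a \<gamma>" unfolding convergent_def by metis
  have lim: "\<exists>N. \<forall>n\<ge>N. opb (\<lambda>\<gamma>. a \<gamma> - x n \<gamma>) e" if e: "e > 0" for e
  proof -
    obtain N where N: "\<And>m n. \<lbrakk>m \<ge> N; n \<ge> N\<rbrakk> \<Longrightarrow> opb (\<lambda>\<gamma>. x m \<gamma> - x n \<gamma>) e"
      using assms(2)[OF e] by auto
    have "opb (\<lambda>\<gamma>. a \<gamma> - x n \<gamma>) e" if n: "n \<ge> N" for n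
    proof (rule opb_lim)
      show "opb (\<lambda>\<gamma>. x (m + N) \<gamma> - x n \<gamma>) e" for m by (rule N) (use n in auto)
      show "(\<lambda>m. x (m + N) \<gamma> - x n \<gamma>) \<longlonglongrightarrow> a \<gamma> - x n \<gamma>" for \<gamma>
        by (rule tendsto_diff[OF LIMSEQ_ignore_initial_segment[OF a] tendsto_const])
    qed
    then show ?thesis by blast
  qed
  have "a \<in> redc"
  proof (rule redc_lim)
    fix \<gamma> assume "\<gamma> \<notin> arrows G"
    then have "(\<lambda>n. x n \<gamma>) = (\<lambda>_. 0)" using redc_outside assms(1) by auto
    then show "a \<gamma> = 0" using a[of \<gamma>] by (simp add: LIMSEQ_const_iff)
  next
    fix e :: real assume "e > 0"
    then show "\<exists>b\<in>redc. opb (\<lambda>\<gamma>. a \<gamma> - b \<gamma>) e" using lim assms(1) by blast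
  qed
  then show ?thesis using that lim a by blast
qed

section \<open>The diagonal and its commutant\<close>

abbreviation C0 :: "('g \<Rightarrow> complex) set" where "C0 \<equiv> C_0 (unit_space G)"

lemma C0_outside: "\<lbrakk>f \<in> C0; \<gamma> \<notin> units G\<rbrakk> \<Longrightarrow> f \<gamma> = 0"
  using C_0E(2) topspace_unit_space by metis

text \<open>The kernel is diagonal, so the Schur test with one entry per row yields the supremum
  bound.\<close>

lemma opb_unit_supported:
  assumes "\<And>\<gamma>. \<gamma> \<notin> units G \<Longrightarrow> h \<gamma> = 0" "\<And>x. norm (h x) \<le> c"
  shows "opb h c"
proof -
  have c: "0 \<le> c" using assms(2) norm_ge_zero order_trans by metis
  have "bounded_kernel (source_fibre G x) (kern h) (c * (1::nat))" for x
  proof (rule bounded_kernel_Schur_test[OF c])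
    show "norm (kern h a b) \<le> c" for a b using assms(2) by (simp add: kern_def)
    fix a assume a: "a \<in> source_fibre G x"
    have eq: "b = a" "b = a" if "b \<in> source_fibre G x" "kern h a b \<noteq> 0 \<or> kern h b a \<noteq> 0" for b
      using that assms(1) quotient_in_units_iff[OF a that(1)] quotient_in_units_iff[OF that(1) a]
      by (auto simp: kern_def)
    show "finite {b \<in> source_fibre G x. kern h a b \<noteq> 0} \<and> card {b \<in> source_fibre G x. kern h a b \<noteq> 0} \<le> 1"
      by (rule subsingleton_card) (use eq in auto)
    show "finite {b \<in> source_fibre G x. kern h b a \<noteq> 0} \<and> card {b \<in> source_fibre G x. kern h b a \<noteq> 0} \<le> 1"
      by (rule subsingleton_card) (use eq in auto)
  qed
  then show ?thesis using c by (simp add: opb_def)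
qed

lemma C0_redc [simp]: 
  assumes "f \<in> C0" shows "f \<in> redc"
proof (rule redcI)
  fix \<gamma> assume "\<gamma> \<notin> arrows G"
  then show "f \<gamma> = 0" using C0_outside[OF assms] units_subset by blast
next
  fix e :: real assume e: "e > 0"
  obtain g where g: "g \<in> C_c (unit_space G)" "\<And>x. norm (f x - g x) \<le> e"
    using C_0_approx[OF Hausdorff_unit_space assms e] by blast
  have "opb (\<lambda>\<gamma>. f \<gamma> - g \<gamma>) e"
    by (rule opb_unit_supported) (use g C0_outside[OF assms] in \<open>auto simp: C_c_units_iff\<close>)
  then show "\<exists>g\<in>C_c (gtop G). opb (\<lambda>\<gamma>. f \<gamma> - g \<gamma>) e" using g(1) by (auto simp: C_c_units_iff)
qed

text \<open>Reduces membership in \<open>C0\<close> to vanishing off the units. Decay at infinity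
  comes from an approximant \<open>g\<close> within \<open>e/2\<close>: wherever the function has
  modulus at least \<open>e\<close>, \<open>g\<close> is nonzero, hence the point lies in the
  compact support of \<open>g\<close>.\<close>

lemma C0_iff: "f \<in> C0 \<longleftrightarrow> f \<in> redc \<and> (\<forall>\<gamma>. \<gamma> \<notin> units G \<longrightarrow> f \<gamma> = 0)"
proof (intro iffI conjI allI impI)
  assume "f \<in> redc \<and> (\<forall>\<gamma>. \<gamma> \<notin> units G \<longrightarrow> f \<gamma> = 0)"
  then have f: "f \<in> redc" and z: "\<And>\<gamma>. \<gamma> \<notin> units G \<Longrightarrow> f \<gamma> = 0" by auto
  have c: "continuous_map (unit_space G) euclidean f"
    unfolding unit_space_def by (rule continuous_map_from_subtopology[OF redc_continuous[OF f]])
  have "compactin (unit_space G) {x \<in> topspace (unit_space G). e \<le> norm (f x)}" if e: "e > 0" for e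
  proof -
    obtain g where g: "g \<in> C_c (gtop G)" "opb (\<lambda>\<gamma>. f \<gamma> - g \<gamma>) (e/2)" using redc_approx[OF f, of "e/2"] e by auto
    obtain K where K: "compactin (gtop G) K" "\<forall>x. x \<notin> K \<longrightarrow> g x = 0" "continuous_map (gtop G) euclidean g"
      by (rule C_cE[OF Hausdorff g(1)])
    have KU: "compactin (unit_space G) (units G \<inter> K)"
      unfolding compactin_unit_space using closed_Int_compactin[OF closed_units K(1)] by auto
    have sub: "{x \<in> topspace (unit_space G). e \<le> norm (f x)} \<subseteq> units G \<inter> K"
    proof
      fix x assume "x \<in> {x \<in> topspace (unit_space G). e \<le> norm (f x)}"
      then have x: "x \<in> units G" "e \<le> norm (f x)" by (auto simp: topspace_unit_space)
      have "norm (f x - g x) \<le> e/2" using opb_pointwise[OF g(2)] x unitsD by simp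
      then have "g x \<noteq> 0" using x e by auto
      then show "x \<in> units G \<inter> K" using K(2) x by blast
    qed
    have "closedin (unit_space G) {x \<in> topspace (unit_space G). norm (f x) \<in> {e..}}"
      by (rule closedin_continuous_map_preimage[OF continuous_map_norm[OF c]]) simp
    then show ?thesis unfolding atLeast_iff by (rule closed_compactin[OF KU sub])
  qed
  then show "f \<in> C0" using c z by (simp add: C_0_def topspace_unit_space)
qed (simp_all add: C0_outside)

lemma C0_convolution_right: "\<lbrakk>k \<in> C0; \<gamma> \<in> arrows G\<rbrakk> \<Longrightarrow> convolution G a k \<gamma> = a \<gamma> * k (gdom G \<gamma>)"
  by (rule convolution_unit_supported_right[OF C0_outside])

lemma C0_convolution_left: "\<lbrakk>k \<in> C0; \<gamma> \<in> arrows G\<rbrakk> \<Longrightarrow> convolution G k a \<gamma> = k (gran G \<gamma>) * a \<gamma>"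
  by (rule convolution_unit_supported_left[OF C0_outside])

lemma C0_convolution:
  assumes "k \<in> C0" "l \<in> C0"
  shows "convolution G k l = (\<lambda>\<gamma>. k \<gamma> * l \<gamma>)"
proof
  fix \<gamma>
  show "convolution G k l \<gamma> = k \<gamma> * l \<gamma>"
  proof (cases "\<gamma> \<in> units G")
    case True then show ?thesis using unitsD[OF True] assms by (simp add: C0_convolution_right)
  next
    case False
    then show ?thesis using assms
      by (cases "\<gamma> \<in> arrows G") (simp_all add: C0_convolution_right C0_outside convolution_outside)
  qed
qed

lemma C0_involution: "k \<in> C0 \<Longrightarrow> involution G k = (\<lambda>\<gamma>. cnj (k \<gamma>))"
proof
  fix \<gamma> assume k: "k \<in> C0"
  show "involution G k \<gamma> = cnj (k \<gamma>)"
  proof (cases "\<gamma> \<in> units G")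
    case True then show ?thesis using unitsD[OF True] inv_unit[OF True] by (simp add: involution_def)
  next
    case False
    have "ginv G \<gamma> \<notin> units G" if "\<gamma> \<in> arrows G"
      using False inv_inv[OF that] inv_unit by metis
    then show ?thesis using False k by (simp add: involution_def C0_outside)
  qed
qed

lemma C0_add: "\<lbrakk>k \<in> C0; l \<in> C0\<rbrakk> \<Longrightarrow> (\<lambda>\<gamma>. k \<gamma> + l \<gamma>) \<in> C0"
  and C0_scale: "k \<in> C0 \<Longrightarrow> (\<lambda>\<gamma>. c * k \<gamma>) \<in> C0"
  and C0_mult: "\<lbrakk>k \<in> C0; l \<in> C0\<rbrakk> \<Longrightarrow> (\<lambda>\<gamma>. k \<gamma> * l \<gamma>) \<in> C0"
  and C0_cnj: "k \<in> C0 \<Longrightarrow> (\<lambda>\<gamma>. cnj (k \<gamma>)) \<in> C0"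
proof -
  show "\<lbrakk>k \<in> C0; l \<in> C0\<rbrakk> \<Longrightarrow> (\<lambda>\<gamma>. k \<gamma> + l \<gamma>) \<in> C0" "k \<in> C0 \<Longrightarrow> (\<lambda>\<gamma>. c * k \<gamma>) \<in> C0"
    by (auto simp: C0_iff)
  show "\<lbrakk>k \<in> C0; l \<in> C0\<rbrakk> \<Longrightarrow> (\<lambda>\<gamma>. k \<gamma> * l \<gamma>) \<in> C0"
    using redc_convolution[of k l] C0_outside by (subst C0_iff) (simp add: C0_convolution)
  show "k \<in> C0 \<Longrightarrow> (\<lambda>\<gamma>. cnj (k \<gamma>)) \<in> C0"
    using redc_involution[of k] C0_outside by (subst C0_iff) (simp add: C0_involution)
qed

lemma bump_function:
  assumes "\<alpha> \<in> W" "openin (gtop G) W"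
  obtains k :: "'g \<Rightarrow> real" where "(\<lambda>\<gamma>. complex_of_real (k \<gamma>)) \<in> C_c (gtop G)" "k \<alpha> = 1" "\<And>\<gamma>. \<gamma> \<notin> W \<Longrightarrow> k \<gamma> = 0"
proof -
  let ?X = "gtop G"
  have cr: "completely_regular_space ?X"
    using locally_compact_regular_imp_completely_regular_space locally_compact Hausdorff by blast
  have a: "\<alpha> \<in> topspace ?X" using openin_subset[OF assms(2)] assms(1) by blast
  obtain U K where U: "openin ?X U" "compactin ?X K" "\<alpha> \<in> U" "U \<subseteq> K"
    using locally_compact a unfolding locally_compact_space_def by blast
  have "closedin ?X (topspace ?X - (U \<inter> W))" using U assms by blast
  moreover have "\<alpha> \<in> topspace ?X - (topspace ?X - (U \<inter> W))" using U assms a by blast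
  ultimately obtain \<phi> :: "'g \<Rightarrow> real" where \<phi>: "continuous_map ?X (top_of_set {0..1}) \<phi>" "\<phi> \<alpha> = 0"
      "\<phi> ` (topspace ?X - (U \<inter> W)) \<subseteq> {1}"
    using cr unfolding completely_regular_space_def by blast
  \<comment> \<open>On the space, \<open>1 - \<phi>\<close> already vanishes off
    \<open>U \<inter> W\<close>, so the cut-off only changes values outside the space, and the
    support falls into the compact set \<open>K\<close>.\<close>
  define k where "k = (\<lambda>\<gamma>. if \<gamma> \<in> U \<inter> W then 1 - \<phi> \<gamma> else 0)"
  have "continuous_map ?X euclideanreal \<phi>" using \<phi>(1) by (simp add: continuous_map_in_subtopology)
  then have "continuous_map ?X euclidean (\<lambda>\<gamma>. complex_of_real (1 - \<phi> \<gamma>))"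
    by (rule continuous_map_compose_continuous_on) (auto intro!: continuous_intros)
  then have "continuous_map ?X euclidean (\<lambda>\<gamma>. complex_of_real (k \<gamma>))"
    by (rule continuous_map_eq) (use \<phi>(3) in \<open>auto simp: k_def\<close>)
  then have "(\<lambda>\<gamma>. complex_of_real (k \<gamma>)) \<in> C_c ?X"
    by (rule C_cI[OF Hausdorff _ U(2)]) (use U(4) in \<open>auto simp: k_def\<close>)
  moreover have "k \<alpha> = 1" "\<And>\<gamma>. \<gamma> \<notin> W \<Longrightarrow> k \<gamma> = 0" using \<phi>(2) U assms by (auto simp: k_def)
  ultimately show ?thesis by (rule that)
qed

text \<open>Produced as a real function, so that the result also serves where self-adjoint elements
  of \<open>C0\<close> are required.\<close>

lemma C0_separates:
  assumes "x \<in> units G" "x \<noteq> y"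
  obtains k :: "'g \<Rightarrow> real" where "(\<lambda>\<gamma>. complex_of_real (k \<gamma>)) \<in> C0" "k x = 1" "k y = 0"
proof -
  have "closedin (gtop G) (topspace (gtop G) \<inter> {y})"
    using Hausdorff by (cases "y \<in> topspace (gtop G)") (auto simp: closedin_Hausdorff_singleton)
  then have "openin (gtop G) (units G - (topspace (gtop G) \<inter> {y}))" using open_units by (rule openin_diff[rotated])
  then obtain k :: "'g \<Rightarrow> real" where k: "(\<lambda>\<gamma>. complex_of_real (k \<gamma>)) \<in> C_c (gtop G)" "k x = 1"
    "\<And>\<gamma>. \<gamma> \<notin> units G - (topspace (gtop G) \<inter> {y}) \<Longrightarrow> k \<gamma> = 0"
    using bump_function[of x] assms by (metis DiffI Int_iff singletonD)
  have "k y = 0" using k(3)[of y] units_subset by (auto simp: topspace_gtop)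
  moreover have "(\<lambda>\<gamma>. complex_of_real (k \<gamma>)) \<in> C0" using k C_c_redc by (auto simp: C0_iff)
  ultimately show ?thesis using that k(2) by blast
qed

text \<open>At an arrow the two products multiply \<open>a\<close> by the values of \<open>k\<close>
  at the range and at the source. A function separating these ends forces \<open>a\<close> to
  vanish, and continuity of \<open>a\<close> makes its nonvanishing set open.\<close>

lemma C0_commutant:
  assumes "effective G" "a \<in> redc" "\<And>k. k \<in> C0 \<Longrightarrow> convolution G k a = convolution G a k"
  shows "a \<in> C0"
proof -
  have "{\<gamma> \<in> topspace (gtop G). a \<gamma> \<in> - {0}} \<subseteq> isotropy G"
  proof
    fix \<gamma> assume "\<gamma> \<in> {\<gamma> \<in> topspace (gtop G). a \<gamma> \<in> - {0}}"
    then have g: "\<gamma> \<in> arrows G" "a \<gamma> \<noteq> 0" by (auto simp: topspace_gtop)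
    have "gran G \<gamma> = gdom G \<gamma>"
    proof (rule ccontr)
      assume "gran G \<gamma> \<noteq> gdom G \<gamma>"
      then obtain k :: "'g \<Rightarrow> real" where k: "(\<lambda>\<gamma>. complex_of_real (k \<gamma>)) \<in> C0" "k (gran G \<gamma>) = 1" "k (gdom G \<gamma>) = 0"
        using C0_separates[OF ran_in_units[OF g(1)]] by metis
      have "convolution G (\<lambda>\<gamma>. complex_of_real (k \<gamma>)) a \<gamma> = convolution G a (\<lambda>\<gamma>. complex_of_real (k \<gamma>)) \<gamma>"
        using assms(3)[OF k(1)] by simp
      then show False using g k(2,3) C0_convolution_left[OF k(1) g(1)] C0_convolution_right[OF k(1) g(1)] by simp
    qed
    then show "\<gamma> \<in> isotropy G" using g by (simp add: isotropy_def)
  qed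
  moreover have "openin (gtop G) {\<gamma> \<in> topspace (gtop G). a \<gamma> \<in> - {0}}"
    by (rule openin_continuous_map_preimage[OF redc_continuous[OF assms(2)]]) (simp add: open_Compl)
  ultimately have "{\<gamma> \<in> topspace (gtop G). a \<gamma> \<in> - {0}} \<subseteq> units G"
    using assms(1) unfolding effective_def by (metis interior_of_maximal)
  then have "a \<gamma> = 0" if "\<gamma> \<notin> units G" for \<gamma>
    using that redc_outside[OF assms(2), of \<gamma>] by (auto simp: topspace_gtop)
  then show ?thesis using assms(2) by (simp add: C0_iff)
qed

end

section \<open>Automorphisms fixing the diagonal\<close>

text \<open>Inverse of the map sending \<open>z\<close> to \<open>z * norm z ^ (n - 1)\<close>. For
  \<open>n = 2 k + 1\<close> the second factor is the \<open>k\<close>-th power of the squared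
  modulus, hence an expression in \<open>cnj z * z\<close>; keeping the phase avoids any choice of
  branch.\<close>

definition odd_root :: "nat \<Rightarrow> complex \<Rightarrow> complex" where
  "odd_root n z = sgn z * of_real (root n (norm z))"

text \<open>At 0 the phase is discontinuous, and the modulus squeezes the value to 0
  instead.\<close>

lemma continuous_odd_root:
  assumes "n > 0"
  shows "continuous_on UNIV (odd_root n)"
proof (rule continuous_at_imp_continuous_on, rule ballI)
  fix z :: complex
  have r: "isCont (\<lambda>z::complex. root n (norm z)) z"
    by (intro continuous_intros)
  show "isCont (odd_root n) z"
  proof (cases "z = 0")
    case False
    then show ?thesis unfolding odd_root_def[abs_def]
      by (intro continuous_mult isCont_sgn continuous_of_real r continuous_ident)
  next
    case True
    have "norm (odd_root n w) \<le> root n (norm w)" for w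
      using assms by (simp add: odd_root_def norm_mult norm_sgn)
    moreover have "((\<lambda>w::complex. root n (norm w)) \<longlongrightarrow> 0) (at 0)"
      using r assms True by (simp add: isCont_def)
    ultimately have "(odd_root n \<longlongrightarrow> 0) (at 0)"
      by (intro Lim_null_comparison[of "odd_root n" "\<lambda>w. root n (norm w)"]) auto
    then show ?thesis using True by (simp add: isCont_def odd_root_def)
  qed
qed

lemma norm_odd_root: "n > 0 \<Longrightarrow> norm (odd_root n z) = root n (norm z)"
  by (cases "z = 0") (simp_all add: odd_root_def norm_mult norm_sgn)

lemma odd_root_eq:
  assumes "n > 0"
  shows "odd_root n z * of_real (norm (odd_root n z) ^ (n - 1)) = z"
proof -
  have "odd_root n z * of_real (norm (odd_root n z) ^ (n - 1))
      = sgn z * of_real (root n (norm z) * root n (norm z) ^ (n - 1))"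
    using assms by (simp add: norm_odd_root) (simp add: odd_root_def mult.assoc)
  also have "root n (norm z) * root n (norm z) ^ (n - 1) = root n (norm z) ^ n"
    using power_minus_mult[OF assms, of "root n (norm z)"] by (simp add: mult.commute)
  also have "\<dots> = norm z" using assms by (rule real_root_pow_pos2) simp
  finally show ?thesis by (cases "z = 0") (simp_all add: sgn_eq)
qed

section \<open>Norm control for purely algebraic automorphisms\<close>

context hausdorff_etale_groupoid
begin

definition redc_automorphism :: "(('g \<Rightarrow> complex) \<Rightarrow> 'g \<Rightarrow> complex) \<Rightarrow> bool" where
  "redc_automorphism \<phi> \<longleftrightarrow> bij_betw \<phi> redc redc \<and>
     (\<forall>a\<in>redc. \<forall>b\<in>redc. \<phi> (\<lambda>\<gamma>. a \<gamma> + b \<gamma>) = (\<lambda>\<gamma>. \<phi> a \<gamma> + \<phi> b \<gamma>)) \<and>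
     (\<forall>c. \<forall>a\<in>redc. \<phi> (\<lambda>\<gamma>. c * a \<gamma>) = (\<lambda>\<gamma>. c * \<phi> a \<gamma>)) \<and>
     (\<forall>a\<in>redc. \<forall>b\<in>redc. \<phi> (convolution G a b) = convolution G (\<phi> a) (\<phi> b)) \<and>
     (\<forall>a\<in>redc. \<phi> (involution G a) = involution G (\<phi> a))"

lemma redc_automorphismD:
  assumes "redc_automorphism \<phi>"
  shows "bij_betw \<phi> redc redc" "a \<in> redc \<Longrightarrow> \<phi> a \<in> redc"
    "\<lbrakk>a \<in> redc; b \<in> redc\<rbrakk> \<Longrightarrow> \<phi> (\<lambda>\<gamma>. a \<gamma> + b \<gamma>) = (\<lambda>\<gamma>. \<phi> a \<gamma> + \<phi> b \<gamma>)"
    "a \<in> redc \<Longrightarrow> \<phi> (\<lambda>\<gamma>. c * a \<gamma>) = (\<lambda>\<gamma>. c * \<phi> a \<gamma>)"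
    "\<lbrakk>a \<in> redc; b \<in> redc\<rbrakk> \<Longrightarrow> \<phi> (convolution G a b) = convolution G (\<phi> a) (\<phi> b)"
    "a \<in> redc \<Longrightarrow> \<phi> (involution G a) = involution G (\<phi> a)"
  using assms bij_betwE[of \<phi> redc redc] unfolding redc_automorphism_def by blast+

lemma redc_automorphism_diff:
  assumes "redc_automorphism \<phi>" "a \<in> redc" "b \<in> redc"
  shows "\<phi> (\<lambda>\<gamma>. a \<gamma> - b \<gamma>) = (\<lambda>\<gamma>. \<phi> a \<gamma> - \<phi> b \<gamma>)"
  using redc_automorphismD(3)[OF assms(1,2), of "\<lambda>\<gamma>. (-1) * b \<gamma>"]
    redc_automorphismD(4)[OF assms(1,3), of "-1"] redc_scale[OF assms(3), of "-1"] by simp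

lemma redc_automorphism_zero:
  assumes "redc_automorphism \<phi>"
  shows "\<phi> (\<lambda>_. 0) = (\<lambda>_. 0)"
  using redc_automorphismD(4)[OF assms redc_zero, of 0] by simp

lemma redc_automorphism_sum:
  assumes "redc_automorphism \<phi>" "finite I" "\<And>i. i \<in> I \<Longrightarrow> f i \<in> redc"
  shows "\<phi> (\<lambda>\<gamma>. \<Sum>i\<in>I. f i \<gamma>) = (\<lambda>\<gamma>. \<Sum>i\<in>I. \<phi> (f i) \<gamma>)"
  using assms(2,3)
proof (induction I rule: finite_induct)
  case empty then show ?case using redc_automorphism_zero[OF assms(1)] by simp
next
  case (insert i I)
  have "(\<lambda>\<gamma>. \<Sum>i\<in>I. f i \<gamma>) \<in> redc" by (rule redc_sum) (use insert in auto)
  then show ?case using insert redc_automorphismD(3)[OF assms(1), of "f i" "\<lambda>\<gamma>. \<Sum>i\<in>I. f i \<gamma>"] by simp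
qed

text \<open>Solves \<open>(1 - s)^2 = 1 - b\<close> without a unit, as the fixed point of
  \<open>s = (b + s^2) / 2\<close> iterated from 0. For \<open>b\<close> of norm at most 1/4 this
  map preserves the ball of radius 1/4 and contracts it by the factor 1/4.\<close>

lemma redc_square_root:
  assumes b: "b \<in> redc" "opb b (1/4)" "involution G b = b"
  obtains s where "s \<in> redc" "involution G s = s" "\<And>\<gamma>. b \<gamma> = 2 * s \<gamma> - convolution G s s \<gamma>"
proof -
  define x where "x = rec_nat (\<lambda>_. 0) (\<lambda>_ t \<gamma>. (1/2) * (b \<gamma> + convolution G t t \<gamma>))"
  have x0: "x 0 = (\<lambda>_. 0)" and xS: "x (Suc n) = (\<lambda>\<gamma>. (1/2) * (b \<gamma> + convolution G (x n) (x n) \<gamma>))" for n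
    by (simp_all add: x_def)
  have xr: "x n \<in> redc" for n
    by (induction n) (simp_all only: x0 xS redc_zero redc_scale redc_add redc_convolution b)
  have xb: "opb (x n) (1/4)" for n
  proof (induction n)
    case 0 then show ?case using opb_mono[OF opb_zero, of "1/4"] by (simp add: x0)
  next
    case (Suc n)
    have "opb (x (Suc n)) (norm (1/2::complex) * (1/4 + 1/4 * (1/4)))"
      unfolding xS by (intro opb_scale opb_add opb_convolution b Suc)
    then show ?case by (rule opb_mono) simp
  qed
  have xi: "involution G (x n) = x n" for n
  proof (induction n)
    case 0 show ?case by (auto simp: x0 involution_def)
  next
    case (Suc n)
    have "involution G (x (Suc n)) = (\<lambda>\<gamma>. (1/2) * (involution G b \<gamma> + involution G (convolution G (x n) (x n)) \<gamma>))"
      by (auto simp: xS involution_def)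
    then show ?case using Suc b(3) by (simp add: involution_convolution xS)
  qed
  have step: "opb (\<lambda>\<gamma>. x (Suc m) \<gamma> - x (Suc n) \<gamma>) (d/4)" if "opb (\<lambda>\<gamma>. x m \<gamma> - x n \<gamma>) d" for m n d
  proof -
    have "opb (\<lambda>\<gamma>. (1/2) * (convolution G (x m) (x m) \<gamma> - convolution G (x n) (x n) \<gamma>)) (norm (1/2::complex) * (d * (1/4) + 1/4 * d))"
      by (intro opb_scale convolution_diff_opb xb that)
    moreover have "norm (1/2::complex) * (d * (1/4) + 1/4 * d) = d / 4" by simp
    ultimately show ?thesis unfolding xS by (simp add: algebra_simps)
  qed
  \<comment> \<open>The distance is at most 1 for \<open>n = 0\<close>, and advancing both indices
    by one divides it by 4.\<close>
  have geo: "opb (\<lambda>\<gamma>. x (n + k) \<gamma> - x n \<gamma>) ((1/4) ^ n)" for n k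
  proof (induction n)
    case 0 show ?case using opb_mono[OF xb, of 1 k] by (simp add: x0)
  next
    case (Suc n) show ?case using step[OF Suc] by simp
  qed
  have cauchy: "\<exists>N. \<forall>m\<ge>N. \<forall>n\<ge>N. opb (\<lambda>\<gamma>. x m \<gamma> - x n \<gamma>) e" if e: "e > 0" for e
  proof -
    have "e / 2 > 0" using e by simp
    then obtain N where N: "(1/4::real) ^ N < e / 2" using real_arch_pow_inv[of "e/2" "1/4"] by auto
    have "opb (\<lambda>\<gamma>. x m \<gamma> - x n \<gamma>) e" if mn: "m \<ge> N" "n \<ge> N" for m n
    proof -
      have "opb (\<lambda>\<gamma>. (x (N + (m - N)) \<gamma> - x N \<gamma>) - (x (N + (n - N)) \<gamma> - x N \<gamma>)) ((1/4) ^ N + (1/4) ^ N)"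
        by (intro opb_diff geo)
      then have "opb (\<lambda>\<gamma>. x m \<gamma> - x n \<gamma>) ((1/4) ^ N + (1/4) ^ N)" using mn by simp
      then show ?thesis by (rule opb_mono) (use N in simp)
    qed
    then show ?thesis by blast
  qed
  obtain s where s: "s \<in> redc" "\<And>e. e > 0 \<Longrightarrow> \<exists>N. \<forall>n\<ge>N. opb (\<lambda>\<gamma>. s \<gamma> - x n \<gamma>) e"
    "\<And>\<gamma>. (\<lambda>n. x n \<gamma>) \<longlonglongrightarrow> s \<gamma>" using redc_complete[OF xr cauchy] by metis
  have sb: "opb s (1/4)" by (rule opb_lim[OF xb s(3)])
  have "involution G s \<gamma> = s \<gamma>" for \<gamma>
  proof (cases "\<gamma> \<in> arrows G")
    case True
    have "(\<lambda>n. cnj (x n (ginv G \<gamma>))) \<longlonglongrightarrow> cnj (s (ginv G \<gamma>))" by (rule tendsto_cnj[OF s(3)])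
    moreover have "cnj (x n (ginv G \<gamma>)) = x n \<gamma>" for n using fun_cong[OF xi, of n \<gamma>] True by (simp add: involution_def)
    ultimately show ?thesis using s(3)[of \<gamma>] LIMSEQ_unique True by (simp add: involution_def) 
  qed (simp add: involution_outside redc_outside[OF s(1)])
  then have si: "involution G s = s" by auto
  have cl: "(\<lambda>n. convolution G (x n) (x n) \<gamma>) \<longlonglongrightarrow> convolution G s s \<gamma>" for \<gamma>
  proof (cases "\<gamma> \<in> arrows G")
    case True
    show ?thesis
    proof (rule LIMSEQ_I)
      fix e :: real assume e: "e > 0"
      obtain N where N: "\<forall>n\<ge>N. opb (\<lambda>\<gamma>. s \<gamma> - x n \<gamma>) e" using s(2)[OF e] by blast
      have "norm (convolution G (x n) (x n) \<gamma> - convolution G s s \<gamma>) < e" if "n \<ge> N" for n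
      proof -
        have "opb (\<lambda>\<gamma>. convolution G s s \<gamma> - convolution G (x n) (x n) \<gamma>) (e * (1/4) + 1/4 * e)"
          using N that by (intro convolution_diff_opb xb sb) auto
        then have "norm (convolution G s s \<gamma> - convolution G (x n) (x n) \<gamma>) \<le> e * (1/4) + 1/4 * e"
          by (rule opb_pointwise[OF _ True])
        then show ?thesis using e by (simp add: norm_minus_commute)
      qed
      then show "\<exists>N. \<forall>n\<ge>N. norm (convolution G (x n) (x n) \<gamma> - convolution G s s \<gamma>) < e" by blast
    qed
  qed (simp add: convolution_outside)
  have "b \<gamma> = 2 * s \<gamma> - convolution G s s \<gamma>" for \<gamma>
  proof -
    have "(\<lambda>n. x (Suc n) \<gamma>) \<longlonglongrightarrow> (1/2) * (b \<gamma> + convolution G s s \<gamma>)"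
      unfolding xS by (intro tendsto_intros cl)
    moreover have "(\<lambda>n. x (Suc n) \<gamma>) \<longlonglongrightarrow> s \<gamma>" using s(3) by (rule LIMSEQ_Suc)
    ultimately have "s \<gamma> = (1/2) * (b \<gamma> + convolution G s s \<gamma>)" by (rule LIMSEQ_unique[rotated])
    then show ?thesis by (simp add: field_simps)
  qed
  then show ?thesis using that s(1) si by blast
qed

text \<open>The relation \<open>f* f = 2 s - s^2\<close> is algebraic, so it survives \<phi>, and
  \<open>opb_one_if_square_root\<close> converts it back into a norm bound. The factor 2 is the
  price of scaling \<open>a\<close> to norm 1/2, which puts \<open>f* f\<close> within the radius
  1/4 of \<open>redc_square_root\<close>.\<close>

lemma redc_automorphism_bounded:
  assumes \<phi>: "redc_automorphism \<phi>" and a: "a \<in> redc" "opb a e" and e: "e > 0"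
  shows "opb (\<phi> a) (2 * e)"
proof -
  note D = redc_automorphismD[OF \<phi>]
  define c where "c = complex_of_real (1 / (2 * e))"
  define f where "f = (\<lambda>\<gamma>. c * a \<gamma>)"
  have f: "f \<in> redc" using a by (simp add: f_def)
  have fb: "opb f (1/2)"
    using opb_scale[OF a(2), of c] e unfolding f_def by (simp add: c_def norm_divide norm_mult)
  let ?b = "convolution G (involution G f) f"
  have "opb ?b (1/4)" using opb_convolution[OF opb_involution[OF fb] fb] by simp
  moreover have "involution G ?b = ?b"
    by (simp add: involution_convolution involution_involution redc_outside[OF f])
  ultimately obtain s where s: "s \<in> redc" "involution G s = s" "\<And>\<gamma>. ?b \<gamma> = 2 * s \<gamma> - convolution G s s \<gamma>"
    using redc_square_root[of ?b] f by auto
  have b: "?b = (\<lambda>\<gamma>. 2 * s \<gamma> - convolution G s s \<gamma>)" using s(3) by auto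
  have "convolution G (involution G (\<phi> f)) (\<phi> f) = \<phi> ?b" using D(5,6) f by simp
  also have "\<dots> = (\<lambda>\<gamma>. 2 * \<phi> s \<gamma> - convolution G (\<phi> s) (\<phi> s) \<gamma>)"
    unfolding b using s(1) by (simp add: redc_automorphism_diff[OF \<phi>] D)
  finally have eq: "convolution G (involution G (\<phi> f)) (\<phi> f) \<gamma> = 2 * \<phi> s \<gamma> - convolution G (\<phi> s) (\<phi> s) \<gamma>" for \<gamma> by simp
  obtain C where C: "opb (\<phi> f) C" using redc_opb D(2) f by blast
  obtain E where E: "opb (\<phi> s) E" using redc_opb D(2) s(1) by blast
  have "involution G (\<phi> s) = \<phi> s" using D(6)[OF s(1)] s(2) by simp
  then have 1: "opb (\<phi> f) 1" using opb_one_if_square_root[OF C E _ eq] by simp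
  have "\<phi> f = (\<lambda>\<gamma>. c * \<phi> a \<gamma>)" unfolding f_def by (rule D(4)[OF a(1)])
  then have "\<phi> a = (\<lambda>\<gamma>. complex_of_real (2 * e) * \<phi> f \<gamma>)" using e by (simp add: c_def)
  then show ?thesis using opb_scale[OF 1, of "complex_of_real (2 * e)"] e by simp
qed

text \<open>Finite sums carry equality to \<open>C_c\<close>. Boundedness of both automorphisms,
  each contributing an error \<open>2 * e\<close>, carries it to limits.\<close>

lemma redc_automorphism_eqI:
  assumes \<phi>: "redc_automorphism \<phi>" and \<psi>: "redc_automorphism \<psi>"
    and eq: "\<And>n. n \<in> bisection_functions \<Longrightarrow> \<phi> n = \<psi> n" and a: "a \<in> redc"
  shows "\<phi> a = \<psi> a"
proof -
  have Cc: "\<phi> f = \<psi> f" if f: "f \<in> C_c (gtop G)" for f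
  proof -
    obtain I :: "'g set" and g where I: "finite I" "\<And>i. i \<in> I \<Longrightarrow> g i \<in> bisection_functions"
      "\<And>\<gamma>. f \<gamma> = (\<Sum>i\<in>I. g i \<gamma>)" using C_c_partition[OF f] by blast
    have f: "f = (\<lambda>\<gamma>. \<Sum>i\<in>I. g i \<gamma>)" using I(3) by auto
    have g: "\<And>i. i \<in> I \<Longrightarrow> g i \<in> redc" using I(2) bisection_functions_C_c C_c_redc by blast
    have "\<phi> f = (\<lambda>\<gamma>. \<Sum>i\<in>I. \<phi> (g i) \<gamma>)"
      unfolding f by (rule redc_automorphism_sum[OF \<phi> I(1)]) (rule g)
    also have "\<dots> = (\<lambda>\<gamma>. \<Sum>i\<in>I. \<psi> (g i) \<gamma>)" using eq[OF I(2)] by simp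
    also have "\<dots> = \<psi> f"
      unfolding f by (rule redc_automorphism_sum[symmetric, OF \<psi> I(1)]) (rule g)
    finally show ?thesis .
  qed
  show ?thesis
  proof
    fix \<gamma>
    show "\<phi> a \<gamma> = \<psi> a \<gamma>"
    proof (cases "\<gamma> \<in> arrows G")
      case True
      have "norm (\<phi> a \<gamma> - \<psi> a \<gamma>) \<le> 4 * e" if e: "e > 0" for e
      proof -
        obtain f where f: "f \<in> C_c (gtop G)" "opb (\<lambda>\<gamma>. a \<gamma> - f \<gamma>) e" using redc_approx[OF a e] by blast
        have r: "f \<in> redc" using f C_c_redc by blast
        have 1: "norm (\<phi> a \<gamma> - \<phi> f \<gamma>) \<le> 2 * e"
          using opb_pointwise[OF redc_automorphism_bounded[OF \<phi> redc_diff[OF a r] f(2) e] True]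
          by (simp add: redc_automorphism_diff[OF \<phi> a r])
        have 2: "norm (\<psi> a \<gamma> - \<psi> f \<gamma>) \<le> 2 * e"
          using opb_pointwise[OF redc_automorphism_bounded[OF \<psi> redc_diff[OF a r] f(2) e] True]
          by (simp add: redc_automorphism_diff[OF \<psi> a r])
        have "\<phi> a \<gamma> - \<psi> a \<gamma> = (\<phi> a \<gamma> - \<phi> f \<gamma>) - (\<psi> a \<gamma> - \<psi> f \<gamma>)" using Cc[OF f(1)] by simp
        then show ?thesis using norm_triangle_ineq4[of "\<phi> a \<gamma> - \<phi> f \<gamma>" "\<psi> a \<gamma> - \<psi> f \<gamma>"] 1 2 by simp
      qed
      then have "norm (\<phi> a \<gamma> - \<psi> a \<gamma>) \<le> 0" by (rule le_zero_if_le_mult[rotated]) simp_all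
      then show ?thesis by simp
    next
      case False
      then show ?thesis using redc_automorphismD(2)[OF \<phi> a] redc_automorphismD(2)[OF \<psi> a] redc_outside by metis
    qed
  qed
qed

text \<open>A nonzero term at \<gamma> needs \<open>\<beta>^-1\<close> and
  \<open>\<beta>^-1 \<gamma>\<close> in the bisection. They have the same range, so they coincide
  and \<gamma> is a unit. At the source of a bisection arrow, that arrow alone contributes.\<close>

lemma bisection_inner_product:
  assumes U: "bisection U" and f: "\<And>\<gamma>. \<gamma> \<notin> U \<Longrightarrow> f \<gamma> = 0" and g: "\<And>\<gamma>. \<gamma> \<notin> U \<Longrightarrow> g \<gamma> = 0"
  shows "\<gamma> \<notin> units G \<Longrightarrow> convolution G (involution G f) g \<gamma> = 0"
    and "\<gamma> \<in> U \<Longrightarrow> convolution G (involution G f) g (gdom G \<gamma>) = cnj (f \<gamma>) * g \<gamma>"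
proof -
  show "convolution G (involution G f) g \<gamma> = 0" if n: "\<gamma> \<notin> units G"
  proof (rule ccontr)
    assume "convolution G (involution G f) g \<gamma> \<noteq> 0"
    then obtain \<beta> where b: "\<gamma> \<in> arrows G" "\<beta> \<in> arrows G" "gran G \<beta> = gran G \<gamma>" "involution G f \<beta> \<noteq> 0"
      "g (gmult G (ginv G \<beta>) \<gamma>) \<noteq> 0" by (rule convolution_nonzeroD)
    have i: "ginv G \<beta> \<in> U" using b(2,4) f by (auto simp: involution_def)
    moreover have j: "gmult G (ginv G \<beta>) \<gamma> \<in> U" using b(5) g by blast
    moreover have "gran G (ginv G \<beta>) = gran G (gmult G (ginv G \<beta>) \<gamma>)"
      using b by (simp add: ran_mult inv_closed dom_inv)
    ultimately have eq: "gmult G (ginv G \<beta>) \<gamma> = ginv G \<beta>" using bisectionD(4)[OF U] by metis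
    have u: "gran G \<beta> \<in> units G" using b ran_in_units by simp
    have "\<gamma> = gran G \<beta>"
    proof (rule mult_cancel_left[of "ginv G \<beta>"])
      show "gmult G (ginv G \<beta>) \<gamma> = gmult G (ginv G \<beta>) (gran G \<beta>)"
        using b u by (simp add: eq mult_unit_right inv_closed dom_inv)
    qed (use b u unitsD in \<open>simp_all add: inv_closed dom_inv ran_ran ran_closed\<close>)
    then show False using u n by simp
  qed
  show "convolution G (involution G f) g (gdom G \<gamma>) = cnj (f \<gamma>) * g \<gamma>" if c: "\<gamma> \<in> U"
  proof -
    let ?x = "gdom G \<gamma>"
    have ga: "\<gamma> \<in> arrows G" using c bisectionD(2)[OF U] by blast
    have x: "?x \<in> source_fibre G ?x" using ga dom_in_units unit_in_source_fibre by simp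
    note gS = in_fibre[OF ga]
    have "convolution G (involution G f) g ?x = apply_kernel (source_fibre G ?x) (kern (involution G f)) g ?x"
      by (rule convolution_eq_apply[OF x])
    also have "\<dots> = (\<Sum>\<kappa>\<in>{\<gamma>}. kern (involution G f) ?x \<kappa> * g \<kappa>)"
    proof (rule apply_kernel_finite)
      fix \<kappa> assume k: "\<kappa> \<in> source_fibre G ?x - {\<gamma>}"
      then have "\<kappa> \<notin> U" using bisectionD(3)[OF U _ c, of \<kappa>] by (auto simp: source_fibre_def)
      then show "g \<kappa> = 0" using g by blast
    qed (use gS in auto)
    also have "\<dots> = cnj (f \<gamma>) * g \<gamma>" by (simp add: kern_involution[OF x gS] kern_unit[OF gS])
    finally show ?thesis .
  qed
qed

section \<open>Factorization over bisections and the cocycle of an automorphism\<close>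

lemma bisection_function_root:
  assumes "f \<in> bisection_functions" "n > 0"
  shows "(\<lambda>\<gamma>. odd_root n (f \<gamma>)) \<in> bisection_functions"
proof -
  have "continuous_map (gtop G) euclidean (\<lambda>\<gamma>. odd_root n (f \<gamma>))"
    by (rule continuous_map_compose_continuous_on[OF _ continuous_odd_root[OF assms(2)]])
       (use assms(1) in \<open>simp add: bisection_functions_def\<close>)
  moreover have "odd_root n 0 = 0" by (simp add: odd_root_def)
  ultimately show ?thesis using assms(1) unfolding bisection_functions_def mem_Collect_eq by metis
qed

text \<open>Every function supported on a bisection factors as \<open>q h\<^sup>k\<close> with \<open>h = q* q\<close>, which lies
  in \<open>C0\<close>.\<close>

lemma bisection_function_factor:
  assumes "f \<in> bisection_functions"
  obtains q U where "q \<in> bisection_functions" "bisection U" "\<forall>\<gamma>. \<gamma> \<notin> U \<longrightarrow> q \<gamma> = 0"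
    "convolution G (involution G q) q \<in> C0"
    "\<forall>\<gamma>. f \<gamma> = q \<gamma> * convolution G (involution G q) q (gdom G \<gamma>) ^ k"
proof -
  obtain K U where K: "bisection U" "K \<subseteq> U" "\<forall>\<gamma>. \<gamma> \<notin> K \<longrightarrow> f \<gamma> = 0"
    using assms unfolding bisection_functions_def by blast
  \<comment> \<open>Then \<open>n - 1 = 2 * k\<close>, so the modulus power left over by the root is
    the \<open>k\<close>-th power of \<open>q* q\<close>.\<close>
  define n where "n = 2 * k + 1"
  have n: "n > 0" by (simp add: n_def)
  define q where "q = (\<lambda>\<gamma>. odd_root n (f \<gamma>))"
  have q: "q \<in> bisection_functions" unfolding q_def by (rule bisection_function_root[OF assms n])
  have qU: "q \<gamma> = 0" if "\<gamma> \<notin> U" for \<gamma> using that K(2,3) by (auto simp: q_def odd_root_def)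
  let ?h = "convolution G (involution G q) q"
  have ip: "\<gamma> \<notin> units G \<Longrightarrow> ?h \<gamma> = 0" "\<gamma> \<in> U \<Longrightarrow> ?h (gdom G \<gamma>) = cnj (q \<gamma>) * q \<gamma>" for \<gamma>
    using bisection_inner_product[of U q q, OF K(1)] qU by simp_all
  have "q \<in> redc" using q bisection_functions_C_c C_c_redc by blast
  then have h: "?h \<in> C0" using ip(1) by (simp add: C0_iff)
  have "f \<gamma> = q \<gamma> * ?h (gdom G \<gamma>) ^ k" for \<gamma>
  proof (cases "\<gamma> \<in> U")
    case True
    have "?h (gdom G \<gamma>) = of_real ((norm (q \<gamma>))\<^sup>2)"
      using ip(2)[OF True] complex_norm_square[of "q \<gamma>"] by (simp add: mult.commute)
    then have "q \<gamma> * ?h (gdom G \<gamma>) ^ k = q \<gamma> * of_real (norm (q \<gamma>) ^ (n - 1))"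
      by (simp add: n_def power_mult)
    also have "\<dots> = f \<gamma>" unfolding q_def by (rule odd_root_eq[OF n])
    finally show ?thesis by simp
  next
    case False then show ?thesis using K(2,3) qU by auto
  qed
  then show ?thesis using that[OF q K(1) _ h] qU by simp
qed

lemma bisection_functions_redc: "f \<in> bisection_functions \<Longrightarrow> f \<in> redc"
  using bisection_functions_C_c C_c_redc by blast

text \<open>For \<open>m = q h\<close> and \<open>v = q* k q\<close> one has \<open>m* k = v q*\<close> and \<open>m v = k q h\<^sup>2\<close>, which moves
  \<open>k\<close> past \<open>\<phi>(m) m*\<close>.\<close>

lemma automorphism_cocycle_in_C0:
  assumes "effective G" and \<phi>: "redc_automorphism \<phi>" and fixed: "\<And>k. k \<in> C0 \<Longrightarrow> \<phi> k = k"
    and m: "m \<in> bisection_functions"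
  shows "convolution G (\<phi> m) (involution G m) \<in> C0"
proof (rule C0_commutant[OF assms(1)])
  note D = redc_automorphismD[OF \<phi>]
  have mr: "m \<in> redc" by (rule bisection_functions_redc[OF m])
  show "convolution G (\<phi> m) (involution G m) \<in> redc" using mr D(2) by simp
  fix k assume k: "k \<in> C0"
  obtain q U where q': "q \<in> bisection_functions" "bisection U" "\<forall>\<gamma>. \<gamma> \<notin> U \<longrightarrow> q \<gamma> = 0"
    "convolution G (involution G q) q \<in> C0"
    "\<forall>\<gamma>. m \<gamma> = q \<gamma> * convolution G (involution G q) q (gdom G \<gamma>) ^ 1"
    by (rule bisection_function_factor[OF m])
  then have q: "q \<in> bisection_functions" "bisection U" "\<And>\<gamma>. \<gamma> \<notin> U \<Longrightarrow> q \<gamma> = 0"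
    "convolution G (involution G q) q \<in> C0"
    "\<And>\<gamma>. m \<gamma> = q \<gamma> * convolution G (involution G q) q (gdom G \<gamma>) ^ 1" by simp_all
  define h where "h = convolution G (involution G q) q"
  \<comment> \<open>\<open>v\<close> transports \<open>k\<close> from ranges to sources along the
    bisection. The bare transport need not extend continuously beyond the bisection; the factor
    \<open>h\<close> that it carries damps it into \<open>C0\<close>.\<close>
  define v where "v = convolution G (involution G q) (convolution G k q)"
  have qr: "q \<in> redc" by (rule bisection_functions_redc[OF q(1)])
  have h: "h \<in> C0" using q(4) by (simp add: h_def)
  have UA: "U \<subseteq> arrows G" by (rule bisectionD(2)[OF q(2)])
  have kq: "convolution G k q \<gamma> = 0" if "\<gamma> \<notin> U" for \<gamma>
    using that q(3) k by (cases "\<gamma> \<in> arrows G") (simp_all add: C0_convolution_left convolution_outside)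
  have v: "v \<in> C0"
    unfolding v_def C0_iff using bisection_inner_product(1)[of U q "convolution G k q", OF q(2)] q(3) kq k qr by simp
  have vd: "v (gdom G \<gamma>) = k (gran G \<gamma>) * h (gdom G \<gamma>)" if "\<gamma> \<in> U" for \<gamma>
    using bisection_inner_product(2)[of U q "convolution G k q" \<gamma>, OF q(2)]
      bisection_inner_product(2)[of U q q \<gamma>, OF q(2)] q(3) kq UA that k
    by (auto simp: v_def h_def C0_convolution_left)
  have mqh: "m = convolution G q h"
  proof
    fix \<gamma> show "m \<gamma> = convolution G q h \<gamma>"
      using q(5)[of \<gamma>] h redc_outside[OF mr, of \<gamma>]
      by (cases "\<gamma> \<in> arrows G") (simp_all add: C0_convolution_right h_def convolution_outside)
  qed
  have hreal: "involution G h = h"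
    by (simp add: h_def involution_convolution involution_involution redc_outside[OF qr])
  have ms: "involution G m = convolution G h (involution G q)"
    unfolding mqh by (simp add: involution_convolution hreal)
  have A: "convolution G (involution G m) k = convolution G v (involution G q)"
  proof
    fix \<gamma>
    show "convolution G (involution G m) k \<gamma> = convolution G v (involution G q) \<gamma>"
    proof (cases "\<gamma> \<in> arrows G \<and> ginv G \<gamma> \<in> U")
      case True
      then have g: "\<gamma> \<in> arrows G" "ginv G \<gamma> \<in> U" by auto
      have "v (gran G \<gamma>) = k (gdom G \<gamma>) * h (gran G \<gamma>)"
        using vd[OF g(2)] g(1) by (simp add: dom_inv ran_inv)
      then show ?thesis using g k v h
        by (simp add: C0_convolution_right C0_convolution_left ms)
    next
      case False
      then show ?thesis using k v h q(3)
        by (cases "\<gamma> \<in> arrows G") (simp_all add: C0_convolution_right C0_convolution_left ms convolution_outside involution_def)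
    qed
  qed
  have B: "convolution G m v = convolution G k (convolution G m h)"
  proof
    fix \<gamma>
    show "convolution G m v \<gamma> = convolution G k (convolution G m h) \<gamma>"
    proof (cases "\<gamma> \<in> U")
      case True
      then show ?thesis using UA vd[OF True] v h k by (auto simp: C0_convolution_right C0_convolution_left)
    next
      case False
      then have "m \<gamma> = 0" using q(3,5) by simp
      then show ?thesis using v h k
        by (cases "\<gamma> \<in> arrows G") (simp_all add: C0_convolution_right C0_convolution_left convolution_outside)
    qed
  qed
  note r = mr qr k v h D(2)[OF mr]
  have "convolution G (convolution G (\<phi> m) (involution G m)) k = convolution G (\<phi> m) (convolution G v (involution G q))"
    using r A by (simp add: redc_convolution_assoc)
  also have "\<dots> = convolution G (\<phi> (convolution G m v)) (involution G q)"
    using r D(5)[of m v] fixed[OF v] by (simp add: redc_convolution_assoc)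
  also have "\<dots> = convolution G (convolution G k (convolution G (\<phi> m) h)) (involution G q)"
    using r fixed[OF k] fixed[OF h] by (simp add: B D(5))
  also have "\<dots> = convolution G k (convolution G (\<phi> m) (involution G m))"
    using r by (simp add: ms redc_convolution_assoc)
  finally show "convolution G k (convolution G (\<phi> m) (involution G m)) = convolution G (convolution G (\<phi> m) (involution G m)) k" by simp
qed

lemma redc_automorphism_compose:
  assumes "redc_automorphism \<phi>" "redc_automorphism \<psi>"
  shows "redc_automorphism (\<phi> \<circ> \<psi>)"
proof -
  note D = redc_automorphismD[OF assms(1)] and E = redc_automorphismD[OF assms(2)]
  show ?thesis unfolding redc_automorphism_def
  proof (intro conjI allI ballI)
    show "bij_betw (\<phi> \<circ> \<psi>) redc redc" by (rule bij_betw_trans[OF E(1) D(1)])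
  qed (simp_all add: D E)
qed

text \<open>Factor \<open>n = m h\<^sup>2\<close> with \<open>h = m* m\<close>, and put \<open>e\<^sub>i = \<phi>\<^sub>i(m) m* \<in> C0\<close>. Then
  \<open>\<phi>\<^sub>2(n) = e\<^sub>2 m h\<close> and \<open>\<phi>\<^sub>1(m h) = e\<^sub>1 m\<close>, so \<open>\<phi>\<^sub>1(\<phi>\<^sub>2(n)) = e\<^sub>2 e\<^sub>1 m\<close>, which is symmetric.\<close>

lemma automorphisms_fixing_C0_commute:
  assumes "effective G" and \<phi>: "redc_automorphism \<phi>" "\<And>k. k \<in> C0 \<Longrightarrow> \<phi> k = k"
    and \<psi>: "redc_automorphism \<psi>" "\<And>k. k \<in> C0 \<Longrightarrow> \<psi> k = k" and a: "a \<in> redc"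
  shows "\<phi> (\<psi> a) = \<psi> (\<phi> a)"
proof -
  have "(\<phi> \<circ> \<psi>) a = (\<psi> \<circ> \<phi>) a"
  proof (rule redc_automorphism_eqI[OF _ _ _ a])
    fix n assume n: "n \<in> bisection_functions"
    \<comment> \<open>Exponent 2, because each of the two automorphisms uses up one factor
      \<open>h = m* m\<close> to turn its image of \<open>m\<close> into a cocycle times
      \<open>m\<close>.\<close>
    obtain m U where m': "m \<in> bisection_functions" "bisection U" "\<forall>\<gamma>. \<gamma> \<notin> U \<longrightarrow> m \<gamma> = 0"
      "convolution G (involution G m) m \<in> C0"
      "\<forall>\<gamma>. n \<gamma> = m \<gamma> * convolution G (involution G m) m (gdom G \<gamma>) ^ 2"
      by (rule bisection_function_factor[OF n])
    then have m: "m \<in> bisection_functions" "convolution G (involution G m) m \<in> C0"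
      "\<And>\<gamma>. n \<gamma> = m \<gamma> * convolution G (involution G m) m (gdom G \<gamma>) ^ 2" by simp_all
    define h where "h = convolution G (involution G m) m"
    have h: "h \<in> C0" using m(2) by (simp add: h_def)
    have mr: "m \<in> redc" by (rule bisection_functions_redc[OF m(1)])
    have n_eq: "n = convolution G (convolution G m h) h"
    proof
      fix \<gamma> show "n \<gamma> = convolution G (convolution G m h) h \<gamma>"
        using m(3)[of \<gamma>] h redc_outside[OF bisection_functions_redc[OF n], of \<gamma>]
        by (cases "\<gamma> \<in> arrows G") (simp_all add: C0_convolution_right h_def convolution_outside power2_eq_square)
    qed
    have key: "\<phi> (\<psi> n) = convolution G (convolution G (\<psi> m) (involution G m)) (convolution G (convolution G (\<phi> m) (involution G m)) m)"
      if \<phi>: "redc_automorphism \<phi>" "\<And>k. k \<in> C0 \<Longrightarrow> \<phi> k = k"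
      and \<psi>: "redc_automorphism \<psi>" "\<And>k. k \<in> C0 \<Longrightarrow> \<psi> k = k" for \<phi> \<psi>
    proof -
      note D = redc_automorphismD[OF \<phi>(1)] and E = redc_automorphismD[OF \<psi>(1)]
      let ?e = "convolution G (\<psi> m) (involution G m)"
      have e: "?e \<in> C0" by (rule automorphism_cocycle_in_C0[OF assms(1) \<psi> m(1)])
      have r: "m \<in> redc" "h \<in> redc" "\<psi> m \<in> redc" "\<phi> m \<in> redc" "?e \<in> redc" using mr h D(2) E(2) e by simp_all
      have "\<psi> n = convolution G (convolution G (\<psi> m) h) h" using r E(5) \<psi>(2)[OF h] by (simp add: n_eq)
      also have "\<dots> = convolution G ?e (convolution G m h)" using r by (simp add: h_def redc_convolution_assoc)
      finally have "\<phi> (\<psi> n) = convolution G ?e (convolution G (\<phi> m) h)"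
        using r D(5) \<phi>(2)[OF h] \<phi>(2)[OF e] by simp
      also have "\<dots> = convolution G ?e (convolution G (convolution G (\<phi> m) (involution G m)) m)"
        using r by (simp add: h_def redc_convolution_assoc)
      finally show ?thesis .
    qed
    let ?e = "convolution G (\<psi> m) (involution G m)" and ?f = "convolution G (\<phi> m) (involution G m)"
    have e: "?e \<in> C0" by (rule automorphism_cocycle_in_C0[OF assms(1) \<psi> m(1)])
    have f: "?f \<in> C0" by (rule automorphism_cocycle_in_C0[OF assms(1) \<phi> m(1)])
    have "convolution G ?e (convolution G ?f m) = convolution G (convolution G ?e ?f) m"
      by (rule redc_convolution_assoc[symmetric, OF C0_redc[OF e] C0_redc[OF f] mr])
    also have "convolution G ?e ?f = convolution G ?f ?e" by (simp add: C0_convolution[OF e f] C0_convolution[OF f e] mult.commute)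
    also have "convolution G (convolution G ?f ?e) m = convolution G ?f (convolution G ?e m)"
      by (rule redc_convolution_assoc[OF C0_redc[OF f] C0_redc[OF e] mr])
    finally show "(\<phi> \<circ> \<psi>) n = (\<psi> \<circ> \<phi>) n" using key[OF \<phi> \<psi>] key[OF \<psi> \<phi>] by simp
  qed (intro redc_automorphism_compose \<phi> \<psi>)+
  then show ?thesis by simp
qed

end

section \<open>The centralizer\<close>

lemma C_0_compose:
  assumes X: "Hausdorff_space X" and f: "f \<in> C_0 X" and H: "continuous_on UNIV H" "\<And>z. norm (H z) \<le> c * norm z"
  shows "(\<lambda>x. H (f x)) \<in> C_0 X"
proof -
  have cont: "continuous_map X euclidean (\<lambda>x. H (f x))"
    by (rule continuous_map_compose_continuous_on[OF C_0E(1)[OF f] H(1)])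
  have H0: "H 0 = 0" using H(2)[of 0] by simp
  have "compactin X {x \<in> topspace X. e \<le> norm (H (f x))}" if e: "e > 0" for e
  proof -
    \<comment> \<open>The growth bound assigns to the level \<open>e\<close> of the composition the
      level \<open>e / C\<close> of \<open>f\<close>; this choice makes \<open>C\<close> positive
      for every \<open>c\<close>.\<close>
    define C where "C = \<bar>c\<bar> + 1"
    have C: "C > 0" "norm (H z) \<le> C * norm z" for z
    proof -
      show "C > 0" by (simp add: C_def add_nonneg_pos)
      have "c * norm z \<le> C * norm z" by (rule mult_right_mono) (simp_all add: C_def)
      then show "norm (H z) \<le> C * norm z" using H(2)[of z] by linarith
    qed
    have "compactin X {x \<in> topspace X. e / C \<le> norm (f x)}" by (rule C_0E(3)[OF f]) (use e C in simp)
    moreover have "{x \<in> topspace X. e \<le> norm (H (f x))} \<subseteq> {x \<in> topspace X. e / C \<le> norm (f x)}"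
    proof safe
      fix x assume "e \<le> norm (H (f x))"
      then have "e \<le> C * norm (f x)" using C(2)[of "f x"] by linarith
      then show "e / C \<le> norm (f x)" using C(1) by (simp add: pos_divide_le_eq mult.commute)
    qed
    moreover have "closedin X {x \<in> topspace X. norm (H (f x)) \<in> {e..}}"
      by (rule closedin_continuous_map_preimage[OF continuous_map_norm[OF cont]]) simp
    ultimately show ?thesis unfolding atLeast_iff by (rule closed_compactin)
  qed
  then show ?thesis using cont H0 C_0E(2)[OF f] by (simp add: C_0_def)
qed

text \<open>The Cayley transform \<open>(1 + i s) / (1 - i s)\<close> of
  \<open>s = t * Re z\<close>, minus 1, so that it vanishes at 0 and preserves \<open>C0\<close>.
  Taking the real part makes it continuous on the whole plane.\<close>

definition cayley :: "real \<Rightarrow> complex \<Rightarrow> complex" where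
  "cayley t z = 2 * \<i> * of_real (t * Re z) / (1 - \<i> * of_real (t * Re z))"

lemma cayley_denominator: "1 - \<i> * of_real s \<noteq> 0" "1 + \<i> * of_real s \<noteq> 0"
  by (auto simp: complex_eq_iff)

lemma one_plus_cayley: "1 + cayley t z = (1 + \<i> * of_real (t * Re z)) / (1 - \<i> * of_real (t * Re z))"
  unfolding cayley_def using cayley_denominator(1)[of "t * Re z"] by (simp add: field_simps)

lemma norm_one_plus_cayley: "norm (1 + cayley t z) = 1"
proof -
  have "1 + \<i> * of_real s = cnj (1 - \<i> * of_real s)" for s by simp
  then have "norm (1 + \<i> * of_real s) = norm (1 - \<i> * of_real s)" for s by (metis complex_mod_cnj)
  then show ?thesis using cayley_denominator(1)[of "t * Re z"] by (simp only: one_plus_cayley norm_divide) simp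
qed

text \<open>Replaces the quotient by a polynomial relation, which can be written with algebra
  operations and therefore carried over by automorphisms.\<close>

lemma cayley_equation: "cayley t z = 2 * \<i> * of_real (t * Re z) + \<i> * of_real (t * Re z) * cayley t z"
  unfolding cayley_def using cayley_denominator(1)[of "t * Re z"] by (simp add: field_simps)

lemma continuous_cayley: "continuous_on UNIV (cayley t)"
  unfolding cayley_def[abs_def] using cayley_denominator(1) by (intro continuous_intros) blast

lemma norm_cayley_le: "norm (cayley t z) \<le> (2 * \<bar>t\<bar>) * norm z"
proof -
  let ?s = "t * Re z"
  have "1 = Re (1 - \<i> * of_real ?s)" by simp
  also have "\<dots> \<le> norm (1 - \<i> * of_real ?s)" by (rule complex_Re_le_cmod)
  finally have n: "1 \<le> norm (1 - \<i> * of_real ?s)" .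
  have "norm (cayley t z) = 2 * \<bar>?s\<bar> / norm (1 - \<i> * of_real ?s)"
    unfolding cayley_def by (simp only: norm_divide norm_mult norm_of_real norm_ii) simp
  also have "\<dots> \<le> 2 * \<bar>?s\<bar> / 1" using n by (intro divide_left_mono) simp_all
  also have "\<dots> \<le> 2 * (\<bar>t\<bar> * norm z)"
    by (simp add: abs_mult mult_left_mono abs_Re_le_cmod)
  finally show ?thesis by simp
qed

text \<open>The imaginary part of \<open>(1 + itX)(1 - itY)(1 - itx)(1 + ity)\<close> is \<open>t e\<^sub>1 - t\<^sup>3 e\<^sub>3\<close>, with \<open>e\<^sub>1\<close> and
  \<open>e\<^sub>3\<close> the elementary symmetric polynomials of \<open>X, -Y, -x, y\<close>, so two values of \<open>t\<close> suffice.\<close>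

lemma cayley_product_eq:
  fixes X Y x y :: real
  assumes "\<And>t. (1 + cayley t (of_real X)) * cnj (1 + cayley t (of_real Y))
      = (1 + cayley t (of_real x)) * cnj (1 + cayley t (of_real y))"
  shows "X - x = Y - y"
proof -
  have cross: "a * c * f * h = b * d * e * g"
    if "a / b * (c / d) = e / f * (g / h)" "b \<noteq> 0" "d \<noteq> 0" "f \<noteq> 0" "h \<noteq> 0" for a b c d e f g h :: complex
    using that by (simp add: field_simps)
  have eq: "t * (X - Y - x + y) = t^3 * (- X * Y * (y - x) - x * y * (X - Y))" for t
  proof -
    let ?p = "\<lambda>s. 1 + \<i> * of_real (t * s)" and ?m = "\<lambda>s. 1 - \<i> * of_real (t * s)"
    have "?p X / ?m X * (?m Y / ?p Y) = ?p x / ?m x * (?m y / ?p y)"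
      using assms[of t] by (simp add: one_plus_cayley)
    then have "?p X * ?m Y * ?m x * ?p y = ?m X * ?p Y * ?p x * ?m y"
      by (rule cross) (rule cayley_denominator)+
    then have "Im (?p X * ?m Y * ?m x * ?p y) = Im (?m X * ?p Y * ?p x * ?m y)" by simp
    then show ?thesis by (simp add: algebra_simps power3_eq_cube)
  qed
  \<comment> \<open>With \<open>eq\<close> written as \<open>t * A = t^3 * B\<close>, the values 1
    and 2 give \<open>A = B\<close> and \<open>A = 4 * B\<close>, hence
    \<open>A = 0\<close>.\<close>
  from eq[of 1] eq[of 2] show ?thesis by simp
qed

section \<open>Conjugation by unitaries of the unitized diagonal\<close>

context hausdorff_etale_groupoid
begin

text \<open>Stands for the unitary \<open>1 + d\<close>, recorded through \<open>d\<close> because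
  the algebra need not have a unit.\<close>

definition quasi_unitary :: "('g \<Rightarrow> complex) \<Rightarrow> bool" where
  "quasi_unitary d \<longleftrightarrow> d \<in> C0 \<and> (\<forall>x. norm (1 + d x) = 1)"

text \<open>Conjugation by the unitary \<open>1 + d\<close> of the unitization.\<close>

definition Ad :: "('g \<Rightarrow> complex) \<Rightarrow> ('g \<Rightarrow> complex) \<Rightarrow> 'g \<Rightarrow> complex" where
  "Ad d a \<gamma> = (1 + d (gran G \<gamma>)) * cnj (1 + d (gdom G \<gamma>)) * a \<gamma>"

lemma quasi_unitary_mult_cnj:
  assumes "quasi_unitary d"
  shows "(1 + d x) * cnj (1 + d x) = 1"
  using assms complex_norm_square[of "1 + d x"] by (simp add: quasi_unitary_def)

text \<open>The source of a quotient is the range of its second arrow, so conjugation multiplies the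
  kernel on both sides by diagonal matrices with unimodular entries indexed by ranges.\<close>

lemma opb_Ad:
  assumes "quasi_unitary d" "opb f C"
  shows "opb (Ad d f) C"
proof -
  have "bounded_kernel (source_fibre G x) (kern (Ad d f)) C" if x: "x \<in> units G" for x
  proof (subst bounded_kernel_cong)
    show "bounded_kernel (source_fibre G x)
        (\<lambda>\<alpha> \<beta>. (1 + d (gran G \<alpha>)) * kern f \<alpha> \<beta> * cnj (1 + d (gran G \<beta>))) C"
      using assms(1) unfolding quasi_unitary_def
      by (intro bounded_kernel_mult_left_right opbD[OF assms(2) x]) (simp_all only: complex_mod_cnj)
  qed (simp add: kern_def Ad_def quotient)
  then show ?thesis using assms(2) by (simp add: opb_def)
qed

lemma Ad_redc:
  assumes d: "quasi_unitary d" and a: "a \<in> redc"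
  shows "Ad d a \<in> redc"
proof (rule redcI)
  fix e :: real assume e: "e > 0"
  obtain f where f: "f \<in> C_c (gtop G)" "opb (\<lambda>\<gamma>. a \<gamma> - f \<gamma>) e" using redc_approx[OF a e] by auto
  have dc: "continuous_map (gtop G) euclidean d" using d redc_continuous by (simp add: quasi_unitary_def)
  have "continuous_map (gtop G) euclidean (\<lambda>\<gamma>. d (gran G \<gamma>))" "continuous_map (gtop G) euclidean (\<lambda>\<gamma>. d (gdom G \<gamma>))"
    using continuous_map_compose[OF continuous_ran dc] continuous_map_compose[OF continuous_dom dc] by (simp_all add: o_def)
  then have "continuous_map (gtop G) euclidean (\<lambda>\<gamma>. (1 + d (gran G \<gamma>)) * cnj (1 + d (gdom G \<gamma>)))"
    by (intro continuous_map_times continuous_map_compose_continuous_on[where h=cnj] continuous_map_add)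
       (auto intro!: continuous_intros)
  then have "Ad d f \<in> C_c (gtop G)" unfolding Ad_def by (rule C_c_mult[OF Hausdorff f(1)])
  moreover have "opb (\<lambda>\<gamma>. Ad d a \<gamma> - Ad d f \<gamma>) e"
    using opb_Ad[OF d f(2)] by (simp add: Ad_def[abs_def] right_diff_distrib)
  ultimately show "\<exists>f\<in>C_c (gtop G). opb (\<lambda>\<gamma>. Ad d a \<gamma> - f \<gamma>) e" by blast
qed (simp add: Ad_def redc_outside[OF a])

lemma quasi_unitary_cnj: "quasi_unitary d \<Longrightarrow> quasi_unitary (\<lambda>x. cnj (d x))"
proof -
  assume d: "quasi_unitary d"
  have "norm (1 + cnj z) = norm (1 + z)" for z :: complex using complex_mod_cnj[of "1 + z"] by simp
  then show "quasi_unitary (\<lambda>x. cnj (d x))" using d by (simp add: quasi_unitary_def C0_cnj)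
qed

lemma Ad_cnj_cancel:
  assumes "quasi_unitary d"
  shows "Ad d (Ad (\<lambda>x. cnj (d x)) a) = a"
proof
  fix \<gamma>
  have "Ad d (Ad (\<lambda>x. cnj (d x)) a) \<gamma>
      = ((1 + d (gran G \<gamma>)) * cnj (1 + d (gran G \<gamma>))) * ((1 + d (gdom G \<gamma>)) * cnj (1 + d (gdom G \<gamma>))) * a \<gamma>"
    by (simp add: Ad_def)
  then show "Ad d (Ad (\<lambda>x. cnj (d x)) a) \<gamma> = a \<gamma>" by (simp only: quasi_unitary_mult_cnj[OF assms]) simp
qed

text \<open>In each term the factors at the intermediate unit, the source of \<beta>, are conjugate
  unimodular numbers and cancel.\<close>

lemma Ad_convolution:
  assumes d: "quasi_unitary d"
  shows "Ad d (convolution G a b) = convolution G (Ad d a) (Ad d b)"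
proof
  fix \<gamma>
  show "Ad d (convolution G a b) \<gamma> = convolution G (Ad d a) (Ad d b) \<gamma>"
  proof (cases "\<gamma> \<in> arrows G")
    case True
    have "convolution G (Ad d a) (Ad d b) \<gamma> = (\<Sum>\<^sub>\<infinity>\<beta>\<in>{\<beta> \<in> arrows G. gran G \<beta> = gran G \<gamma>}.
        ((1 + d (gran G \<gamma>)) * cnj (1 + d (gdom G \<gamma>))) * (a \<beta> * b (gmult G (ginv G \<beta>) \<gamma>)))"
      unfolding convolution_def if_P[OF True]
    proof (rule infsum_cong)
      fix \<beta> assume b: "\<beta> \<in> {\<beta> \<in> arrows G. gran G \<beta> = gran G \<gamma>}"
      then have r: "gran G (gmult G (ginv G \<beta>) \<gamma>) = gdom G \<beta>" "gdom G (gmult G (ginv G \<beta>) \<gamma>) = gdom G \<gamma>"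
        "gran G \<beta> = gran G \<gamma>"
        using True by (simp_all add: ran_mult dom_mult inv_closed dom_inv ran_inv)
      have "Ad d a \<beta> * Ad d b (gmult G (ginv G \<beta>) \<gamma>)
          = ((1 + d (gdom G \<beta>)) * cnj (1 + d (gdom G \<beta>))) * (((1 + d (gran G \<gamma>)) * cnj (1 + d (gdom G \<gamma>))) * (a \<beta> * b (gmult G (ginv G \<beta>) \<gamma>)))"
        by (simp only: Ad_def r mult_ac)
      then show "Ad d a \<beta> * Ad d b (gmult G (ginv G \<beta>) \<gamma>)
          = ((1 + d (gran G \<gamma>)) * cnj (1 + d (gdom G \<gamma>))) * (a \<beta> * b (gmult G (ginv G \<beta>) \<gamma>))"
        by (simp only: quasi_unitary_mult_cnj[OF d] mult_1)
    qed
    also have "\<dots> = Ad d (convolution G a b) \<gamma>"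
      using True unfolding infsum_cmult_right' by (simp add: Ad_def convolution_def)
    finally show ?thesis by simp
  qed (simp add: Ad_def convolution_outside)
qed

lemma Ad_involution: "Ad d (involution G a) = involution G (Ad d a)"
  by (auto simp: fun_eq_iff Ad_def involution_def dom_inv ran_inv)

lemma Ad_automorphism:
  assumes d: "quasi_unitary d"
  shows "redc_automorphism (Ad d)"
  unfolding redc_automorphism_def
proof (intro conjI allI ballI)
  have c: "Ad (\<lambda>x. cnj (d x)) (Ad d a) = a" for a
    using Ad_cnj_cancel[OF quasi_unitary_cnj[OF d]] by simp
  show "bij_betw (Ad d) redc redc"
    by (rule bij_betw_byWitness[where f'="Ad (\<lambda>x. cnj (d x))"])
       (auto simp: c Ad_cnj_cancel[OF d] intro: Ad_redc d quasi_unitary_cnj)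
  show "Ad d (\<lambda>\<gamma>. a \<gamma> + b \<gamma>) = (\<lambda>\<gamma>. Ad d a \<gamma> + Ad d b \<gamma>)" for a b
    by (simp add: fun_eq_iff Ad_def algebra_simps)
  show "Ad d (\<lambda>\<gamma>. c * a \<gamma>) = (\<lambda>\<gamma>. c * Ad d a \<gamma>)" for c a
    by (simp add: fun_eq_iff Ad_def algebra_simps)
qed (simp_all only: Ad_convolution[OF d] Ad_involution)

lemma Ad_C0:
  assumes "quasi_unitary d" "k \<in> C0"
  shows "Ad d k = k"
proof
  fix \<gamma> show "Ad d k \<gamma> = k \<gamma>"
    using quasi_unitary_mult_cnj[OF assms(1), of \<gamma>] C0_outside[OF assms(2), of \<gamma>] unitsD(2,3)[of \<gamma>]
    by (cases "\<gamma> \<in> units G") (simp_all add: Ad_def)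
qed

text \<open>Expands conjugation by \<open>1 + d\<close> into operations of the algebra, so that an
  automorphism can be applied to it. This form makes sense with any element in place of
  \<open>d\<close>.\<close>

lemma Ad_algebraic:
  assumes d: "d \<in> C0" and b: "b \<in> redc"
  shows "Ad d b = (\<lambda>\<gamma>. b \<gamma> + (convolution G d b \<gamma> + (convolution G b (involution G d) \<gamma>
    + convolution G (convolution G d b) (involution G d) \<gamma>)))"
proof
  fix \<gamma>
  note ds = C0_cnj[OF d]
  show "Ad d b \<gamma> = b \<gamma> + (convolution G d b \<gamma> + (convolution G b (involution G d) \<gamma>
    + convolution G (convolution G d b) (involution G d) \<gamma>))"
    using redc_outside[OF b, of \<gamma>]
    by (cases "\<gamma> \<in> arrows G")
       (simp_all add: C0_involution[OF d] C0_convolution_right[OF ds] C0_convolution_left[OF d] Ad_def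
          convolution_outside algebra_simps)
qed

text \<open>The portion of the centralizing property that the argument exploits, for the
  conjugations that fix \<open>C0\<close>.\<close>

definition commutes_inner :: "(('g \<Rightarrow> complex) \<Rightarrow> 'g \<Rightarrow> complex) \<Rightarrow> bool" where
  "commutes_inner \<psi> \<longleftrightarrow> (\<forall>d. quasi_unitary d \<longrightarrow> (\<forall>a\<in>redc. \<psi> (Ad d a) = Ad d (\<psi> a)))"

lemma automorphism_Ad:
  assumes \<psi>: "redc_automorphism \<psi>" and d: "d \<in> C0" and b: "b \<in> redc"
  shows "\<psi> (Ad d b) = (\<lambda>\<gamma>. \<psi> b \<gamma> + (convolution G (\<psi> d) (\<psi> b) \<gamma> + (convolution G (\<psi> b) (involution G (\<psi> d)) \<gamma>
    + convolution G (convolution G (\<psi> d) (\<psi> b)) (involution G (\<psi> d)) \<gamma>)))"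
  using d b redc_automorphismD[OF \<psi>] by (simp add: Ad_algebraic)

text \<open>Conjugation by \<open>1 + \<psi>(d)\<close> fixes \<open>C0\<close>, so \<open>\<psi>(d)\<close> lies in the commutant of \<open>C0\<close>.\<close>

lemma commutes_inner_quasi_unitary:
  assumes eff: "effective G" and \<psi>: "redc_automorphism \<psi>" and ci: "commutes_inner \<psi>" and d: "quasi_unitary d"
  shows "\<psi> d \<in> C0"
proof (rule C0_commutant[OF eff])
  note D = redc_automorphismD[OF \<psi>]
  have dC: "d \<in> C0" and dr: "d \<in> redc" using d by (simp_all add: quasi_unitary_def)
  define p where "p = \<psi> d"
  define ps where "ps = involution G p"
  have p: "p \<in> redc" using D(2) dr by (simp add: p_def)
  have ps: "ps \<in> redc" using p by (simp add: ps_def)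
  show "\<psi> d \<in> redc" using p by (simp add: p_def)
  \<comment> \<open>Unitarity of \<open>1 + d\<close>, expanded so that the unit cancels, is a
    relation inside the algebra and passes to \<open>p\<close>.\<close>
  have unit: "(\<lambda>\<gamma>. convolution G ps p \<gamma> + (p \<gamma> + ps \<gamma>)) = (\<lambda>_. 0)"
  proof -
    have "(\<lambda>\<gamma>. convolution G (involution G d) d \<gamma> + (d \<gamma> + involution G d \<gamma>)) = (\<lambda>_. 0)"
    proof
      fix \<gamma>
      have "convolution G (involution G d) d \<gamma> + (d \<gamma> + involution G d \<gamma>) = (1 + d \<gamma>) * cnj (1 + d \<gamma>) - 1"
        by (simp add: C0_involution[OF dC] C0_convolution[OF C0_cnj[OF dC] dC] algebra_simps)
      then show "convolution G (involution G d) d \<gamma> + (d \<gamma> + involution G d \<gamma>) = 0"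
        by (simp only: quasi_unitary_mult_cnj[OF d]) simp
    qed
    then have "\<psi> (\<lambda>\<gamma>. convolution G (involution G d) d \<gamma> + (d \<gamma> + involution G d \<gamma>)) = (\<lambda>_. 0)"
      by (simp only: redc_automorphism_zero[OF \<psi>])
    then show ?thesis using dr D by (simp add: p_def ps_def)
  qed
  fix k assume k: "k \<in> C0"
  then have kr: "k \<in> redc" by simp
  obtain b where b: "b \<in> redc" "\<psi> b = k" using D(1) kr by (metis bij_betw_iff_bijections)
  have "\<psi> (Ad d b) = k" using ci d b k by (simp add: commutes_inner_def Ad_C0)
  then have e: "k = (\<lambda>\<gamma>. k \<gamma> + (convolution G p k \<gamma> + (convolution G k ps \<gamma> + convolution G (convolution G p k) ps \<gamma>)))"
    using automorphism_Ad[OF \<psi> dC b(1)] by (simp add: b(2) p_def ps_def)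
  have x: "convolution G p k \<gamma> + (convolution G k ps \<gamma> + convolution G (convolution G p k) ps \<gamma>) = 0" for \<gamma>
    using fun_cong[OF e, of \<gamma>] by simp
  define pk where "pk = convolution G p k"
  have pk: "pk \<in> redc" using p kr by (simp add: pk_def)
  have zl: "convolution G a (\<lambda>_. 0) = (\<lambda>_. 0)" "convolution G (\<lambda>_. 0) a = (\<lambda>_. 0)" for a
    using convolution_scale_right[of a 0 "\<lambda>_. 0"] convolution_scale_left[of 0 "\<lambda>_. 0" a] by simp_all
  \<comment> \<open>The relation \<open>x\<close> contains \<open>p k\<close>, \<open>k p*\<close>
    and \<open>p k p*\<close>. Multiplying it by \<open>p\<close> on the right creates the products
    \<open>p* p\<close> to which \<open>unit\<close> applies.\<close>
  have A: "convolution G pk p \<gamma> + (convolution G k (convolution G ps p) \<gamma> + convolution G pk (convolution G ps p) \<gamma>) = 0" for \<gamma>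
  proof -
    have "convolution G (\<lambda>\<gamma>. pk \<gamma> + (convolution G k ps \<gamma> + convolution G pk ps \<gamma>)) p = (\<lambda>_. 0)"
      using x zl(2) by (simp add: pk_def)
    then have "(\<lambda>\<gamma>. convolution G pk p \<gamma> + (convolution G k (convolution G ps p) \<gamma> + convolution G pk (convolution G ps p) \<gamma>)) = (\<lambda>_. 0)"
      using p ps kr pk by (simp add: redc_convolution_add_left redc_convolution_assoc)
    then show ?thesis by (rule fun_cong)
  qed
  have B: "convolution G a (convolution G ps p) \<gamma> + (convolution G a p \<gamma> + convolution G a ps \<gamma>) = 0" if a: "a \<in> redc" for a \<gamma>
  proof -
    have "convolution G a (\<lambda>\<gamma>. convolution G ps p \<gamma> + (p \<gamma> + ps \<gamma>)) = (\<lambda>_. 0)"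
      unfolding unit by (rule zl)
    then have "(\<lambda>\<gamma>. convolution G a (convolution G ps p) \<gamma> + (convolution G a p \<gamma> + convolution G a ps \<gamma>)) = (\<lambda>_. 0)"
      using p ps a by (simp add: redc_convolution_add_right)
    then show ?thesis by (rule fun_cong)
  qed
  \<comment> \<open>Eliminating \<open>p* p\<close> from \<open>A\<close> by means of
    \<open>B\<close> leaves \<open>k p + k p* + p k p* = 0\<close>; comparison with \<open>x\<close>
    gives \<open>k p = p k\<close>.\<close>
  have "convolution G k p \<gamma> = pk \<gamma>" for \<gamma>
    using A[of \<gamma>] B[OF kr, of \<gamma>] B[OF pk, of \<gamma>] x[of \<gamma>, folded pk_def] by algebra
  then show "convolution G k (\<psi> d) = convolution G (\<psi> d) k" by (auto simp: pk_def p_def)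
qed

section \<open>Images of the diagonal under centralizing automorphisms\<close>

lemma cayley_quasi_unitary:
  assumes "f \<in> C0"
  shows "quasi_unitary (\<lambda>x. cayley t (f x))"
  unfolding quasi_unitary_def
  using C_0_compose[OF Hausdorff_unit_space assms continuous_cayley norm_cayley_le] norm_one_plus_cayley by blast

text \<open>Transport of \<open>cayley_equation\<close>. It is kept as an implicit equation because
  \<psi>(f) is not yet known to be a function on the units, so no Cayley transform of it can be
  formed.\<close>

lemma automorphism_cayley:
  assumes \<psi>: "redc_automorphism \<psi>" and f: "f \<in> C0" "\<And>x. Im (f x) = 0"
  shows "\<psi> (\<lambda>x. cayley t (f x)) = (\<lambda>\<gamma>. 2 * \<i> * of_real t * \<psi> f \<gamma>
    + \<i> * of_real t * convolution G (\<psi> f) (\<psi> (\<lambda>x. cayley t (f x))) \<gamma>)"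
proof -
  let ?d = "\<lambda>x. cayley t (f x)"
  note D = redc_automorphismD[OF \<psi>]
  have d: "?d \<in> C0" using cayley_quasi_unitary[OF f(1)] by (simp add: quasi_unitary_def)
  have re: "complex_of_real (t * Re (f x)) = of_real t * f x" for x
    using f(2)[of x] by (simp add: complex_eq_iff)
  have "?d = (\<lambda>x. 2 * \<i> * of_real t * f x + \<i> * of_real t * convolution G f ?d x)"
  proof
    fix x
    show "?d x = 2 * \<i> * of_real t * f x + \<i> * of_real t * convolution G f ?d x"
      using cayley_equation[of t "f x"] unfolding re C0_convolution[OF f(1) d] by (simp add: mult.assoc)
  qed
  then have "\<psi> ?d = \<psi> (\<lambda>x. 2 * \<i> * of_real t * f x + \<i> * of_real t * convolution G f ?d x)" by (rule arg_cong)
  also have "\<dots> = (\<lambda>\<gamma>. 2 * \<i> * of_real t * \<psi> f \<gamma> + \<i> * of_real t * \<psi> (convolution G f ?d) \<gamma>)"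
    using f(1) d D(3)[of "\<lambda>x. 2 * \<i> * of_real t * f x" "\<lambda>x. \<i> * of_real t * convolution G f ?d x"]
    by (simp add: D(4))
  also have "\<psi> (convolution G f ?d) = convolution G (\<psi> f) (\<psi> ?d)" using f(1) d by (simp add: D(5))
  finally show ?thesis .
qed

lemma C0_real_imaginary:
  assumes "f \<in> C0"
  shows "(\<lambda>x. complex_of_real (Re (f x))) \<in> C0" "(\<lambda>x. complex_of_real (Im (f x))) \<in> C0"
    "f = (\<lambda>x. complex_of_real (Re (f x)) + \<i> * complex_of_real (Im (f x)))"
proof -
  show "(\<lambda>x. complex_of_real (Re (f x))) \<in> C0"
    by (rule C_0_compose[OF Hausdorff_unit_space assms, of _ 1]) (auto intro!: continuous_intros simp: abs_Re_le_cmod)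
  show "(\<lambda>x. complex_of_real (Im (f x))) \<in> C0"
    by (rule C_0_compose[OF Hausdorff_unit_space assms, of _ 1]) (auto intro!: continuous_intros simp: abs_Im_le_cmod)
qed (simp add: complex_eq[symmetric])

text \<open>For real f the image \<open>p\<close> of a Cayley transform is already in
  \<open>C0\<close>. At a non-unit arrow the transported relation says that \<psi>(f) times
  \<open>2 + p\<close>, taken at the source, is zero. The value -2 of \<open>p\<close> would
  correspond to the point -1 that Cayley transforms omit: at the source itself the relation would
  read \<open>-2 = 0\<close>.\<close>

lemma commutes_inner_maps_C0:
  assumes eff: "effective G" and \<psi>: "redc_automorphism \<psi>" and ci: "commutes_inner \<psi>" and f: "f \<in> C0"
  shows "\<psi> f \<in> C0"
proof -
  note D = redc_automorphismD[OF \<psi>]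
  have real: "\<psi> f \<in> C0" if f: "f \<in> C0" "\<And>x. Im (f x) = 0" for f
  proof -
    define p where "p = \<psi> (\<lambda>x. cayley 1 (f x))"
    have p: "p \<in> C0"
      unfolding p_def by (rule commutes_inner_quasi_unitary[OF eff \<psi> ci cayley_quasi_unitary[OF f(1)]])
    have F: "\<psi> f \<in> redc" using D(2) f(1) by simp
    have eq: "p \<gamma> = 2 * \<i> * \<psi> f \<gamma> + \<i> * (\<psi> f \<gamma> * p (gdom G \<gamma>))" if "\<gamma> \<in> arrows G" for \<gamma>
      using fun_cong[OF automorphism_cayley[OF \<psi> f, of 1], of \<gamma>] C0_convolution_right[OF p that] by (simp add: p_def)
    have "\<psi> f \<gamma> = 0" if n: "\<gamma> \<notin> units G" for \<gamma>
    proof (cases "\<gamma> \<in> arrows G")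
      case True
      let ?y = "gdom G \<gamma>"
      have "\<i> * \<psi> f \<gamma> * (2 + p ?y) = 0"
        using eq[OF True] C0_outside[OF p n] by (simp add: algebra_simps)
      moreover have "2 + p ?y \<noteq> 0"
      proof
        assume "2 + p ?y = 0"
        then have p2: "p ?y = -2" by (simp only: eq_neg_iff_add_eq_0 add.commute)
        have "p ?y = 2 * \<i> * \<psi> f ?y + \<i> * (\<psi> f ?y * p ?y)"
          using eq[OF dom_closed[OF True]] unfolding dom_dom[OF True] .
        then show False unfolding p2 by simp
      qed
      ultimately show ?thesis by simp
    qed (rule redc_outside[OF F])
    then show ?thesis using F by (simp add: C0_iff)
  qed
  note ri = C0_real_imaginary[OF f]
  have "\<psi> f = (\<lambda>\<gamma>. \<psi> (\<lambda>x. complex_of_real (Re (f x))) \<gamma> + \<i> * \<psi> (\<lambda>x. complex_of_real (Im (f x))) \<gamma>)"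
    using D(3)[of "\<lambda>x. complex_of_real (Re (f x))" "\<lambda>x. \<i> * complex_of_real (Im (f x))"] ri
    by (simp add: D(4))
  then show ?thesis using C0_add[OF real[OF ri(1)] C0_scale[OF real[OF ri(2)], of \<i>]] by simp
qed

lemma inverse_automorphism:
  assumes \<psi>: "redc_automorphism \<psi>"
  defines "\<theta> \<equiv> inv_into redc \<psi>"
  shows "redc_automorphism \<theta>" "a \<in> redc \<Longrightarrow> \<psi> (\<theta> a) = a" "a \<in> redc \<Longrightarrow> \<theta> (\<psi> a) = a"
proof -
  note D = redc_automorphismD[OF \<psi>]
  show i: "a \<in> redc \<Longrightarrow> \<psi> (\<theta> a) = a" "a \<in> redc \<Longrightarrow> \<theta> (\<psi> a) = a" for a
    unfolding \<theta>_def using D(1) by (auto simp: bij_betw_inv_into_right bij_betw_inv_into_left)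
  have b: "bij_betw \<theta> redc redc" unfolding \<theta>_def by (rule bij_betw_inv_into[OF D(1)])
  then have c: "\<theta> a \<in> redc" if "a \<in> redc" for a using that by (rule bij_betwE[rule_format])
  have eqI: "\<theta> a = b" if "a = \<psi> b" "b \<in> redc" for a b using that i by simp
  show "redc_automorphism \<theta>"
    unfolding redc_automorphism_def
    by (intro conjI allI ballI b; rule eqI) (simp_all add: D c i)
qed

text \<open>The inverse automorphism also commutes with the conjugations, so it maps
  \<open>C0\<close> into itself as well.\<close>

lemma commutes_inner_image_C0:
  assumes eff: "effective G" and \<psi>: "redc_automorphism \<psi>" and ci: "commutes_inner \<psi>"
  shows "\<psi> ` C0 = C0"
proof
  show "\<psi> ` C0 \<subseteq> C0" using commutes_inner_maps_C0[OF assms] by blast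
  let ?\<theta> = "inv_into redc \<psi>"
  note i = inverse_automorphism[OF \<psi>]
  note D = redc_automorphismD[OF \<psi>] and E = redc_automorphismD[OF i(1)]
  have "commutes_inner ?\<theta>"
    unfolding commutes_inner_def
  proof (intro allI impI ballI)
    fix d a assume d: "quasi_unitary d" and a: "a \<in> redc"
    have "\<psi> (Ad d (?\<theta> a)) = Ad d a" using ci d a E(2) i(2) by (simp add: commutes_inner_def)
    then show "?\<theta> (Ad d a) = Ad d (?\<theta> a)" using i(3)[OF Ad_redc[OF d E(2)[OF a]]] by simp
  qed
  then have "?\<theta> f \<in> C0" if "f \<in> C0" for f using commutes_inner_maps_C0[OF eff i(1)] that by blast
  then show "C0 \<subseteq> \<psi> ` C0" using i(2)[OF C0_redc] by (metis imageI subsetI)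
qed

text \<open>The displacement \<open>\<psi>(f) - f\<close> is invariant under arrows: compare the two conjugations by Cayley
  transforms of \<open>f\<close> at an arrow.\<close>

lemma displacement_invariant:
  assumes eff: "effective G" and \<psi>: "redc_automorphism \<psi>" and ci: "commutes_inner \<psi>"
    and f: "f \<in> C0" "\<And>x. Im (f x) = 0" and \<alpha>: "\<alpha> \<in> arrows G"
  shows "\<psi> f (gran G \<alpha>) - f (gran G \<alpha>) = \<psi> f (gdom G \<alpha>) - f (gdom G \<alpha>)"
proof -
  note D = redc_automorphismD[OF \<psi>]
  have F: "\<psi> f \<in> C0" by (rule commutes_inner_maps_C0[OF eff \<psi> ci f(1)])
  have "involution G f = f" using C0_involution[OF f(1)] f(2) by (auto simp: complex_eq_iff)
  then have "(\<lambda>\<gamma>. cnj (\<psi> f \<gamma>)) = \<psi> f" using D(6)[of f] f(1) C0_involution[OF F] by simp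
  then have FI: "Im (\<psi> f x) = 0" for x using fun_cong[of "\<lambda>\<gamma>. cnj (\<psi> f \<gamma>)" "\<psi> f" x] by (simp add: complex_eq_iff)
  \<comment> \<open>Now that \<psi>(f) and the image of the transform both lie in \<open>C0\<close>,
    the implicit equation holds pointwise on units and can be solved, its denominator being
    nonzero.\<close>
  have c: "\<psi> (\<lambda>x. cayley t (f x)) x = cayley t (\<psi> f x)" if x: "x \<in> units G" for t x
  proof -
    let ?p = "\<psi> (\<lambda>x. cayley t (f x))"
    have p: "?p \<in> C0" by (rule commutes_inner_quasi_unitary[OF eff \<psi> ci cayley_quasi_unitary[OF f(1)]])
    have F': "\<psi> f x = of_real (Re (\<psi> f x))" using FI by (simp add: complex_eq_iff)
    have "?p x = 2 * \<i> * of_real t * \<psi> f x + \<i> * of_real t * (\<psi> f x * ?p x)"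
      using fun_cong[OF automorphism_cayley[OF \<psi> f, of t], of x] C0_convolution_right[OF p unitsD(1)[OF x]] unitsD(2)[OF x] by simp
    then have "?p x * (1 - \<i> * of_real (t * Re (\<psi> f x))) = 2 * \<i> * of_real (t * Re (\<psi> f x))"
      by (subst (asm) (1 2) F') (simp add: algebra_simps)
    then show ?thesis unfolding cayley_def using cayley_denominator(1)[of "t * Re (\<psi> f x)"]
      by (simp add: eq_divide_eq)
  qed
  \<comment> \<open>An element with value 1 at \<alpha> reveals the scalar by which a conjugation
    acts there. Surjectivity of \<psi> then provides \<open>b\<close>.\<close>
  obtain k :: "'g \<Rightarrow> real" where k: "(\<lambda>\<gamma>. complex_of_real (k \<gamma>)) \<in> C_c (gtop G)" "k \<alpha> = 1"
    using bump_function[of \<alpha> "topspace (gtop G)"] \<alpha> topspace_gtop by (metis openin_topspace)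
  obtain b where b: "b \<in> redc" "\<psi> b = (\<lambda>\<gamma>. complex_of_real (k \<gamma>))"
    using D(1) C_c_redc[OF k(1)] by (metis bij_betw_iff_bijections)
  have u: "gran G \<alpha> \<in> units G" "gdom G \<alpha> \<in> units G" using \<alpha> ran_in_units dom_in_units by auto
  have "(1 + cayley t (\<psi> f (gran G \<alpha>))) * cnj (1 + cayley t (\<psi> f (gdom G \<alpha>)))
      = (1 + cayley t (f (gran G \<alpha>))) * cnj (1 + cayley t (f (gdom G \<alpha>)))" for t
  proof -
    let ?d = "\<lambda>x. cayley t (f x)"
    have d: "quasi_unitary ?d" by (rule cayley_quasi_unitary[OF f(1)])
    then have dC: "?d \<in> C0" by (simp add: quasi_unitary_def)
    have p: "\<psi> ?d \<in> C0" by (rule commutes_inner_quasi_unitary[OF eff \<psi> ci d])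
    \<comment> \<open>As an automorphism \<psi> carries conjugation by \<open>1 + d\<close> to
      conjugation by \<open>1 + \<psi> d\<close>; by \<open>commutes_inner\<close> it also leaves
      that conjugation unchanged. So the two agree on the image of \<psi>.\<close>
    have "Ad (\<psi> ?d) (\<psi> b) = \<psi> (Ad ?d b)"
      unfolding automorphism_Ad[OF \<psi> dC b(1)] by (rule Ad_algebraic[OF p D(2)[OF b(1)]])
    also have "\<dots> = Ad ?d (\<psi> b)" using ci d b(1) by (simp add: commutes_inner_def)
    finally have "Ad (\<psi> ?d) (\<psi> b) \<alpha> = Ad ?d (\<psi> b) \<alpha>" by simp
    then show ?thesis using k(2) by (simp add: Ad_def b(2) c u)
  qed
  then have "(1 + cayley t (of_real (Re (\<psi> f (gran G \<alpha>))))) * cnj (1 + cayley t (of_real (Re (\<psi> f (gdom G \<alpha>)))))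
      = (1 + cayley t (of_real (Re (f (gran G \<alpha>))))) * cnj (1 + cayley t (of_real (Re (f (gdom G \<alpha>)))))" for t
    by (simp add: cayley_def)
  then have "Re (\<psi> f (gran G \<alpha>)) - Re (f (gran G \<alpha>)) = Re (\<psi> f (gdom G \<alpha>)) - Re (f (gdom G \<alpha>))"
    by (rule cayley_product_eq)
  then show ?thesis using FI f(2) by (simp add: complex_eq_iff)
qed

text \<open>If \<open>g = \<psi>(f) - f\<close> is nonzero at \<open>y\<close>, invariance of \<open>\<psi>(f k) - f k = f l + k g + g l\<close>, where
  \<open>l = \<psi>(k) - k\<close>, first for \<open>k = f\<close> and then for all \<open>k\<close>, shows that no \<open>k\<close> separates the two ends of
  an arrow starting at \<open>y\<close>.\<close>

lemma displacement_zero: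
  assumes eff: "effective G" and \<psi>: "redc_automorphism \<psi>" and ci: "commutes_inner \<psi>"
    and f: "f \<in> C0" "\<And>x. Im (f x) = 0" and \<alpha>: "\<alpha> \<in> arrows G" "gran G \<alpha> \<noteq> gdom G \<alpha>"
  shows "\<psi> f (gdom G \<alpha>) = f (gdom G \<alpha>)"
proof (rule ccontr)
  let ?x = "gran G \<alpha>" and ?y = "gdom G \<alpha>"
  assume ne: "\<psi> f ?y \<noteq> f ?y"
  note D = redc_automorphismD[OF \<psi>]
  have prod: "(f ?x - f ?y) * (\<psi> k ?y - k ?y) + (k ?x - k ?y) * (\<psi> f ?y - f ?y) = 0"
    if k: "k \<in> C0" "\<And>x. Im (k x) = 0" for k
  proof -
    have fk: "(\<lambda>\<gamma>. f \<gamma> * k \<gamma>) \<in> C0" "\<And>x. Im (f x * k x) = 0" using C0_mult f k by auto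
    have "\<psi> (\<lambda>\<gamma>. f \<gamma> * k \<gamma>) = (\<lambda>\<gamma>. \<psi> f \<gamma> * \<psi> k \<gamma>)"
      using D(5)[of f k] f k
      by (simp add: C0_convolution C0_convolution[OF commutes_inner_maps_C0[OF eff \<psi> ci f(1)] commutes_inner_maps_C0[OF eff \<psi> ci k(1)]])
    then have 1: "\<psi> f ?x * \<psi> k ?x - f ?x * k ?x = \<psi> f ?y * \<psi> k ?y - f ?y * k ?y"
      using displacement_invariant[OF eff \<psi> ci fk \<alpha>(1)] by simp
    have 2: "\<psi> f ?x = f ?x + (\<psi> f ?y - f ?y)" "\<psi> k ?x = k ?x + (\<psi> k ?y - k ?y)"
      using displacement_invariant[OF eff \<psi> ci f \<alpha>(1)] displacement_invariant[OF eff \<psi> ci k \<alpha>(1)]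
      by (simp_all add: algebra_simps)
    \<comment> \<open>The product of the two displacements is the same at both ends of the arrow and
      cancels.\<close>
    show ?thesis using 1 unfolding 2 by (simp add: algebra_simps)
  qed
  have "2 * (f ?x - f ?y) * (\<psi> f ?y - f ?y) = 0" using prod[OF f] by (simp add: algebra_simps)
  then have fxy: "f ?x = f ?y" using ne by simp
  have "?y \<in> units G" "?y \<noteq> ?x" using \<alpha> dom_in_units by auto
  then obtain k :: "'g \<Rightarrow> real" where k: "(\<lambda>\<gamma>. complex_of_real (k \<gamma>)) \<in> C0" "k ?y = 1" "k ?x = 0"
    by (rule C0_separates)
  show False using prod[OF k(1)] fxy ne k(2,3) by simp
qed

lemma commutes_inner_fixes_C0:
  assumes eff: "effective G" and en: "enough_arrows G"
    and \<psi>: "redc_automorphism \<psi>" and ci: "commutes_inner \<psi>" and f: "f \<in> C0"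
  shows "\<psi> f = f"
proof -
  note D = redc_automorphismD[OF \<psi>]
  have real: "\<psi> f = f" if f: "f \<in> C0" "\<And>x. Im (f x) = 0" for f
  proof (rule ccontr)
    assume ne: "\<psi> f \<noteq> f"
    have F: "\<psi> f \<in> C0" by (rule commutes_inner_maps_C0[OF eff \<psi> ci f(1)])
    define g where "g = (\<lambda>\<gamma>. \<psi> f \<gamma> - f \<gamma>)"
    have g: "continuous_map (gtop G) euclidean g"
      unfolding g_def by (rule redc_continuous) (use F f in simp)
    let ?V = "{x \<in> topspace (gtop G). g x \<in> - {0}}"
    have V: "openin (gtop G) ?V" by (rule openin_continuous_map_preimage[OF g]) (simp add: open_Compl)
    have "g \<gamma> = 0" if "\<gamma> \<notin> units G" for \<gamma>
      using C0_outside[OF F that] C0_outside[OF f(1) that] by (simp add: g_def)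
    then have Vu: "?V \<subseteq> units G" by blast
    obtain x where x: "\<psi> f x \<noteq> f x" using ne by auto
    then have xu: "x \<in> units G" using C0_outside[OF F, of x] C0_outside[OF f(1), of x] by metis
    then have "x \<in> ?V" using x unitsD by (auto simp: g_def topspace_gtop)
    then have "?V \<noteq> {}" by blast
    moreover have "openin (unit_space G) ?V" using V Vu by (simp add: openin_unit_space_iff)
    ultimately obtain \<alpha> where a: "\<alpha> \<in> arrows G - units G" "gdom G \<alpha> \<in> ?V"
      using en unfolding enough_arrows_def by blast
    \<comment> \<open>\<open>displacement_zero\<close> asks for an arrow with distinct ends, whereas
      \<open>enough_arrows\<close> yields one outside the units. Effectiveness bridges the gap: a
      nonempty open set of non-units cannot lie in the isotropy.\<close>
    define W where "W = {\<beta> \<in> topspace (gtop G). gdom G \<beta> \<in> ?V} - units G"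
    have W: "openin (gtop G) W"
      unfolding W_def by (intro openin_diff openin_continuous_map_preimage[OF continuous_dom V] closed_units)
    have aW: "\<alpha> \<in> W" using a by (auto simp: W_def topspace_gtop)
    have "\<not> W \<subseteq> isotropy G"
    proof
      assume "W \<subseteq> isotropy G"
      then have "W \<subseteq> gtop G interior_of isotropy G" using W by (rule interior_of_maximal)
      then have "W \<subseteq> units G" using eff by (simp add: effective_def)
      then show False using aW by (auto simp: W_def)
    qed
    then obtain \<beta> where b0: "\<beta> \<in> W" "\<beta> \<notin> isotropy G" by blast
    then have b: "\<beta> \<in> arrows G" "gdom G \<beta> \<in> ?V" "gran G \<beta> \<noteq> gdom G \<beta>"
      by (auto simp: W_def isotropy_def topspace_gtop)
    show False using displacement_zero[OF eff \<psi> ci f b(1,3)] b(2) by (simp add: g_def)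
  qed
  note ri = C0_real_imaginary[OF f]
  have "\<psi> f = (\<lambda>\<gamma>. \<psi> (\<lambda>x. complex_of_real (Re (f x))) \<gamma> + \<i> * \<psi> (\<lambda>x. complex_of_real (Im (f x))) \<gamma>)"
    using D(3)[of "\<lambda>x. complex_of_real (Re (f x))" "\<lambda>x. \<i> * complex_of_real (Im (f x))"] ri
    by (simp add: D(4))
  then show ?thesis using real[OF ri(1)] real[OF ri(2)] ri(3) by simp
qed

end

section \<open>Automorphisms of the completion\<close>

lemma star_automorphismsD:
  assumes "\<phi> \<in> star_automorphisms A"
  shows "\<phi> \<in> Bij (carrier A)" "\<phi> \<in> extensional (carrier A)" "bij_betw \<phi> (carrier A) (carrier A)"
    "a \<in> carrier A \<Longrightarrow> \<phi> a \<in> carrier A"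
    "\<lbrakk>a \<in> carrier A; b \<in> carrier A\<rbrakk> \<Longrightarrow> \<phi> (add A a b) = add A (\<phi> a) (\<phi> b)"
    "a \<in> carrier A \<Longrightarrow> \<phi> (scale A c a) = scale A c (\<phi> a)"
    "\<lbrakk>a \<in> carrier A; b \<in> carrier A\<rbrakk> \<Longrightarrow> \<phi> (times A a b) = times A (\<phi> a) (\<phi> b)"
    "a \<in> carrier A \<Longrightarrow> \<phi> (star A a) = star A (\<phi> a)"
proof -
  show 1: "\<phi> \<in> Bij (carrier A)" using assms by (simp add: star_automorphisms_def)
  then show "\<phi> \<in> extensional (carrier A)" and b: "bij_betw \<phi> (carrier A) (carrier A)" by (auto simp: Bij_def)
  show "a \<in> carrier A \<Longrightarrow> \<phi> a \<in> carrier A" using b by (rule bij_betwE[rule_format])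
qed (use assms in \<open>simp_all add: star_automorphisms_def\<close>)

lemma carrier_Aut: "carrier (Aut A) = star_automorphisms A" by (simp add: Aut_def)

lemma mult_Aut:
  "\<lbrakk>\<phi> \<in> star_automorphisms A; \<psi> \<in> star_automorphisms A\<rbrakk> \<Longrightarrow> \<phi> \<otimes>\<^bsub>Aut A\<^esub> \<psi> = compose (carrier A) \<phi> \<psi>"
  by (simp add: Aut_def BijGroup_def star_automorphismsD(1))

lemma one_Aut: "\<one>\<^bsub>Aut A\<^esub> = (\<lambda>x\<in>carrier A. x)" by (simp add: Aut_def BijGroup_def)

text \<open>Multiplication comes from \<open>BijGroup\<close>, so it suffices to exhibit a subgroup
  there. The closure conditions are hypotheses because the record \<open>normed_star_algebra\<close>
  carries no axioms.\<close>

lemma group_Aut: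
  assumes add: "\<And>a b. \<lbrakk>a \<in> carrier A; b \<in> carrier A\<rbrakk> \<Longrightarrow> add A a b \<in> carrier A"
    and scale: "\<And>c a. a \<in> carrier A \<Longrightarrow> scale A c a \<in> carrier A"
    and times: "\<And>a b. \<lbrakk>a \<in> carrier A; b \<in> carrier A\<rbrakk> \<Longrightarrow> times A a b \<in> carrier A"
    and star: "\<And>a. a \<in> carrier A \<Longrightarrow> star A a \<in> carrier A"
  shows "group (Aut A)"
proof -
  let ?S = "carrier A"
  interpret B: group "BijGroup ?S" by (rule group_BijGroup)
  have "subgroup (star_automorphisms A) (BijGroup ?S)"
  proof (rule B.subgroupI)
    show "star_automorphisms A \<subseteq> carrier (BijGroup ?S)"
      by (auto simp: BijGroup_def star_automorphisms_def)
    have "(\<lambda>x\<in>?S. x) \<in> star_automorphisms A"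
      using assms id_Bij[of ?S] by (simp add: star_automorphisms_def)
    then show "star_automorphisms A \<noteq> {}" by blast
  next
    fix \<phi> assume p: "\<phi> \<in> star_automorphisms A"
    note D = star_automorphismsD[OF p]
    let ?i = "\<lambda>x\<in>?S. inv_into ?S \<phi> x"
    have i: "inv_into ?S \<phi> a \<in> ?S" "\<phi> (inv_into ?S \<phi> a) = a" if "a \<in> ?S" for a
      using that D(3) by (auto simp: bij_betw_inv_into_right bij_betw_def inv_into_into)
    have eqI: "inv_into ?S \<phi> a = b" if "a = \<phi> b" "b \<in> ?S" for a b
      using that D(3) by (simp add: bij_betw_inv_into_left)
    have "?i \<in> star_automorphisms A"
      unfolding star_automorphisms_def
      by (intro CollectI conjI ballI allI restrict_inv_into_Bij D(1))
         (simp_all add: assms i, (rule eqI; simp add: D assms i)+)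
    then show "inv\<^bsub>BijGroup ?S\<^esub> \<phi> \<in> star_automorphisms A" by (simp add: inv_BijGroup[OF D(1)])
  next
    fix \<phi> \<psi> assume p: "\<phi> \<in> star_automorphisms A" "\<psi> \<in> star_automorphisms A"
    note D = star_automorphismsD[OF p(1)] and E = star_automorphismsD[OF p(2)]
    have "compose ?S \<phi> \<psi> \<in> star_automorphisms A"
      unfolding star_automorphisms_def
      by (intro CollectI conjI ballI allI compose_Bij D(1) E(1)) (simp_all add: compose_def assms D E)
    then show "\<phi> \<otimes>\<^bsub>BijGroup ?S\<^esub> \<psi> \<in> star_automorphisms A" using D(1) E(1) by (simp add: BijGroup_def)
  qed
  then show ?thesis unfolding Aut_def by (rule subgroup.subgroup_is_group) (rule group_BijGroup)
qed

lemma subgroup_Aut_fixing: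
  assumes "group (Aut A)" "B \<subseteq> carrier A"
  shows "subgroup (Aut_fixing A B) (Aut A)"
proof (rule group.subgroupI[OF assms(1)])
  interpret group "Aut A" by (rule assms(1))
  show "Aut_fixing A B \<subseteq> carrier (Aut A)" by (auto simp: Aut_fixing_def)
  have "\<one>\<^bsub>Aut A\<^esub> \<in> Aut_fixing A B"
    using assms(2) one_closed by (auto simp: Aut_fixing_def one_Aut)
  then show "Aut_fixing A B \<noteq> {}" by blast
next
  interpret group "Aut A" by (rule assms(1))
  fix \<phi> assume p: "\<phi> \<in> Aut_fixing A B"
  then have c: "\<phi> \<in> carrier (Aut A)" by (simp add: Aut_fixing_def)
  note i = inv_closed[OF c]
  have "(inv\<^bsub>Aut A\<^esub> \<phi>) b = b" if "b \<in> B" for b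
  proof -
    have "compose (carrier A) (inv\<^bsub>Aut A\<^esub> \<phi>) \<phi> = (\<lambda>x\<in>carrier A. x)"
      using l_inv[OF c] mult_Aut[of "inv\<^bsub>Aut A\<^esub> \<phi>" A \<phi>] i c by (simp add: carrier_Aut one_Aut)
    then have "compose (carrier A) (inv\<^bsub>Aut A\<^esub> \<phi>) \<phi> b = b" using that assms(2) by auto
    then show ?thesis using that assms(2) p by (auto simp: compose_def Aut_fixing_def)
  qed
  then show "inv\<^bsub>Aut A\<^esub> \<phi> \<in> Aut_fixing A B" using i by (simp add: Aut_fixing_def)
next
  interpret group "Aut A" by (rule assms(1))
  fix \<phi> \<psi> assume p: "\<phi> \<in> Aut_fixing A B" "\<psi> \<in> Aut_fixing A B"
  then have c: "\<phi> \<in> carrier (Aut A)" "\<psi> \<in> carrier (Aut A)" by (simp_all add: Aut_fixing_def)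
  have "(\<phi> \<otimes>\<^bsub>Aut A\<^esub> \<psi>) b = b" if "b \<in> B" for b
    using that assms(2) p c mult_Aut[of \<phi> A \<psi>] by (auto simp: carrier_Aut compose_def Aut_fixing_def)
  then show "\<phi> \<otimes>\<^bsub>Aut A\<^esub> \<psi> \<in> Aut_fixing A B" using m_closed[OF c] by (simp add: Aut_fixing_def)
qed

text \<open>An abelian subgroup containing \<open>H\<close> commutes with \<open>H\<close>
  elementwise and therefore lies in the centralizer.\<close>

lemma maximal_abelian_subgroupI:
  assumes "group \<Gamma>" "subgroup H \<Gamma>" "\<And>g h. \<lbrakk>g \<in> H; h \<in> H\<rbrakk> \<Longrightarrow> g \<otimes>\<^bsub>\<Gamma>\<^esub> h = h \<otimes>\<^bsub>\<Gamma>\<^esub> g"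
    "centralizer \<Gamma> H \<subseteq> H"
  shows "maximal_abelian_subgroup H \<Gamma>"
  unfolding maximal_abelian_subgroup_def abelian_subgroup_def
proof (intro conjI allI impI)
  show "subgroup H \<Gamma>" by fact
  show "comm_group (\<Gamma>\<lparr>carrier := H\<rparr>)"
    by (rule group.group_comm_groupI[OF subgroup.subgroup_is_group[OF assms(2,1)]]) (simp add: assms(3))
  fix K assume K: "(subgroup K \<Gamma> \<and> comm_group (\<Gamma>\<lparr>carrier := K\<rparr>)) \<and> H \<subseteq> K"
  then interpret K: comm_group "\<Gamma>\<lparr>carrier := K\<rparr>" by simp
  have "K \<subseteq> centralizer \<Gamma> H"
  proof
    fix g assume g: "g \<in> K"
    have "g \<otimes>\<^bsub>\<Gamma>\<^esub> h = h \<otimes>\<^bsub>\<Gamma>\<^esub> g" if "h \<in> H" for h using K.m_comm[of g h] g that K by auto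
    then show "g \<in> centralizer \<Gamma> H" using g K subgroup.subset[of K \<Gamma>] by (auto simp: centralizer_def)
  qed
  then show "K = H" using K assms(4) by blast
qed

text \<open>Evaluates the unions over representatives in \<open>completion\<close>, once these are
  known to exist and to give the same class.\<close>

lemma UN_const: "\<lbrakk>S \<noteq> {}; \<And>x. x \<in> S \<Longrightarrow> f x = c\<rbrakk> \<Longrightarrow> (\<Union>x\<in>S. f x) = c"
  by auto

section \<open>Identification of the completion with the function model\<close>

context hausdorff_etale_groupoid
begin

lemma C_c_diff: "\<lbrakk>f \<in> C_c (gtop G); g \<in> C_c (gtop G)\<rbrakk> \<Longrightarrow> (\<lambda>\<gamma>. f \<gamma> - g \<gamma>) \<in> C_c (gtop G)"
  using C_c_add[OF Hausdorff, of f "\<lambda>\<gamma>. (-1) * g \<gamma>"] C_c_scale[OF Hausdorff, of g "-1"] by simp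

lemma dst_convolution_algebra: "dst (convolution_algebra G) f g = reduced_norm G (\<lambda>\<gamma>. f \<gamma> - g \<gamma>)"
  by (simp add: dst_def convolution_algebra_def)

text \<open>Together with \<open>dst_le\<close> this trades the reduced norm for \<open>opb\<close>.
  The Cauchy conditions are strict and \<open>opb\<close> is not, hence the passage to
  \<open>e/2\<close> in one direction below.\<close>

lemma dst_lessD:
  assumes "f \<in> C_c (gtop G)" "g \<in> C_c (gtop G)" "dst (convolution_algebra G) f g < e"
  shows "opb (\<lambda>\<gamma>. f \<gamma> - g \<gamma>) e"
proof -
  obtain C where "opb (\<lambda>\<gamma>. f \<gamma> - g \<gamma>) C" using C_c_opb[OF C_c_diff[OF assms(1,2)]] by blast
  from opb_mono[OF opb_reduced_norm[OF this]] assms(3) show ?thesis by (simp add: dst_convolution_algebra)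
qed

lemma dst_le: "opb (\<lambda>\<gamma>. f \<gamma> - g \<gamma>) e \<Longrightarrow> dst (convolution_algebra G) f g \<le> e"
  by (simp add: dst_convolution_algebra reduced_norm_le)

lemma dst_nonneg: "\<lbrakk>f \<in> C_c (gtop G); g \<in> C_c (gtop G)\<rbrakk> \<Longrightarrow> 0 \<le> dst (convolution_algebra G) f g"
  using C_c_opb[OF C_c_diff] opb_reduced_norm opbD0 dst_convolution_algebra by metis

lemma cauchy_seqs_iff:
  "x \<in> cauchy_seqs (convolution_algebra G) \<longleftrightarrow> (\<forall>n. x n \<in> C_c (gtop G)) \<and>
     (\<forall>e>0. \<exists>N. \<forall>m\<ge>N. \<forall>n\<ge>N. opb (\<lambda>\<gamma>. x m \<gamma> - x n \<gamma>) e)"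
proof -
  have "(\<forall>e>0. \<exists>N. \<forall>m\<ge>N. \<forall>n\<ge>N. dst (convolution_algebra G) (x m) (x n) < e)
      \<longleftrightarrow> (\<forall>e>0. \<exists>N. \<forall>m\<ge>N. \<forall>n\<ge>N. opb (\<lambda>\<gamma>. x m \<gamma> - x n \<gamma>) e)" if x: "\<forall>n. x n \<in> C_c (gtop G)"
  proof (intro iffI allI impI)
    fix e :: real assume "\<forall>e>0. \<exists>N. \<forall>m\<ge>N. \<forall>n\<ge>N. dst (convolution_algebra G) (x m) (x n) < e" "e > 0"
    then show "\<exists>N. \<forall>m\<ge>N. \<forall>n\<ge>N. opb (\<lambda>\<gamma>. x m \<gamma> - x n \<gamma>) e" using dst_lessD x by meson
  next
    fix e :: real assume H: "\<forall>e>0. \<exists>N. \<forall>m\<ge>N. \<forall>n\<ge>N. opb (\<lambda>\<gamma>. x m \<gamma> - x n \<gamma>) e" and e: "e > 0"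
    then obtain N where "\<forall>m\<ge>N. \<forall>n\<ge>N. opb (\<lambda>\<gamma>. x m \<gamma> - x n \<gamma>) (e/2)" by (meson half_gt_zero)
    then have "\<forall>m\<ge>N. \<forall>n\<ge>N. dst (convolution_algebra G) (x m) (x n) \<le> e/2" using dst_le by blast
    then show "\<exists>N. \<forall>m\<ge>N. \<forall>n\<ge>N. dst (convolution_algebra G) (x m) (x n) < e" using e
      by (intro exI[of _ N]) fastforce
  qed
  moreover have "carrier (convolution_algebra G) = C_c (gtop G)" by (simp add: convolution_algebra_def)
  ultimately show ?thesis unfolding cauchy_seqs_def by blast
qed

lemma cauchy_rel_iff:
  "(x, y) \<in> cauchy_rel (convolution_algebra G) \<longleftrightarrow> x \<in> cauchy_seqs (convolution_algebra G) \<and>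
     y \<in> cauchy_seqs (convolution_algebra G) \<and> (\<forall>e>0. \<exists>N. \<forall>n\<ge>N. opb (\<lambda>\<gamma>. x n \<gamma> - y n \<gamma>) e)"
proof -
  have "(\<lambda>n. dst (convolution_algebra G) (x n) (y n)) \<longlonglongrightarrow> 0 \<longleftrightarrow> (\<forall>e>0. \<exists>N. \<forall>n\<ge>N. opb (\<lambda>\<gamma>. x n \<gamma> - y n \<gamma>) e)"
    if x: "\<forall>n. x n \<in> C_c (gtop G)" and y: "\<forall>n. y n \<in> C_c (gtop G)"
  proof -
    have nn: "norm (dst (convolution_algebra G) (x n) (y n) - 0) = dst (convolution_algebra G) (x n) (y n)" for n
      using dst_nonneg[of "x n" "y n"] x y by simp
    show ?thesis unfolding LIMSEQ_iff nn
    proof (intro iffI allI impI)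
      fix e :: real assume "\<forall>e>0. \<exists>N. \<forall>n\<ge>N. dst (convolution_algebra G) (x n) (y n) < e" "e > 0"
      then show "\<exists>N. \<forall>n\<ge>N. opb (\<lambda>\<gamma>. x n \<gamma> - y n \<gamma>) e" using dst_lessD x y by meson
    next
      fix e :: real assume H: "\<forall>e>0. \<exists>N. \<forall>n\<ge>N. opb (\<lambda>\<gamma>. x n \<gamma> - y n \<gamma>) e" and e: "e > 0"
      then obtain N where "\<forall>n\<ge>N. opb (\<lambda>\<gamma>. x n \<gamma> - y n \<gamma>) (e/2)" by (meson half_gt_zero)
      then have "\<forall>n\<ge>N. dst (convolution_algebra G) (x n) (y n) \<le> e/2" using dst_le by blast
      then show "\<exists>N. \<forall>n\<ge>N. dst (convolution_algebra G) (x n) (y n) < e" using e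
        by (intro exI[of _ N]) fastforce
    qed
  qed
  then show ?thesis unfolding cauchy_rel_def using cauchy_seqs_iff by auto
qed

text \<open>The element of the completion represented by \<open>a \<in> redc\<close>.\<close>

definition cl :: "('g \<Rightarrow> complex) \<Rightarrow> (nat \<Rightarrow> 'g \<Rightarrow> complex) set" where
  "cl a = {x. (\<forall>n. x n \<in> C_c (gtop G)) \<and> (\<forall>e>0. \<exists>N. \<forall>n\<ge>N. opb (\<lambda>\<gamma>. a \<gamma> - x n \<gamma>) e)}"

lemma clD:
  assumes "x \<in> cl a"
  shows "x n \<in> C_c (gtop G)" "e > 0 \<Longrightarrow> \<exists>N. \<forall>n\<ge>N. opb (\<lambda>\<gamma>. a \<gamma> - x n \<gamma>) e"
  using assms by (simp_all add: cl_def)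

lemma clI:
  assumes "\<And>n. x n \<in> C_c (gtop G)" "\<And>e. e > 0 \<Longrightarrow> \<exists>N. \<forall>n\<ge>N. opb (\<lambda>\<gamma>. a \<gamma> - x n \<gamma>) e"
  shows "x \<in> cl a"
  using assms by (simp add: cl_def)

lemma cl_add:
  assumes "x \<in> cl a" "y \<in> cl b"
  shows "(\<lambda>n \<gamma>. x n \<gamma> + y n \<gamma>) \<in> cl (\<lambda>\<gamma>. a \<gamma> + b \<gamma>)"
proof (rule clI)
  show "(\<lambda>\<gamma>. x n \<gamma> + y n \<gamma>) \<in> C_c (gtop G)" for n
    by (rule C_c_add[OF Hausdorff clD(1)[OF assms(1)] clD(1)[OF assms(2)]])
  fix e :: real assume "e > 0"
  then have e: "e/2 > 0" by simp
  obtain N where N: "\<forall>n\<ge>N. opb (\<lambda>\<gamma>. a \<gamma> - x n \<gamma>) (e/2)" using clD(2)[OF assms(1) e] by blast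
  obtain M where M: "\<forall>n\<ge>M. opb (\<lambda>\<gamma>. b \<gamma> - y n \<gamma>) (e/2)" using clD(2)[OF assms(2) e] by blast
  have "opb (\<lambda>\<gamma>. a \<gamma> + b \<gamma> - (x n \<gamma> + y n \<gamma>)) e" if "n \<ge> max N M" for n
    using opb_add[OF N[rule_format, of n] M[rule_format, of n]] that by (simp add: algebra_simps)
  then show "\<exists>N. \<forall>n\<ge>N. opb (\<lambda>\<gamma>. a \<gamma> + b \<gamma> - (x n \<gamma> + y n \<gamma>)) e" by blast
qed

lemma cl_scale:
  assumes "x \<in> cl a"
  shows "(\<lambda>n \<gamma>. c * x n \<gamma>) \<in> cl (\<lambda>\<gamma>. c * a \<gamma>)"
proof (rule clI)
  show "(\<lambda>\<gamma>. c * x n \<gamma>) \<in> C_c (gtop G)" for n by (rule C_c_scale[OF Hausdorff clD(1)[OF assms]])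
  fix e :: real assume e: "e > 0"
  let ?d = "e / (norm c + 1)"
  have p: "norm c + 1 > 0" by (simp add: add_nonneg_pos)
  obtain N where N: "\<forall>n\<ge>N. opb (\<lambda>\<gamma>. a \<gamma> - x n \<gamma>) ?d" using clD(2)[OF assms, of ?d] e p by auto
  have "norm c * ?d \<le> e" using e p by (simp add: field_simps)
  then have "opb (\<lambda>\<gamma>. c * a \<gamma> - c * x n \<gamma>) e" if "n \<ge> N" for n
    using opb_mono[OF opb_scale[OF N[rule_format, OF that], of c]] by (simp add: right_diff_distrib)
  then show "\<exists>N. \<forall>n\<ge>N. opb (\<lambda>\<gamma>. c * a \<gamma> - c * x n \<gamma>) e" by blast
qed

lemma cl_involution:
  assumes "x \<in> cl a"
  shows "(\<lambda>n. involution G (x n)) \<in> cl (involution G a)"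
proof (rule clI)
  show "involution G (x n) \<in> C_c (gtop G)" for n by (rule involution_C_c[OF clD(1)[OF assms]])
  fix e :: real assume "e > 0"
  then obtain N where N: "\<forall>n\<ge>N. opb (\<lambda>\<gamma>. a \<gamma> - x n \<gamma>) e" using clD(2)[OF assms] by blast
  have "(\<lambda>\<gamma>. involution G a \<gamma> - involution G (x n) \<gamma>) = involution G (\<lambda>\<gamma>. a \<gamma> - x n \<gamma>)" for n
    by (auto simp: involution_def)
  then show "\<exists>N. \<forall>n\<ge>N. opb (\<lambda>\<gamma>. involution G a \<gamma> - involution G (x n) \<gamma>) e"
    using N opb_involution by (intro exI[of _ N]) simp
qed

lemma cl_convolution:
  assumes "x \<in> cl a" "y \<in> cl b" "a \<in> redc" "b \<in> redc"
  shows "(\<lambda>n. convolution G (x n) (y n)) \<in> cl (convolution G a b)"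
proof (rule clI)
  show "convolution G (x n) (y n) \<in> C_c (gtop G)" for n
    by (rule convolution_C_c[OF clD(1)[OF assms(1)] clD(1)[OF assms(2)]])
  fix e :: real assume e: "e > 0"
  obtain A where A: "A > 0" "opb a A" using redc_opb_pos[OF assms(3)] by blast
  obtain B where B: "B > 0" "opb b B" using redc_opb_pos[OF assms(4)] by blast
  define d where "d = min 1 (e / (A + B + 2))"
  have ABp: "A + B + 2 > 0" using A B by simp
  have d: "d > 0" "d \<le> 1" "d * (A + B + 2) \<le> e"
    using e ABp by (auto simp: d_def min_le_iff_disj pos_le_divide_eq[symmetric])
  obtain N where N: "\<forall>n\<ge>N. opb (\<lambda>\<gamma>. a \<gamma> - x n \<gamma>) d" using clD(2)[OF assms(1) d(1)] by blast
  obtain M where M: "\<forall>n\<ge>M. opb (\<lambda>\<gamma>. b \<gamma> - y n \<gamma>) d" using clD(2)[OF assms(2) d(1)] by blast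
  have "opb (\<lambda>\<gamma>. convolution G a b \<gamma> - convolution G (x n) (y n) \<gamma>) e" if n: "n \<ge> max N M" for n
  proof -
    have f: "opb (\<lambda>\<gamma>. a \<gamma> - x n \<gamma>) d" and g: "opb (\<lambda>\<gamma>. b \<gamma> - y n \<gamma>) d" using N M n by auto
    have f': "opb (x n) (A + 1)" using opb_mono[OF opb_diff[OF A(2) f], of "A + 1"] d(2) by simp
    have g': "opb (y n) (B + 1)" using opb_mono[OF opb_diff[OF B(2) g], of "B + 1"] d(2) by simp
    have "opb (\<lambda>\<gamma>. convolution G a b \<gamma> - convolution G (x n) (y n) \<gamma>) (d * (B + 1) + (A + 1) * d)"
      by (rule convolution_diff_opb[OF opb_mono[OF A(2)] f' opb_mono[OF B(2)] g' f g]) simp_all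
    then show ?thesis by (rule opb_mono) (use d(3) in \<open>simp add: algebra_simps\<close>)
  qed
  then show "\<exists>N. \<forall>n\<ge>N. opb (\<lambda>\<gamma>. convolution G a b \<gamma> - convolution G (x n) (y n) \<gamma>) e" by blast
qed

lemma cl_nonempty:
  assumes "a \<in> redc"
  shows "cl a \<noteq> {}"
proof -
  have "\<exists>f\<in>C_c (gtop G). opb (\<lambda>\<gamma>. a \<gamma> - f \<gamma>) (inverse (Suc n))" for n
    by (rule redc_approx[OF assms]) simp
  then obtain f where f: "\<And>n::nat. f n \<in> C_c (gtop G)" "\<And>n. opb (\<lambda>\<gamma>. a \<gamma> - f n \<gamma>) (inverse (Suc n))" by metis
  have "f \<in> cl a"
  proof (rule clI[OF f(1)])
    fix e :: real assume "e > 0"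
    then have "\<forall>\<^sub>F n in sequentially. inverse (Suc n) < e"
      using LIMSEQ_inverse_real_of_nat order_tendstoD(2) by blast
    then obtain N where N: "\<And>n. n \<ge> N \<Longrightarrow> inverse (Suc n) < e" by (auto simp: eventually_sequentially)
    have "opb (\<lambda>\<gamma>. a \<gamma> - f n \<gamma>) e" if "n \<ge> N" for n
      by (rule opb_mono[OF f(2) less_imp_le[OF N[OF that]]])
    then show "\<exists>N. \<forall>n\<ge>N. opb (\<lambda>\<gamma>. a \<gamma> - f n \<gamma>) e" by blast
  qed
  then show ?thesis by blast
qed

lemma cl_cauchy:
  assumes "x \<in> cl a"
  shows "x \<in> cauchy_seqs (convolution_algebra G)"
  unfolding cauchy_seqs_iff
proof (intro conjI allI impI)
  show "x n \<in> C_c (gtop G)" for n by (rule clD(1)[OF assms])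
  fix e :: real assume "e > 0"
  then have e: "e/2 > 0" by simp
  obtain N where N: "\<forall>n\<ge>N. opb (\<lambda>\<gamma>. a \<gamma> - x n \<gamma>) (e/2)" using clD(2)[OF assms e] by blast
  have "opb (\<lambda>\<gamma>. x m \<gamma> - x n \<gamma>) e" if "m \<ge> N" "n \<ge> N" for m n
    using opb_diff[OF N[rule_format, OF that(2)] N[rule_format, OF that(1)]] by simp
  then show "\<exists>N. \<forall>m\<ge>N. \<forall>n\<ge>N. opb (\<lambda>\<gamma>. x m \<gamma> - x n \<gamma>) e" by blast
qed

text \<open>Sequences at distance tending to 0 approximate the same function and conversely, so a
  class is determined by the limit function of any one of its members.\<close>

lemma cauchy_rel_class:
  assumes "x \<in> cl a"
  shows "cauchy_rel (convolution_algebra G) `` {x} = cl a"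
proof (intro Set.set_eqI iffI)
  fix y assume "y \<in> cauchy_rel (convolution_algebra G) `` {x}"
  then have y: "y \<in> cauchy_seqs (convolution_algebra G)" "\<forall>e>0. \<exists>N. \<forall>n\<ge>N. opb (\<lambda>\<gamma>. x n \<gamma> - y n \<gamma>) e"
    by (auto simp: cauchy_rel_iff)
  show "y \<in> cl a"
  proof (rule clI)
    show "y n \<in> C_c (gtop G)" for n using y(1) by (simp add: cauchy_seqs_iff)
    fix e :: real assume "e > 0"
    then have e: "e/2 > 0" by simp
    obtain N where N: "\<forall>n\<ge>N. opb (\<lambda>\<gamma>. a \<gamma> - x n \<gamma>) (e/2)" using clD(2)[OF assms e] by blast
    obtain M where M: "\<forall>n\<ge>M. opb (\<lambda>\<gamma>. x n \<gamma> - y n \<gamma>) (e/2)" using y(2) e by blast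
    have "opb (\<lambda>\<gamma>. a \<gamma> - y n \<gamma>) e" if "n \<ge> max N M" for n
      using opb_add[OF N[rule_format, of n] M[rule_format, of n]] that by simp
    then show "\<exists>N. \<forall>n\<ge>N. opb (\<lambda>\<gamma>. a \<gamma> - y n \<gamma>) e" by blast
  qed
next
  fix y assume y: "y \<in> cl a"
  have "\<exists>N. \<forall>n\<ge>N. opb (\<lambda>\<gamma>. x n \<gamma> - y n \<gamma>) e" if "e > 0" for e
  proof -
    have e: "e/2 > 0" using that by simp
    obtain N where N: "\<forall>n\<ge>N. opb (\<lambda>\<gamma>. a \<gamma> - x n \<gamma>) (e/2)" using clD(2)[OF assms e] by blast
    obtain M where M: "\<forall>n\<ge>M. opb (\<lambda>\<gamma>. a \<gamma> - y n \<gamma>) (e/2)" using clD(2)[OF y e] by blast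
    have "opb (\<lambda>\<gamma>. x n \<gamma> - y n \<gamma>) e" if "n \<ge> max N M" for n
      using opb_diff[OF M[rule_format, of n] N[rule_format, of n]] that by simp
    then show ?thesis by blast
  qed
  then show "y \<in> cauchy_rel (convolution_algebra G) `` {x}"
    using cl_cauchy[OF assms] cl_cauchy[OF y] by (auto simp: cauchy_rel_iff)
qed

lemma cauchy_seq_in_cl:
  assumes "x \<in> cauchy_seqs (convolution_algebra G)"
  obtains a where "a \<in> redc" "x \<in> cl a"
proof -
  have x: "\<And>n. x n \<in> C_c (gtop G)" "\<And>e. e > 0 \<Longrightarrow> \<exists>N. \<forall>m\<ge>N. \<forall>n\<ge>N. opb (\<lambda>\<gamma>. x m \<gamma> - x n \<gamma>) e"
    using assms by (auto simp: cauchy_seqs_iff)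
  obtain a where "a \<in> redc" "\<And>e. e > 0 \<Longrightarrow> \<exists>N. \<forall>n\<ge>N. opb (\<lambda>\<gamma>. a \<gamma> - x n \<gamma>) e"
    using redc_complete[OF C_c_redc[OF x(1)] x(2)] by metis
  then show ?thesis using that x(1) by (simp add: cl_def)
qed

lemma carrier_reduced_Cstar: "carrier (reduced_Cstar G) = cl ` redc"
proof -
  have "carrier (reduced_Cstar G) = cauchy_seqs (convolution_algebra G) // cauchy_rel (convolution_algebra G)"
    by (simp add: reduced_Cstar_def completion_def)
  also have "\<dots> = cl ` redc"
  proof (intro Set.set_eqI iffI)
    fix X assume "X \<in> cauchy_seqs (convolution_algebra G) // cauchy_rel (convolution_algebra G)"
    then obtain x where x: "x \<in> cauchy_seqs (convolution_algebra G)" "X = cauchy_rel (convolution_algebra G) `` {x}"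
      by (auto simp: quotient_def)
    obtain a where "a \<in> redc" "x \<in> cl a" using cauchy_seq_in_cl[OF x(1)] by blast
    then show "X \<in> cl ` redc" using x(2) cauchy_rel_class by blast
  next
    fix X assume "X \<in> cl ` redc"
    then obtain a where a: "a \<in> redc" "X = cl a" by blast
    obtain x where x: "x \<in> cl a" using cl_nonempty[OF a(1)] by blast
    show "X \<in> cauchy_seqs (convolution_algebra G) // cauchy_rel (convolution_algebra G)"
      using cauchy_rel_class[OF x] a(2) quotientI[OF cl_cauchy[OF x], of "cauchy_rel (convolution_algebra G)"] by simp
  qed
  finally show ?thesis .
qed

text \<open>Operator bounds control the values at all arrows, so a sequence determines its limit
  function.\<close>

lemma cl_inj:
  assumes "a \<in> redc" "b \<in> redc" "cl a = cl b"
  shows "a = b"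
proof
  fix \<gamma>
  show "a \<gamma> = b \<gamma>"
  proof (cases "\<gamma> \<in> arrows G")
    case True
    obtain x where x: "x \<in> cl a" using cl_nonempty[OF assms(1)] by blast
    have "norm (a \<gamma> - b \<gamma>) \<le> 2 * e" if e: "e > 0" for e
    proof -
      obtain N where N: "\<forall>n\<ge>N. opb (\<lambda>\<gamma>. a \<gamma> - x n \<gamma>) e" using clD(2)[OF x e] by blast
      obtain M where M: "\<forall>n\<ge>M. opb (\<lambda>\<gamma>. b \<gamma> - x n \<gamma>) e" using clD(2)[of x b] x assms(3) e by blast
      have "opb (\<lambda>\<gamma>. a \<gamma> - b \<gamma>) (e + e)"
        using opb_diff[OF N[rule_format, of "max N M"] M[rule_format, of "max N M"]] by simp
      from opb_pointwise[OF this True] show ?thesis by simp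
    qed
    then have "norm (a \<gamma> - b \<gamma>) \<le> 0" by (rule le_zero_if_le_mult[rotated]) simp_all
    then show ?thesis by simp
  next
    case False then show ?thesis by (simp add: redc_outside[OF assms(1)] redc_outside[OF assms(2)])
  qed
qed

lemma reduced_Cstar_operations:
  assumes "a \<in> redc" "b \<in> redc"
  shows "add (reduced_Cstar G) (cl a) (cl b) = cl (\<lambda>\<gamma>. a \<gamma> + b \<gamma>)"
    and "scale (reduced_Cstar G) c (cl a) = cl (\<lambda>\<gamma>. c * a \<gamma>)"
    and "times (reduced_Cstar G) (cl a) (cl b) = cl (convolution G a b)"
    and "star (reduced_Cstar G) (cl a) = cl (involution G a)"
proof -
  note ne = cl_nonempty[OF assms(1)] cl_nonempty[OF assms(2)]
  have ops: "add (convolution_algebra G) = (\<lambda>f g \<alpha>. f \<alpha> + g \<alpha>)" "scale (convolution_algebra G) = (\<lambda>c f \<alpha>. c * f \<alpha>)"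
    "times (convolution_algebra G) = convolution G" "star (convolution_algebra G) = involution G"
    by (simp_all add: convolution_algebra_def)
  show "add (reduced_Cstar G) (cl a) (cl b) = cl (\<lambda>\<gamma>. a \<gamma> + b \<gamma>)"
    unfolding reduced_Cstar_def completion_def normed_star_algebra.simps ops
    by (intro UN_const ne cauchy_rel_class cl_add)
  show "scale (reduced_Cstar G) c (cl a) = cl (\<lambda>\<gamma>. c * a \<gamma>)"
    unfolding reduced_Cstar_def completion_def normed_star_algebra.simps ops
    by (intro UN_const ne cauchy_rel_class cl_scale)
  show "times (reduced_Cstar G) (cl a) (cl b) = cl (convolution G a b)"
    unfolding reduced_Cstar_def completion_def normed_star_algebra.simps ops
    by (intro UN_const ne cauchy_rel_class cl_convolution assms)
  show "star (reduced_Cstar G) (cl a) = cl (involution G a)"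
    unfolding reduced_Cstar_def completion_def normed_star_algebra.simps ops
    by (intro UN_const ne cauchy_rel_class cl_involution)
qed

lemma group_Aut_reduced_Cstar: "group (Aut (reduced_Cstar G))"
proof (rule group_Aut)
  note ops = reduced_Cstar_operations
  fix X assume "X \<in> carrier (reduced_Cstar G)"
  then obtain a where X: "a \<in> redc" "X = cl a" unfolding carrier_reduced_Cstar by blast
  show "scale (reduced_Cstar G) c X \<in> carrier (reduced_Cstar G)" for c
    unfolding X(2) ops(2)[OF X(1) X(1)] carrier_reduced_Cstar by (intro imageI redc_scale X)
  show "star (reduced_Cstar G) X \<in> carrier (reduced_Cstar G)"
    unfolding X(2) ops(4)[OF X(1) X(1)] carrier_reduced_Cstar by (intro imageI redc_involution X)
  fix Y assume "Y \<in> carrier (reduced_Cstar G)"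
  then obtain b where Y: "b \<in> redc" "Y = cl b" unfolding carrier_reduced_Cstar by blast
  show "add (reduced_Cstar G) X Y \<in> carrier (reduced_Cstar G)"
    unfolding X(2) Y(2) ops(1)[OF X(1) Y(1)] carrier_reduced_Cstar by (intro imageI redc_add X Y)
  show "times (reduced_Cstar G) X Y \<in> carrier (reduced_Cstar G)"
    unfolding X(2) Y(2) ops(3)[OF X(1) Y(1)] carrier_reduced_Cstar by (intro imageI redc_convolution X Y)
qed

text \<open>For functions supported on the units a supremum bound is an operator bound, so uniform
  convergence implies convergence in the algebra.\<close>

lemma C_0_embedding_eq:
  assumes f: "f \<in> C0"
  shows "C_0_embedding G f = cl f"
proof -
  let ?Y = "{y. (\<forall>n. y n \<in> C_c (unit_space G)) \<and> uniform_limit (units G) y f sequentially}"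
  have Y: "y \<in> cl f" if "y \<in> ?Y" for y
  proof (rule clI)
    show "y n \<in> C_c (gtop G)" for n using that by (simp add: C_c_units_iff)
    fix e :: real assume e: "e > 0"
    then have "\<forall>\<^sub>F n in sequentially. \<forall>x\<in>units G. dist (y n x) (f x) < e"
      using that by (simp add: uniform_limit_iff)
    then obtain N where N: "\<And>n x. \<lbrakk>n \<ge> N; x \<in> units G\<rbrakk> \<Longrightarrow> dist (y n x) (f x) < e"
      by (auto simp: eventually_sequentially)
    have "opb (\<lambda>\<gamma>. f \<gamma> - y n \<gamma>) e" if n: "n \<ge> N" for n
    proof (rule opb_unit_supported)
      fix \<gamma> assume "\<gamma> \<notin> units G"
      then show z: "f \<gamma> - y n \<gamma> = 0" using C0_outside[OF f] \<open>y \<in> ?Y\<close> by (simp add: C_c_units_iff)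
    next
      fix \<gamma>
      show "norm (f \<gamma> - y n \<gamma>) \<le> e"
      proof (cases "\<gamma> \<in> units G")
        case True then show ?thesis using N[OF n True] by (simp add: dist_norm norm_minus_commute)
      next
        case False
        then have "f \<gamma> - y n \<gamma> = 0" using C0_outside[OF f] \<open>y \<in> ?Y\<close> by (simp add: C_c_units_iff)
        then show ?thesis using e by simp
      qed
    qed
    then show "\<exists>N. \<forall>n\<ge>N. opb (\<lambda>\<gamma>. f \<gamma> - y n \<gamma>) e" by blast
  qed
  have "\<exists>g\<in>C_c (unit_space G). \<forall>x. norm (f x - g x) \<le> inverse (Suc n)" for n
  proof -
    have "(0::real) < inverse (Suc n)" by simp
    then obtain g where "g \<in> C_c (unit_space G)" "\<And>x. norm (f x - g x) \<le> inverse (Suc n)"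
      using C_0_approx[OF Hausdorff_unit_space f] by blast
    then show ?thesis by blast
  qed
  then obtain y where y: "\<And>n. y n \<in> C_c (unit_space G)" "\<And>n x. norm (f x - y n x) \<le> inverse (Suc n)" by metis
  have "uniform_limit (units G) y f sequentially"
    unfolding uniform_limit_iff
  proof (intro allI impI)
    fix e :: real assume "e > 0"
    then have "\<forall>\<^sub>F n in sequentially. inverse (Suc n) < e"
      using LIMSEQ_inverse_real_of_nat order_tendstoD(2) by blast
    then show "\<forall>\<^sub>F n in sequentially. \<forall>x\<in>units G. dist (y n x) (f x) < e"
    proof eventually_elim
      case (elim n)
      show ?case
      proof
        fix x show "dist (y n x) (f x) < e"
          using y(2)[of x n] elim by (simp add: dist_norm norm_minus_commute)
      qed
    qed
  qed
  \<comment> \<open>An approximating sequence has to exist, since otherwise the image under the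
    relation would be empty and not a class.\<close>
  then have ne: "?Y \<noteq> {}" using y(1) by blast
  have "C_0_embedding G f = (\<Union>y\<in>?Y. cauchy_rel (convolution_algebra G) `` {y})"
    unfolding C_0_embedding_def by (rule Image_eq_UN)
  also have "\<dots> = cl f" by (rule UN_const[OF ne]) (rule cauchy_rel_class[OF Y])
  finally show ?thesis .
qed

lemma C_0_units_eq: "C_0_units G = cl ` C0"
  unfolding C_0_units_def by (rule image_cong[OF refl]) (rule C_0_embedding_eq)

section \<open>Transport of automorphisms between the completion and the function model\<close>

definition uncl :: "(nat \<Rightarrow> 'g \<Rightarrow> complex) set \<Rightarrow> 'g \<Rightarrow> complex" where
  "uncl = inv_into redc cl"

lemma bij_betw_cl: "bij_betw cl redc (carrier (reduced_Cstar G))"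
  using cl_inj by (auto simp: bij_betw_def inj_on_def carrier_reduced_Cstar)

lemma uncl_cl: "a \<in> redc \<Longrightarrow> uncl (cl a) = a"
  unfolding uncl_def by (rule bij_betw_inv_into_left[OF bij_betw_cl])

lemma cl_uncl: "X \<in> carrier (reduced_Cstar G) \<Longrightarrow> cl (uncl X) = X"
  unfolding uncl_def by (rule bij_betw_inv_into_right[OF bij_betw_cl])

lemma bij_betw_uncl: "bij_betw uncl (carrier (reduced_Cstar G)) redc"
  unfolding uncl_def by (rule bij_betw_inv_into[OF bij_betw_cl])

lemma uncl_redc: "X \<in> carrier (reduced_Cstar G) \<Longrightarrow> uncl X \<in> redc"
  using bij_betw_uncl by (rule bij_betwE[rule_format])

lemma cl_carrier: "a \<in> redc \<Longrightarrow> cl a \<in> carrier (reduced_Cstar G)"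
  by (simp add: carrier_reduced_Cstar)

definition down :: "((nat \<Rightarrow> 'g \<Rightarrow> complex) set \<Rightarrow> (nat \<Rightarrow> 'g \<Rightarrow> complex) set) \<Rightarrow> ('g \<Rightarrow> complex) \<Rightarrow> 'g \<Rightarrow> complex" where
  "down \<phi> a = uncl (\<phi> (cl a))"

text \<open>The restriction to the carrier makes the map extensional, as membership in
  \<open>Bij\<close> demands.\<close>

definition up :: "(('g \<Rightarrow> complex) \<Rightarrow> 'g \<Rightarrow> complex) \<Rightarrow> (nat \<Rightarrow> 'g \<Rightarrow> complex) set \<Rightarrow> (nat \<Rightarrow> 'g \<Rightarrow> complex) set" where
  "up \<psi> = (\<lambda>X\<in>carrier (reduced_Cstar G). cl (\<psi> (uncl X)))"

lemma cl_down:
  assumes "\<phi> \<in> star_automorphisms (reduced_Cstar G)" "a \<in> redc"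
  shows "cl (down \<phi> a) = \<phi> (cl a)"
  unfolding down_def by (rule cl_uncl[OF star_automorphismsD(4)[OF assms(1) cl_carrier[OF assms(2)]]])

lemma down_automorphism:
  assumes \<phi>: "\<phi> \<in> star_automorphisms (reduced_Cstar G)"
  shows "redc_automorphism (down \<phi>)"
proof -
  note D = star_automorphismsD[OF \<phi>]
  have r: "down \<phi> a \<in> redc" if "a \<in> redc" for a
    unfolding down_def using that by (intro uncl_redc D cl_carrier)
  have eqI: "down \<phi> a = b" if "\<phi> (cl a) = cl b" "a \<in> redc" "b \<in> redc" for a b
    using that by (simp add: down_def uncl_cl)
  have "bij_betw (uncl \<circ> (\<phi> \<circ> cl)) redc redc"
    by (intro bij_betw_trans[OF bij_betw_trans[OF bij_betw_cl D(3)] bij_betw_uncl])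
  moreover have "uncl \<circ> (\<phi> \<circ> cl) = down \<phi>" by (auto simp: down_def)
  ultimately have b: "bij_betw (down \<phi>) redc redc" by simp
  note ops = reduced_Cstar_operations
  show ?thesis unfolding redc_automorphism_def
  proof (intro conjI allI ballI b)
    fix a c assume a: "a \<in> redc"
    note a' = cl_carrier[OF a] and ra = r[OF a] and d = cl_down[OF \<phi> a, symmetric]
    have "\<phi> (cl (\<lambda>\<gamma>. c * a \<gamma>)) = cl (\<lambda>\<gamma>. c * down \<phi> a \<gamma>)"
      using D(6)[OF a', of c] by (simp only: ops(2)[OF a a] ops(2)[OF ra ra] d)
    then show "down \<phi> (\<lambda>\<gamma>. c * a \<gamma>) = (\<lambda>\<gamma>. c * down \<phi> a \<gamma>)"
      by (rule eqI) (simp_all add: a ra)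
    have "\<phi> (cl (involution G a)) = cl (involution G (down \<phi> a))"
      using D(8)[OF a'] by (simp only: ops(4)[OF a a] ops(4)[OF ra ra] d)
    then show "down \<phi> (involution G a) = involution G (down \<phi> a)"
      by (rule eqI) (simp_all add: a ra)
  next
    fix a b assume a: "a \<in> redc" and b: "b \<in> redc"
    note a' = cl_carrier[OF a] cl_carrier[OF b] and ra = r[OF a] r[OF b]
      and d = cl_down[OF \<phi> a, symmetric] cl_down[OF \<phi> b, symmetric]
    have "\<phi> (cl (\<lambda>\<gamma>. a \<gamma> + b \<gamma>)) = cl (\<lambda>\<gamma>. down \<phi> a \<gamma> + down \<phi> b \<gamma>)"
      using D(5)[OF a'] by (simp only: ops(1)[OF a b] ops(1)[OF ra] d)
    then show "down \<phi> (\<lambda>\<gamma>. a \<gamma> + b \<gamma>) = (\<lambda>\<gamma>. down \<phi> a \<gamma> + down \<phi> b \<gamma>)"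
      by (rule eqI) (simp_all add: a b ra)
    have "\<phi> (cl (convolution G a b)) = cl (convolution G (down \<phi> a) (down \<phi> b))"
      using D(7)[OF a'] by (simp only: ops(3)[OF a b] ops(3)[OF ra] d)
    then show "down \<phi> (convolution G a b) = convolution G (down \<phi> a) (down \<phi> b)"
      by (rule eqI) (simp_all add: a b ra)
  qed
qed

lemma up_cl: "a \<in> redc \<Longrightarrow> up \<psi> (cl a) = cl (\<psi> a)"
  by (simp add: up_def cl_carrier uncl_cl)

lemma up_automorphism:
  assumes \<psi>: "redc_automorphism \<psi>"
  shows "up \<psi> \<in> star_automorphisms (reduced_Cstar G)"
proof -
  note D = redc_automorphismD[OF \<psi>] and ops = reduced_Cstar_operations
  let ?S = "carrier (reduced_Cstar G)"
  have "bij_betw (cl \<circ> (\<psi> \<circ> uncl)) ?S ?S"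
    by (intro bij_betw_trans[OF bij_betw_trans[OF bij_betw_uncl D(1)] bij_betw_cl])
  then have "bij_betw (up \<psi>) ?S ?S"
    by (rule bij_betw_cong[THEN iffD1, rotated]) (simp add: up_def)
  then have "up \<psi> \<in> Bij ?S" by (simp add: Bij_def up_def)
  moreover have "up \<psi> (add (reduced_Cstar G) (cl a) (cl b)) = add (reduced_Cstar G) (up \<psi> (cl a)) (up \<psi> (cl b))"
    "up \<psi> (times (reduced_Cstar G) (cl a) (cl b)) = times (reduced_Cstar G) (up \<psi> (cl a)) (up \<psi> (cl b))"
    "up \<psi> (scale (reduced_Cstar G) c (cl a)) = scale (reduced_Cstar G) c (up \<psi> (cl a))"
    "up \<psi> (star (reduced_Cstar G) (cl a)) = star (reduced_Cstar G) (up \<psi> (cl a))"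
    if ab: "a \<in> redc" "b \<in> redc" for a b c
    by (simp_all add: ops[OF ab] up_cl ab D ops[OF D(2)[OF ab(1)] D(2)[OF ab(2)]])
  ultimately show ?thesis unfolding star_automorphisms_def carrier_reduced_Cstar by blast
qed

text \<open>Products in \<open>Aut\<close> are compositions restricted to the carrier, so they can
  be compared on the classes \<open>cl a\<close>.\<close>

lemma star_automorphism_eqI:
  assumes "\<phi> \<in> star_automorphisms (reduced_Cstar G)" "\<psi> \<in> star_automorphisms (reduced_Cstar G)"
    "\<phi>' \<in> star_automorphisms (reduced_Cstar G)" "\<psi>' \<in> star_automorphisms (reduced_Cstar G)"
  shows "\<phi> \<otimes>\<^bsub>Aut (reduced_Cstar G)\<^esub> \<psi> = \<phi>' \<otimes>\<^bsub>Aut (reduced_Cstar G)\<^esub> \<psi>'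
    \<longleftrightarrow> (\<forall>a\<in>redc. \<phi> (\<psi> (cl a)) = \<phi>' (\<psi>' (cl a)))"
  unfolding mult_Aut[OF assms(1,2)] mult_Aut[OF assms(3,4)] compose_def
  by (auto simp: carrier_reduced_Cstar fun_eq_iff restrict_def)

lemma down_fixes_C0:
  assumes "\<phi> \<in> Aut_fixing (reduced_Cstar G) (C_0_units G)" "k \<in> C0"
  shows "down \<phi> k = k"
  using assms by (simp add: down_def Aut_fixing_def C_0_units_eq uncl_cl)

lemma Aut_fixing_commute:
  assumes "effective G" "\<phi> \<in> Aut_fixing (reduced_Cstar G) (C_0_units G)" "\<psi> \<in> Aut_fixing (reduced_Cstar G) (C_0_units G)"
  shows "\<phi> \<otimes>\<^bsub>Aut (reduced_Cstar G)\<^esub> \<psi> = \<psi> \<otimes>\<^bsub>Aut (reduced_Cstar G)\<^esub> \<phi>"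
proof -
  have s: "\<phi> \<in> star_automorphisms (reduced_Cstar G)" "\<psi> \<in> star_automorphisms (reduced_Cstar G)"
    using assms by (simp_all add: Aut_fixing_def carrier_Aut)
  note d = down_automorphism[OF s(1)] down_automorphism[OF s(2)]
  have "\<phi> (\<psi> (cl a)) = \<psi> (\<phi> (cl a))" if a: "a \<in> redc" for a
  proof -
    have "down \<phi> (down \<psi> a) = down \<psi> (down \<phi> a)"
      using automorphisms_fixing_C0_commute[OF assms(1) d(1) down_fixes_C0[OF assms(2)] d(2) down_fixes_C0[OF assms(3)] a] by simp
    then have "cl (down \<phi> (down \<psi> a)) = cl (down \<psi> (down \<phi> a))" by simp
    then show ?thesis
      by (simp add: cl_down s a redc_automorphismD(2)[OF d(1)] redc_automorphismD(2)[OF d(2)])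
  qed
  then show ?thesis by (simp add: star_automorphism_eqI[OF s s(2,1)])
qed

text \<open>Each \<open>Ad d\<close> fixes \<open>C0\<close>, so its lift by \<open>up\<close> is
  one of the automorphisms with which \<psi> commutes.\<close>

lemma centralizer_commutes_inner:
  assumes "\<psi> \<in> centralizer (Aut (reduced_Cstar G)) (Aut_fixing (reduced_Cstar G) (C_0_units G))"
  shows "\<psi> \<in> star_automorphisms (reduced_Cstar G)" "commutes_inner (down \<psi>)"
proof -
  show s: "\<psi> \<in> star_automorphisms (reduced_Cstar G)" using assms by (simp add: centralizer_def carrier_Aut)
  show "commutes_inner (down \<psi>)"
    unfolding commutes_inner_def
  proof (intro allI impI ballI)
    fix d a assume d: "quasi_unitary d" and a: "a \<in> redc"
    note D = redc_automorphismD(2)[OF down_automorphism[OF s]]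
    have u: "up (Ad d) \<in> star_automorphisms (reduced_Cstar G)" by (rule up_automorphism[OF Ad_automorphism[OF d]])
    then have "up (Ad d) \<in> Aut_fixing (reduced_Cstar G) (C_0_units G)"
      using Ad_C0[OF d] by (auto simp: Aut_fixing_def carrier_Aut C_0_units_eq up_cl)
    then have "\<psi> \<otimes>\<^bsub>Aut (reduced_Cstar G)\<^esub> up (Ad d) = up (Ad d) \<otimes>\<^bsub>Aut (reduced_Cstar G)\<^esub> \<psi>"
      using assms by (simp add: centralizer_def)
    then have "\<psi> (up (Ad d) (cl a)) = up (Ad d) (\<psi> (cl a))"
      using a by (simp add: star_automorphism_eqI[OF s u u s])
    then have "cl (down \<psi> (Ad d a)) = cl (Ad d (down \<psi> a))"
      using a D Ad_redc[OF d] by (simp add: up_cl cl_down[OF s] flip: cl_down[OF s])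
    then show "down \<psi> (Ad d a) = Ad d (down \<psi> a)"
      by (rule cl_inj[rotated 2]) (use a D Ad_redc[OF d] in simp_all)
  qed
qed

end

theorem theorem3p1p9:
  fixes G :: "'g topological_groupoid_data"
  assumes "etale_groupoid G"
    and "locally_compact_space (gtop G)"
    and "Hausdorff_space (gtop G)"
    and "effective G"
  shows "centralizer (Aut (reduced_Cstar G)) (Aut_fixing (reduced_Cstar G) (C_0_units G))
           \<subseteq> Aut_preserving (reduced_Cstar G) (C_0_units G)
         \<and> (enough_arrows G \<longrightarrow>
              maximal_abelian_subgroup (Aut_fixing (reduced_Cstar G) (C_0_units G))
                (Aut (reduced_Cstar G)))"
proof -
  interpret hausdorff_etale_groupoid G
    using assms by (intro hausdorff_etale_groupoid.intro hausdorff_etale_groupoid_axioms.intro)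
  let ?A = "reduced_Cstar G" and ?D = "C_0_units G"
  have image: "\<psi> ` ?D = cl ` down \<psi> ` C0" if "\<psi> \<in> star_automorphisms ?A" for \<psi>
    unfolding C_0_units_eq image_image by (intro image_cong refl) (simp add: cl_down[OF that])
  have "\<psi> \<in> Aut_preserving ?A ?D" if "\<psi> \<in> centralizer (Aut ?A) (Aut_fixing ?A ?D)" for \<psi>
  proof -
    note c = centralizer_commutes_inner[OF that]
    have "down \<psi> ` C0 = C0" by (rule commutes_inner_image_C0[OF assms(4) down_automorphism[OF c(1)] c(2)])
    then show ?thesis using c(1) image[OF c(1)] by (simp add: Aut_preserving_def carrier_Aut C_0_units_eq)
  qed
  moreover have "maximal_abelian_subgroup (Aut_fixing ?A ?D) (Aut ?A)" if en: "enough_arrows G"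
  proof (rule maximal_abelian_subgroupI[OF group_Aut_reduced_Cstar])
    show "subgroup (Aut_fixing ?A ?D) (Aut ?A)"
      by (rule subgroup_Aut_fixing[OF group_Aut_reduced_Cstar]) (auto simp: C_0_units_eq carrier_reduced_Cstar)
    show "\<phi> \<otimes>\<^bsub>Aut ?A\<^esub> \<psi> = \<psi> \<otimes>\<^bsub>Aut ?A\<^esub> \<phi>" if "\<phi> \<in> Aut_fixing ?A ?D" "\<psi> \<in> Aut_fixing ?A ?D" for \<phi> \<psi>
      by (rule Aut_fixing_commute[OF assms(4) that])
    \<comment> \<open>Maximality amounts to the centralizer being contained in the group itself;
      this is where enough arrows enter.\<close>
    show "centralizer (Aut ?A) (Aut_fixing ?A ?D) \<subseteq> Aut_fixing ?A ?D"
    proof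
      fix \<psi> assume "\<psi> \<in> centralizer (Aut ?A) (Aut_fixing ?A ?D)"
      note c = centralizer_commutes_inner[OF this]
      have "\<psi> (cl f) = cl f" if "f \<in> C0" for f
        using commutes_inner_fixes_C0[OF assms(4) en down_automorphism[OF c(1)] c(2) that] cl_down[OF c(1), of f] that by simp
      then show "\<psi> \<in> Aut_fixing ?A ?D" using c(1) by (auto simp: Aut_fixing_def carrier_Aut C_0_units_eq)
    qed
  qed
  ultimately show ?thesis by blast
qed

end
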